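(* Let $\tilde\theta=\{\tilde\theta_{ij}\}_{i,j\in I}$, $\tilde{\mathbf p}=\{\tilde p_i\}_{i\in I}$, $\theta=\{\theta_{ij}\}_{i,j\in I}$ and $\mathbf p=(\{p_{ij}\}_{i,j\in I},\{p_i\}_{i\in I})$ be families of invertible elements of $\Bbbk$ such that $1-\tilde p_i^n$ is invertible for all $i\in I$, $n\in\mathbb Z_{>0}$, and $$\tilde\theta_{ij}=\theta_{ij}p_{ji}^{-1},\qquad\tilde p_i^{a_{ij}}=p_{ij}^2,\qquad\tilde p_i=p_i^2,\qquad\tilde\theta_{ij}\tilde\theta_{ji}=\tilde p_i^{-a_{ij}}\ (i,j\in I),\qquad\tilde\theta_{ii}=\tilde p_i^{-1}.$$ Let $G\subset\mathrm P$ be a subset with $G+\mathrm Q\subset G$. Then: (i) $\theta$ and $\mathbf p$ satisfy: $p_{ij}^2=p_i^{2a_{ij}}$, $(p_{ij}p_{ji})/(\theta_{ij}\theta_{ji})=p_i^{2a_{ij}}$, $p_{ii}/\theta_{ii}=p_i^2$, and $1-p_i^n$ is invertible in $\Bbbk$ for any $i\in I$ and $n\in\mathbb Z_{>0}$. (ii) There exist equivalences of categories $$\mathrm{Mod}^G(\mathcal U_{\tilde\theta,\tilde{\mathbf p}}(\mathfrak g))\simeq\mathrm{Mod}^G(U_{\theta,\mathbf p}(\mathfrak g))\quad\text{and}\quad\mathcal O^G_{\rm int}(\mathcal U_{\tilde\theta,\tilde{\mathbf p}}(\mathfrak g))\simeq\mathcal O^G_{\rm int}(U_{\theta,\mathbf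 p}(\mathfrak g)).$$ (iii) The category $\mathrm{Mod}^G(\mathcal U_{\tilde\theta,\tilde{\mathbf p}}(\mathfrak g))$ depends, up to equivalence, only on the parameters $\{\tilde p_i\}_{i\in I}$ (which satisfy $\tilde p_i^{a_{ij}}=\tilde p_j^{a_{ji}}$): that is, for another family $\tilde\theta'$ for which $(\tilde\theta',\tilde{\mathbf p})$ satisfies the same conditions, $\mathrm{Mod}^G(\mathcal U_{\tilde\theta',\tilde{\mathbf p}}(\mathfrak g))\simeq\mathrm{Mod}^G(\mathcal U_{\tilde\theta,\tilde{\mathbf p}}(\mathfrak g))$.
   Context: **Cartan datum.** $I$ is an index set; $\mathsf A=(a_{ij})_{i,j\in I}$ is a symmetrizable Cartan matrix ($a_{ii}=2$, $a_{ij}\le0$ for $i\ne j$, $a_{ij}=0$ if $a_{ji}=0$, and $d_ia_{ij}=d_ja_{ji}$ for some positive integers $d_i$). $\mathrm P$ is a free abelian group, $\{\alpha_i\}\subset\mathrm P$ is linearly independent, $\{h_i\}\subset\mathrm{Hom}(\mathrm P,\mathbb Z)$, $\langle h_i,\alpha_j\rangle=a_{ij}$; $\mathrm Q=\bigoplus\mathbb Z\alpha_i$, $\mathrm Q^+=\sum\mathbb Z_{\ge0}\alpha_i$. $\Bbbk$ is a commutative ring. **$U_{\theta,\mathbf p}(\mathfrak g)$.** When $\theta,\mathbf p$ satisfy the conditions displayed in (i), put $c_{ij}=p_{ij}p_i^{-a_{ij}}$. $U_{\theta,\mathbf p}(\mathfrak g)$ is the $\Bbbk$-algebra generated by $e_i,f_i,K_i^{\pm1}$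 with relations $K_iK_j=K_jK_i$, $K_ie_jK_i^{-1}=p_{ij}e_j$, $K_if_jK_i^{-1}=p_{ij}^{-1}f_j$, $e_if_j-\theta_{ji}f_je_i=\delta_{ij}\frac{K_i-K_i^{-1}}{p_i-p_i^{-1}}$, and for $i\ne j$: $\sum_{k=0}^{1-a_{ij}}(-c_{ij}\theta_{ji}^{-1})^kf_i^{(1-a_{ij}-k)}f_jf_i^{(k)}=0$, $\sum_{k=0}^{1-a_{ij}}(-c_{ij}\theta_{ij})^ke_i^{(1-a_{ij}-k)}e_je_i^{(k)}=0$, where $x^{(n)}=x^n/\prod_{k=1}^n\frac{p_i^k-p_i^{-k}}{p_i-p_i^{-1}}$ for $x=e_i,f_i$. **$\mathcal U_{\tilde\theta,\tilde{\mathbf p}}(\mathfrak g)$.** The $\Bbbk$-algebra generated by $e_i,f_i,\tilde K_i^{\pm1}$ with relations $\tilde K_i\tilde K_j=\tilde K_j\tilde K_i$, $\tilde K_ie_j\tilde K_i^{-1}=\tilde p_i^{a_{ij}}e_j$, $\tilde K_if_j\tilde K_i^{-1}=\tilde p_i^{-a_{ij}}f_j$, $e_if_j-\tilde\theta_{ji}f_je_i=\delta_{ij}\frac{1-\tilde K_i}{1-\tilde p_i}$, and for $i\ne j$: $\sum_{k=0}^{1-a_{ij}}(-\tilde\theta_{ji})^{-k}\tilde p_i^{k(k-1)/2}f_i^{\langle1-a_{ij}-k\rangle}f_jf_i^{\langle k\rangle}=0$, $\sum_{k=0}^{1-a_{ij}}(-\tilde\theta_{ij})^{-k}\tilde p_i^{k(k-1)/2}e_i^{\langle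 k\rangle}e_je_i^{\langle1-a_{ij}-k\rangle}=0$, where $x^{\langle n\rangle}=x^n/\prod_{k=1}^n\frac{1-\tilde p_i^k}{1-\tilde p_i}$ for $x=e_i,f_i$. Both algebras are $\mathrm Q$-graded with $e_i,f_i$ of degree $\alpha_i,-\alpha_i$ and $K_i,\tilde K_i$ of degree $0$. **Weighted modules.** Fix functions $\chi_i:G\to\Bbbk^\times$ with $\chi_i(\lambda)^2=p_i^{2\langle h_i,\lambda\rangle}$ and $\chi_i(\lambda+\alpha_j)=p_{ij}\chi_i(\lambda)$ (these exist, and different choices give equivalent categories). $\mathrm{Mod}^G(\mathcal A)$ is the category of $\mathcal A$-modules $V=\bigoplus_{\mu\in G}V_\mu$ with $\mathcal A_\alpha V_\mu\subset V_{\mu+\alpha}$ and with $K_i|_{V_\mu}=\chi_i(\mu)$ for $\mathcal A=U_{\theta,\mathbf p}(\mathfrak g)$, resp. $\tilde K_i|_{V_\mu}=\tilde p_i^{\langle h_i,\mu\rangle}$ for $\mathcal A=\mathcal U_{\tilde\theta,\tilde{\mathbf p}}(\mathfrak g)$. $\mathcal O^G_{\rm int}(\mathcal A)$ is the full subcategory of those $V$ with all $V_\lambda$ finite-dimensional, weights in a finite union of sets $\lambda_s-\mathrm Q^+$ ($\lambda_s\in G$), and all $e_i,f_i$ locally nilpotent. *)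

theory Defs
  imports
    Complex_Main
    "HOL-Algebra.QuotRing"
    "HOL-Algebra.Module"
    "HOL-Library.Poly_Mapping"
    "HOL-Library.FuncSet"
begin

section \<open>Integer multiples and integer powers of units\<close>

definition zmul :: "int \<Rightarrow> 'p::ab_group_add \<Rightarrow> 'p"
  where "zmul n x = (if 0 \<le> n then ((+) x ^^ nat n) 0 else - ((+) x ^^ nat (- n)) 0)"

lemma zmul_0 [simp]: "zmul 0 x = 0"
  by (simp add: zmul_def)

lemma zmul_add_1: "zmul (n + 1) x = zmul n x + x"
proof (cases "0 \<le> n")
  case True
  then show ?thesis by (simp add: zmul_def nat_add_distrib)
next
  case False
  then have "nat (- n) = Suc (nat (- (n + 1)))" by simp
  then show ?thesis using False
    by (cases "n = -1") (simp_all add: zmul_def)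
qed

lemma zmul_diff_1: "zmul (n - 1) x = zmul n x - x"
  using zmul_add_1[of "n - 1" x] by (simp add: algebra_simps)

lemma zmul_add_left: "zmul (n + m) x = zmul n x + zmul m x"
proof (induction m rule: int_induct[where k = 0])
  case base
  show ?case by simp
next
  case (step1 m)
  have "zmul (n + (m + 1)) x = zmul (n + m) x + x"
    using zmul_add_1[of "n + m" x] by (simp add: add.assoc)
  then show ?case using step1 zmul_add_1[of m x] by (simp add: add.assoc)
next
  case (step2 m)
  have "zmul (n + (m - 1)) x = zmul (n + m - 1) x" by (simp add: algebra_simps)
  then show ?case by (simp add: zmul_diff_1 step2)
qed

interpretation zmod: Modules.module zmul
proof
  fix n m :: int and x y :: "'p::ab_group_add"
  show "zmul n (x + y) = zmul n x + zmul n y"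
    by (induction n rule: int_induct[where k = 0])
       (simp_all add: zmul_add_1 zmul_diff_1)
  show "zmul (n + m) x = zmul n x + zmul m x"
    by (rule zmul_add_left)
  show "zmul n (zmul m x) = zmul (n * m) x"
  proof (induction n rule: int_induct[where k = 0])
    case base
    show ?case by simp
  next
    case (step1 n)
    have "zmul ((n + 1) * m) x = zmul (n * m) x + zmul m x"
      by (simp only: distrib_right mult_1 zmul_add_left)
    then show ?case using step1 zmul_add_1[of n "zmul m x"] by simp
  next
    case (step2 n)
    have "zmul (n * m) x = zmul ((n - 1) * m + m) x" by (simp add: algebra_simps)
    then show ?case by (simp add: zmul_diff_1 zmul_add_left step2)
  qed
  show "zmul 1 x = x"
    by (simp add: zmul_def)
qed

text \<open>The inverse of a unit of a commutative ring; meaningless on non-units.\<close>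

definition uinv :: "'k::comm_ring_1 \<Rightarrow> 'k"
  where "uinv x = (THE y. x * y = 1)"

lemma uinv_eqI: "x * y = 1 \<Longrightarrow> uinv x = (y :: 'k::comm_ring_1)"
  unfolding uinv_def by (rule the_equality) (auto, metis mult.assoc mult.commute mult_1)

lemma mult_uinv: "x dvd 1 \<Longrightarrow> x * uinv x = (1 :: 'k::comm_ring_1)"
  by (metis dvdE uinv_eqI)

definition upow :: "'k::comm_ring_1 \<Rightarrow> int \<Rightarrow> 'k"
  where "upow x n = (if 0 \<le> n then x ^ nat n else uinv x ^ nat (- n))"


section \<open>Cartan data\<close>

locale cartan_datum =
  fixes a :: "'i \<Rightarrow> 'i \<Rightarrow> int"
    and \<alpha> :: "'i \<Rightarrow> 'p::ab_group_add"
    and h :: "'i \<Rightarrow> 'p \<Rightarrow> int"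
  assumes a_diag: "a i i = 2"
    and a_offdiag: "i \<noteq> j \<Longrightarrow> a i j \<le> 0"
    and a_zero: "a j i = 0 \<Longrightarrow> a i j = 0"
    and a_symmetrizable: "\<exists>d :: 'i \<Rightarrow> int. (\<forall>i. 0 < d i) \<and> (\<forall>i j. d i * a i j = d j * a j i)"
    and P_free: "\<exists>B :: 'p set. zmod.independent B \<and> zmod.span B = UNIV"
    and \<alpha>_inj: "inj \<alpha>"
    and \<alpha>_independent: "zmod.independent (range \<alpha>)"
    and h_add: "h i (x + y) = h i x + h i y"
    and h_\<alpha>: "h i (\<alpha> j) = a i j"

definition root_lattice :: "('i \<Rightarrow> 'p::ab_group_add) \<Rightarrow> 'p set"
  where "root_lattice \<alpha> = zmod.span (range \<alpha>)"

definition pos_root_cone :: "('i \<Rightarrow> 'p::ab_group_add) \<Rightarrow> 'p set"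
  where "pos_root_cone \<alpha> = {\<Sum>i\<in>S. zmul (int (n i)) (\<alpha> i) | S n. finite S}"


section \<open>Algebras presented by generators and relations\<close>

text \<open>
  The free associative algebra on \<open>'g\<close> is the monoid algebra of the free monoid on \<open>'g\<close>.  The type
  of finitely supported functions carries the convolution product once its index type is an
  additive monoid, so concatenation of words is written as (non-commutative) addition.
\<close>

datatype 'g word = Word (letters: "'g list")

instantiation word :: (type) monoid_add
begin

definition zero_word :: "'a word"
  where "0 = Word []"

definition plus_word :: "'a word \<Rightarrow> 'a word \<Rightarrow> 'a word"
  where "v + w = Word (letters v @ letters w)"

instance
  by standard (simp_all add: zero_word_def plus_word_def)

end

type_synonym ('g, 'k) falg = "'g word \<Rightarrow>\<^sub>0 'k"

definition var :: "'g \<Rightarrow> ('g, 'k::comm_ring_1) falg"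
  where "var g = Poly_Mapping.single (Word [g]) 1"

definition scal :: "'k \<Rightarrow> ('g, 'k::comm_ring_1) falg"
  where "scal c = Poly_Mapping.single 0 c"

definition free_alg :: "('g, 'k::comm_ring_1) falg ring"
  where "free_alg = \<lparr>carrier = UNIV, mult = (*), one = 1, zero = 0, add = (+)\<rparr>"

lemma free_alg_ring: "ring (free_alg :: ('g, 'k::comm_ring_1) falg ring)"
proof (rule ringI)
  show "abelian_group (free_alg :: ('g, 'k) falg ring)"
    by (rule abelian_groupI) (auto simp: free_alg_def algebra_simps intro: exI[of _ "- _"])
  show "Group.monoid (free_alg :: ('g, 'k) falg ring)"
    by (rule monoidI) (auto simp: free_alg_def mult.assoc)
qed (auto simp: free_alg_def algebra_simps)

definition presented_alg :: "('g, 'k::comm_ring_1) falg set \<Rightarrow> ('g, 'k) falg set ring"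
  where "presented_alg R = free_alg Quot (Idl\<^bsub>free_alg\<^esub> R)"

lemma presented_alg_ring: "ring (presented_alg R)"
  unfolding presented_alg_def
  by (intro ideal.quotient_is_ring ring.genideal_ideal free_alg_ring) (simp add: free_alg_def)

definition alg_class :: "('g, 'k::comm_ring_1) falg set \<Rightarrow> ('g, 'k) falg \<Rightarrow> ('g, 'k) falg set"
  where "alg_class R x = (Idl\<^bsub>free_alg\<^esub> R) +>\<^bsub>free_alg\<^esub> x"


section \<open>The algebras \<open>U\<^sub>\<theta>\<^sub>,\<^sub>p(g)\<close> and their tilde variants\<close>

datatype 'i gen = E 'i | F 'i | K 'i | Kinv 'i

text \<open>\<open>divpow d x n\<close> is $x^n$ divided by \<open>d n\<close>.\<close>

definition divpow :: "(nat \<Rightarrow> 'k) \<Rightarrow> ('g, 'k::comm_ring_1) falg \<Rightarrow> nat \<Rightarrow> ('g, 'k) falg"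
  where "divpow d x n = scal (uinv (d n)) * x ^ n"

definition U_fact :: "'k::comm_ring_1 \<Rightarrow> nat \<Rightarrow> 'k"
  where "U_fact p n = (\<Prod>k=1..n. (upow p (int k) - upow p (- int k)) * uinv (p - uinv p))"

text \<open>
  In \<open>U_rels\<close>, \<open>p\<close> is the family $p_i$, \<open>pp\<close> is the family $p_{ij}$, and
  \<open>pp i j * upow (p i) (- a i j)\<close> is the constant $c_{ij}$.  In \<open>Ut_rels\<close>, all parameters are
  the ones with tildes and \<open>K i\<close> stands for $\tilde K_i$.
\<close>

definition U_rels ::
  "('i \<Rightarrow> 'i \<Rightarrow> int) \<Rightarrow> ('i \<Rightarrow> 'i \<Rightarrow> 'k) \<Rightarrow> ('i \<Rightarrow> 'i \<Rightarrow> 'k) \<Rightarrow> ('i \<Rightarrow> 'k::comm_ring_1)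
    \<Rightarrow> ('i gen, 'k) falg set"
  where "U_rels a \<theta> pp p =
    {var (K i) * var (Kinv i) - 1 | i. True} \<union>
    {var (Kinv i) * var (K i) - 1 | i. True} \<union>
    {var (K i) * var (K j) - var (K j) * var (K i) | i j. True} \<union>
    {var (K i) * var (E j) * var (Kinv i) - scal (pp i j) * var (E j) | i j. True} \<union>
    {var (K i) * var (F j) * var (Kinv i) - scal (uinv (pp i j)) * var (F j) | i j. True} \<union>
    {var (E i) * var (F j) - scal (\<theta> j i) * var (F j) * var (E i)
      - (if i = j then scal (uinv (p i - uinv (p i))) * (var (K i) - var (Kinv i)) else 0)
      | i j. True} \<union>
    {\<Sum>k=0..nat (1 - a i j).
        scal ((- (pp i j * upow (p i) (- a i j) * uinv (\<theta> j i))) ^ k)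
          * divpow (U_fact (p i)) (var (F i)) (nat (1 - a i j) - k) * var (F j)
          * divpow (U_fact (p i)) (var (F i)) k
      | i j. i \<noteq> j} \<union>
    {\<Sum>k=0..nat (1 - a i j).
        scal ((- (pp i j * upow (p i) (- a i j) * \<theta> i j)) ^ k)
          * divpow (U_fact (p i)) (var (E i)) (nat (1 - a i j) - k) * var (E j)
          * divpow (U_fact (p i)) (var (E i)) k
      | i j. i \<noteq> j}"

definition Ut_fact :: "'k::comm_ring_1 \<Rightarrow> nat \<Rightarrow> 'k"
  where "Ut_fact p n = (\<Prod>k=1..n. (1 - p ^ k) * uinv (1 - p))"

definition Ut_rels ::
  "('i \<Rightarrow> 'i \<Rightarrow> int) \<Rightarrow> ('i \<Rightarrow> 'i \<Rightarrow> 'k) \<Rightarrow> ('i \<Rightarrow> 'k::comm_ring_1) \<Rightarrow> ('i gen, 'k) falg set"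
  where "Ut_rels a \<theta> p =
    {var (K i) * var (Kinv i) - 1 | i. True} \<union>
    {var (Kinv i) * var (K i) - 1 | i. True} \<union>
    {var (K i) * var (K j) - var (K j) * var (K i) | i j. True} \<union>
    {var (K i) * var (E j) * var (Kinv i) - scal (upow (p i) (a i j)) * var (E j) | i j. True} \<union>
    {var (K i) * var (F j) * var (Kinv i) - scal (upow (p i) (- a i j)) * var (F j) | i j. True} \<union>
    {var (E i) * var (F j) - scal (\<theta> j i) * var (F j) * var (E i)
      - (if i = j then scal (uinv (1 - p i)) * (1 - var (K i)) else 0)
      | i j. True} \<union>
    {\<Sum>k=0..nat (1 - a i j).
        scal (upow (- \<theta> j i) (- int k) * p i ^ (k * (k - 1) div 2))
          * divpow (Ut_fact (p i)) (var (F i)) (nat (1 - a i j) - k) * var (F j)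
          * divpow (Ut_fact (p i)) (var (F i)) k
      | i j. i \<noteq> j} \<union>
    {\<Sum>k=0..nat (1 - a i j).
        scal (upow (- \<theta> i j) (- int k) * p i ^ (k * (k - 1) div 2))
          * divpow (Ut_fact (p i)) (var (E i)) k * var (E j)
          * divpow (Ut_fact (p i)) (var (E i)) (nat (1 - a i j) - k)
      | i j. i \<noteq> j}"

fun gen_degree :: "('i \<Rightarrow> 'p::ab_group_add) \<Rightarrow> 'i gen \<Rightarrow> 'p"
  where
    "gen_degree \<alpha> (E i) = \<alpha> i"
  | "gen_degree \<alpha> (F i) = - \<alpha> i"
  | "gen_degree \<alpha> (K i) = 0"
  | "gen_degree \<alpha> (Kinv i) = 0"

definition word_degree :: "('i \<Rightarrow> 'p::ab_group_add) \<Rightarrow> 'i gen word \<Rightarrow> 'p"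
  where "word_degree \<alpha> w = sum_list (map (gen_degree \<alpha>) (letters w))"

definition graded_piece ::
  "('i gen, 'k::comm_ring_1) falg set \<Rightarrow> ('i \<Rightarrow> 'p::ab_group_add) \<Rightarrow> 'p \<Rightarrow> ('i gen, 'k) falg set set"
  where "graded_piece R \<alpha> \<beta> = {alg_class R x | x. \<forall>w\<in>Poly_Mapping.keys x. word_degree \<alpha> w = \<beta>}"


section \<open>Categories and equivalences\<close>

text \<open>\<open>Comp C X Y Z g f\<close> is the composite of \<open>f\<close> from \<open>X\<close> to \<open>Y\<close> and \<open>g\<close> from \<open>Y\<close> to \<open>Z\<close>.\<close>

record ('o, 'm) cat =
  Ob :: "'o set"
  Hom :: "'o \<Rightarrow> 'o \<Rightarrow> 'm set"
  Id :: "'o \<Rightarrow> 'm"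
  Comp :: "'o \<Rightarrow> 'o \<Rightarrow> 'o \<Rightarrow> 'm \<Rightarrow> 'm \<Rightarrow> 'm"

locale is_category =
  fixes C :: "('o, 'm) cat"
  assumes Id_in: "X \<in> Ob C \<Longrightarrow> Id C X \<in> Hom C X X"
    and Comp_in: "\<lbrakk>X \<in> Ob C; Y \<in> Ob C; Z \<in> Ob C; f \<in> Hom C X Y; g \<in> Hom C Y Z\<rbrakk>
      \<Longrightarrow> Comp C X Y Z g f \<in> Hom C X Z"
    and Comp_Id_right: "\<lbrakk>X \<in> Ob C; Y \<in> Ob C; f \<in> Hom C X Y\<rbrakk> \<Longrightarrow> Comp C X X Y f (Id C X) = f"
    and Comp_Id_left: "\<lbrakk>X \<in> Ob C; Y \<in> Ob C; f \<in> Hom C X Y\<rbrakk> \<Longrightarrow> Comp C X Y Y (Id C Y) f = f"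
    and Comp_assoc: "\<lbrakk>W \<in> Ob C; X \<in> Ob C; Y \<in> Ob C; Z \<in> Ob C;
        f \<in> Hom C W X; g \<in> Hom C X Y; k \<in> Hom C Y Z\<rbrakk>
      \<Longrightarrow> Comp C W Y Z k (Comp C W X Y g f) = Comp C W X Z (Comp C X Y Z k g) f"

locale is_functor =
  source: is_category C + target: is_category D
  for C :: "('o1, 'm1) cat" and D :: "('o2, 'm2) cat" +
  fixes Fo :: "'o1 \<Rightarrow> 'o2" and Fm :: "'o1 \<Rightarrow> 'o1 \<Rightarrow> 'm1 \<Rightarrow> 'm2"
  assumes Fo_in: "X \<in> Ob C \<Longrightarrow> Fo X \<in> Ob D"
    and Fm_in: "\<lbrakk>X \<in> Ob C; Y \<in> Ob C; f \<in> Hom C X Y\<rbrakk> \<Longrightarrow> Fm X Y f \<in> Hom D (Fo X) (Fo Y)"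
    and Fm_Id: "X \<in> Ob C \<Longrightarrow> Fm X X (Id C X) = Id D (Fo X)"
    and Fm_Comp: "\<lbrakk>X \<in> Ob C; Y \<in> Ob C; Z \<in> Ob C; f \<in> Hom C X Y; g \<in> Hom C Y Z\<rbrakk>
      \<Longrightarrow> Fm X Z (Comp C X Y Z g f) = Comp D (Fo X) (Fo Y) (Fo Z) (Fm Y Z g) (Fm X Y f)"

definition is_iso :: "('o, 'm) cat \<Rightarrow> 'o \<Rightarrow> 'o \<Rightarrow> 'm \<Rightarrow> bool"
  where "is_iso C X Y f \<longleftrightarrow> f \<in> Hom C X Y \<and>
    (\<exists>g\<in>Hom C Y X. Comp C X Y X g f = Id C X \<and> Comp C Y X Y f g = Id C Y)"

definition natural_iso ::
  "('o1, 'm1) cat \<Rightarrow> ('o2, 'm2) cat \<Rightarrow> ('o1 \<Rightarrow> 'o2) \<Rightarrow> ('o1 \<Rightarrow> 'o1 \<Rightarrow> 'm1 \<Rightarrow> 'm2)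
    \<Rightarrow> ('o1 \<Rightarrow> 'o2) \<Rightarrow> ('o1 \<Rightarrow> 'o1 \<Rightarrow> 'm1 \<Rightarrow> 'm2) \<Rightarrow> ('o1 \<Rightarrow> 'm2) \<Rightarrow> bool"
  where "natural_iso C D Fo Fm Go Gm \<eta> \<longleftrightarrow>
    (\<forall>X\<in>Ob C. is_iso D (Fo X) (Go X) (\<eta> X)) \<and>
    (\<forall>X\<in>Ob C. \<forall>Y\<in>Ob C. \<forall>f\<in>Hom C X Y.
      Comp D (Fo X) (Fo Y) (Go Y) (\<eta> Y) (Fm X Y f) = Comp D (Fo X) (Go X) (Go Y) (Gm X Y f) (\<eta> X))"

definition equivalent_categories :: "('o1, 'm1) cat \<Rightarrow> ('o2, 'm2) cat \<Rightarrow> bool"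
  where "equivalent_categories C D \<longleftrightarrow>
    (\<exists>Fo Fm Go Gm \<eta> \<epsilon>. is_functor C D Fo Fm \<and> is_functor D C Go Gm \<and>
      natural_iso C C (\<lambda>X. X) (\<lambda>X Y f. f)
        (\<lambda>X. Go (Fo X)) (\<lambda>X Y f. Gm (Fo X) (Fo Y) (Fm X Y f)) \<eta> \<and>
      natural_iso D D (\<lambda>X. Fo (Go X)) (\<lambda>X Y f. Fm (Go X) (Go Y) (Gm X Y f))
        (\<lambda>X. X) (\<lambda>X Y f. f) \<epsilon>)"

definition full_subcategory :: "('o, 'm) cat \<Rightarrow> ('o \<Rightarrow> bool) \<Rightarrow> ('o, 'm) cat"
  where "full_subcategory C P = C\<lparr>Ob := {X \<in> Ob C. P X}\<rparr>"


section \<open>Weighted modules\<close>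

text \<open>
  The library's locale \<open>module\<close> requires a commutative base ring; this is the same list of axioms
  over an arbitrary ring.
\<close>

locale left_module = R?: ring R + M?: abelian_group M
  for R :: "('a, 'r) ring_scheme" and M :: "('a, 'v, 'm) module_scheme" (structure) +
  assumes smult_closed: "\<lbrakk>r \<in> carrier R; x \<in> carrier M\<rbrakk> \<Longrightarrow> r \<odot>\<^bsub>M\<^esub> x \<in> carrier M"
    and smult_l_distr: "\<lbrakk>r \<in> carrier R; s \<in> carrier R; x \<in> carrier M\<rbrakk>
      \<Longrightarrow> (r \<oplus>\<^bsub>R\<^esub> s) \<odot>\<^bsub>M\<^esub> x = r \<odot>\<^bsub>M\<^esub> x \<oplus>\<^bsub>M\<^esub> s \<odot>\<^bsub>M\<^esub> x"
    and smult_r_distr: "\<lbrakk>r \<in> carrier R; x \<in> carrier M; y \<in> carrier M\<rbrakk>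
      \<Longrightarrow> r \<odot>\<^bsub>M\<^esub> (x \<oplus>\<^bsub>M\<^esub> y) = r \<odot>\<^bsub>M\<^esub> x \<oplus>\<^bsub>M\<^esub> r \<odot>\<^bsub>M\<^esub> y"
    and smult_assoc: "\<lbrakk>r \<in> carrier R; s \<in> carrier R; x \<in> carrier M\<rbrakk>
      \<Longrightarrow> (r \<otimes>\<^bsub>R\<^esub> s) \<odot>\<^bsub>M\<^esub> x = r \<odot>\<^bsub>M\<^esub> (s \<odot>\<^bsub>M\<^esub> x)"
    and smult_one: "x \<in> carrier M \<Longrightarrow> \<one>\<^bsub>R\<^esub> \<odot>\<^bsub>M\<^esub> x = x"

text \<open>Only the components \<open>wt M \<mu>\<close> with \<open>\<mu>\<close> in the chosen weight set \<open>G\<close> are ever used.\<close>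

record ('a, 'v, 'p) wmodule = "('a, 'v) module" +
  wt :: "'p \<Rightarrow> 'v set"

definition direct_sum_decomposition :: "'p set \<Rightarrow> ('a, 'v, 'p) wmodule \<Rightarrow> bool"
  where "direct_sum_decomposition G M \<longleftrightarrow>
    (\<forall>\<mu>\<in>G. additive_subgroup (wt M \<mu>) M) \<and>
    (\<forall>v\<in>carrier M. \<exists>!u. u \<in> (\<Pi>\<^sub>E \<mu>\<in>G. wt M \<mu>) \<and> finite {\<mu>\<in>G. u \<mu> \<noteq> \<zero>\<^bsub>M\<^esub>} \<and>
      v = (\<Oplus>\<^bsub>M\<^esub> \<mu>\<in>{\<mu>\<in>G. u \<mu> \<noteq> \<zero>\<^bsub>M\<^esub>}. u \<mu>))"

text \<open>
  Weighted modules over the algebra with relations \<open>R\<close>, where \<open>\<kappa> i \<mu>\<close> is the scalar through which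
  \<open>K i\<close> acts on the component of weight \<open>\<mu>\<close>.  Scalars act through the structure map of the
  algebra, so stability under degree 0 makes each component a submodule over the base ring.
\<close>

definition weighted_module ::
  "('i gen, 'k::comm_ring_1) falg set \<Rightarrow> ('i \<Rightarrow> 'p::ab_group_add) \<Rightarrow> 'p set \<Rightarrow> ('i \<Rightarrow> 'p \<Rightarrow> 'k)
    \<Rightarrow> (('i gen, 'k) falg set, 'v, 'p) wmodule \<Rightarrow> bool"
  where "weighted_module R \<alpha> G \<kappa> M \<longleftrightarrow>
    left_module (presented_alg R) M \<and>
    direct_sum_decomposition G M \<and>
    (\<forall>\<beta>\<in>root_lattice \<alpha>. \<forall>\<mu>\<in>G. \<forall>x\<in>graded_piece R \<alpha> \<beta>. \<forall>v\<in>wt M \<mu>. x \<odot>\<^bsub>M\<^esub> v \<in> wt M (\<mu> + \<beta>)) \<and>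
    (\<forall>i. \<forall>\<mu>\<in>G. \<forall>v\<in>wt M \<mu>.
      alg_class R (var (K i)) \<odot>\<^bsub>M\<^esub> v = alg_class R (scal (\<kappa> i \<mu>)) \<odot>\<^bsub>M\<^esub> v)"

definition wmodule_hom ::
  "('a, 'r) ring_scheme \<Rightarrow> 'p set \<Rightarrow> ('a, 'v, 'p) wmodule \<Rightarrow> ('a, 'v, 'p) wmodule \<Rightarrow> ('v \<Rightarrow> 'v) set"
  where "wmodule_hom A G M N = {\<phi> \<in> carrier M \<rightarrow>\<^sub>E carrier N.
    (\<forall>x\<in>carrier M. \<forall>y\<in>carrier M. \<phi> (x \<oplus>\<^bsub>M\<^esub> y) = \<phi> x \<oplus>\<^bsub>N\<^esub> \<phi> y) \<and>
    (\<forall>r\<in>carrier A. \<forall>x\<in>carrier M. \<phi> (r \<odot>\<^bsub>M\<^esub> x) = r \<odot>\<^bsub>N\<^esub> \<phi> x) \<and>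
    (\<forall>\<mu>\<in>G. \<phi> ` wt M \<mu> \<subseteq> wt N \<mu>)}"

text \<open>
  The category of weighted modules whose underlying sets are subsets of the type \<open>'v\<close>; this type
  plays the role of the universe.
\<close>

definition weighted_cat ::
  "'v itself \<Rightarrow> ('i gen, 'k::comm_ring_1) falg set \<Rightarrow> ('i \<Rightarrow> 'p::ab_group_add) \<Rightarrow> 'p set
    \<Rightarrow> ('i \<Rightarrow> 'p \<Rightarrow> 'k) \<Rightarrow> ((('i gen, 'k) falg set, 'v, 'p) wmodule, 'v \<Rightarrow> 'v) cat"
  where "weighted_cat _ R \<alpha> G \<kappa> =
    \<lparr>Ob = {M. weighted_module R \<alpha> G \<kappa> M},
     Hom = wmodule_hom (presented_alg R) G,
     Id = (\<lambda>M. restrict (\<lambda>x. x) (carrier M)),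
     Comp = (\<lambda>L M N \<psi> \<phi>. compose (carrier L) \<psi> \<phi>)\<rparr>"

text \<open>Over a commutative base ring, finite-dimensional is read as finitely generated.\<close>

definition fin_gen_weight_space ::
  "('g, 'k::comm_ring_1) falg set \<Rightarrow> (('g, 'k) falg set, 'v, 'p) wmodule \<Rightarrow> 'p \<Rightarrow> bool"
  where "fin_gen_weight_space R M \<mu> \<longleftrightarrow>
    (\<exists>S. finite S \<and> S \<subseteq> wt M \<mu> \<and>
      (\<forall>v\<in>wt M \<mu>. \<exists>c. v = (\<Oplus>\<^bsub>M\<^esub> s\<in>S. alg_class R (scal (c s)) \<odot>\<^bsub>M\<^esub> s)))"

definition integrable_O ::
  "('i gen, 'k::comm_ring_1) falg set \<Rightarrow> ('i \<Rightarrow> 'p::ab_group_add) \<Rightarrow> 'p set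
    \<Rightarrow> (('i gen, 'k) falg set, 'v, 'p) wmodule \<Rightarrow> bool"
  where "integrable_O R \<alpha> G M \<longleftrightarrow>
    (\<forall>\<mu>\<in>G. fin_gen_weight_space R M \<mu>) \<and>
    (\<exists>\<Lambda>. finite \<Lambda> \<and> \<Lambda> \<subseteq> G \<and>
      (\<forall>\<mu>\<in>G. wt M \<mu> \<noteq> {\<zero>\<^bsub>M\<^esub>} \<longrightarrow> (\<exists>\<nu>\<in>\<Lambda>. \<exists>\<beta>\<in>pos_root_cone \<alpha>. \<mu> = \<nu> - \<beta>))) \<and>
    (\<forall>i. \<forall>v\<in>carrier M.
      (\<exists>n. (smult M (alg_class R (var (E i))) ^^ n) v = \<zero>\<^bsub>M\<^esub>) \<and>
      (\<exists>n. (smult M (alg_class R (var (F i))) ^^ n) v = \<zero>\<^bsub>M\<^esub>))"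

definition weight_characters ::
  "('i \<Rightarrow> 'p::ab_group_add) \<Rightarrow> ('i \<Rightarrow> 'p \<Rightarrow> int) \<Rightarrow> 'p set \<Rightarrow> ('i \<Rightarrow> 'i \<Rightarrow> 'k) \<Rightarrow> ('i \<Rightarrow> 'k::comm_ring_1)
    \<Rightarrow> ('i \<Rightarrow> 'p \<Rightarrow> 'k) \<Rightarrow> bool"
  where "weight_characters \<alpha> h G pp p \<chi> \<longleftrightarrow>
    (\<forall>i. \<forall>\<mu>\<in>G. \<chi> i \<mu> dvd 1 \<and> \<chi> i \<mu> ^ 2 = upow (p i) (2 * h i \<mu>)) \<and>
    (\<forall>i j. \<forall>\<mu>\<in>G. \<chi> i (\<mu> + \<alpha> j) = pp i j * \<chi> i \<mu>)"

definition Mod_U where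
  "Mod_U T a \<alpha> G \<theta> pp p \<chi> = weighted_cat T (U_rels a \<theta> pp p) \<alpha> G \<chi>"

definition O_int_U where
  "O_int_U T a \<alpha> G \<theta> pp p \<chi> =
    full_subcategory (Mod_U T a \<alpha> G \<theta> pp p \<chi>) (integrable_O (U_rels a \<theta> pp p) \<alpha> G)"

definition Mod_Ut where
  "Mod_Ut T a \<alpha> h G \<theta> p = weighted_cat T (Ut_rels a \<theta> p) \<alpha> G (\<lambda>i \<mu>. upow (p i) (h i \<mu>))"

definition O_int_Ut where
  "O_int_Ut T a \<alpha> h G \<theta> p =
    full_subcategory (Mod_Ut T a \<alpha> h G \<theta> p) (integrable_O (Ut_rels a \<theta> p) \<alpha> G)"

end

theory Submission
  imports Defs
begin

text \<open>
  On the weight space of weight \<open>\<mu>\<close> rescale \<open>E i\<close>, \<open>F i\<close> and \<open>K i\<close> by units \<open>x i \<mu>\<close>, \<open>y i \<mu>\<close> and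
  \<open>\<kappa>' i \<mu> / \<kappa> i \<mu>\<close>, keeping the underlying group and the grading.  If \<open>x\<close> and \<open>y\<close> are multiplied by
  constants under translation of \<open>\<mu>\<close> by simple roots, the rescaled operators again satisfy relations
  of the same shape, with other parameters, and the inverse units undo the change.  For (ii) take
  $y_i = 1$ and $x_i(\mu) = p_i p_{ii}^{-1} \chi_i(\mu)^{-1}$.  For (iii) choose a total order on the
  index set and $x_i$ with $x_i(\mu + \alpha_j) = s_{ij} x_i(\mu)$, where $s_{ij}$ is the ratio of the two
  values of $\tilde\theta_{ij}$ if $i < j$ and $1$ otherwise, and put $y_i(\mu) = x_i(\mu - \alpha_i)^{-1}$.
\<close>

section \<open>Rescaling the free algebra\<close>

text \<open>The scalars vary with the weight, so the twist is not pulled back along a homomorphism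
  of the presented algebras. It is a family of linear maps of the free algebra, one for each weight,
  and a rescaled relation need only vanish on that one weight space: it suffices that it lies in the
  left ideal generated by the relations at hand and the elements
  \<open>K i - \<kappa> i \<mu>\<close>. For (ii) this freedom is essential, since the two
  inhomogeneous terms become scalar multiples of each other only after the \<open>K i\<close> are
  replaced by eigenvalues. With y_i = 1 the relation between \<open>E i\<close> and
  \<open>F i\<close> demands x_i(\<mu> - \<alpha>_i) (1 - \<chi>_i(\<mu>)^2) / (1 - p_i^2) =
  (\<chi>_i(\<mu>) - \<chi>_i(\<mu>)^-1) / (p_i - p_i^-1), solved by x_i(\<mu> - \<alpha>_i) = p_i
  \<chi>_i(\<mu>)^-1; the shift by \<alpha>_i produces p_ii^-1. In (iii) the inhomogeneous term
  stays the same, which dictates y_i. There remains one equation \<theta>'_ji s_ij = s_ji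
  \<theta>_ji for each unordered pair, because the product \<theta>_ij \<theta>_ji is prescribed; so
  one of the two ratios can be 1, and the order decides which.\<close>

lemma falg_induct [case_names single add]:
  fixes x :: "'g word \<Rightarrow>\<^sub>0 'k::comm_ring_1"
  assumes single: "\<And>w b. P (Poly_Mapping.single w b)"
    and add: "\<And>x y. P x \<Longrightarrow> P y \<Longrightarrow> P (x + y)"
  shows "P x"
proof (induction x rule: update_induct)
  case const
  show ?case using single[of undefined 0] by simp
next
  case (update f w b)
  have "Poly_Mapping.update w b f = Poly_Mapping.single w b + f"
    using update(1)
    by (intro poly_mapping_eqI)
       (auto simp: lookup_update lookup_add lookup_single when_def in_keys_iff)
  then show ?case using add[OF single update(3)] by simp
qed

lemma scal_mult_single: "scal c * Poly_Mapping.single w b = Poly_Mapping.single w (c * b)"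
  by (simp add: scal_def mult_single)

lemma single_mult_scal: "Poly_Mapping.single w b * scal c = Poly_Mapping.single w (c * b)"
  by (simp add: scal_def mult_single mult.commute)

lemma scal_commute: "x * scal c = scal c * x"
  by (induction x rule: falg_induct) (simp_all add: scal_mult_single single_mult_scal algebra_simps)

lemma scal_left_commute: "x * (scal c * y) = scal c * (x * y)"
  by (metis mult.assoc scal_commute)

lemma scal_mult: "scal (c * d) = scal c * scal d"
  by (simp add: scal_def mult_single)

lemma scal_mult_assoc: "scal c * (scal d * x) = scal (c * d) * x"
  by (simp add: scal_mult mult.assoc)

lemma scal_add: "scal (c + d) = scal c + scal d"
  by (simp add: scal_def single_add)

lemma scal_minus: "scal (- c) = - scal c"
  by (simp add: scal_def single_uminus)

lemma scal_diff: "scal (c - d) = scal c - scal d"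
  by (simp add: scal_def single_diff)

lemma scal_0 [simp]: "scal 0 = 0"
  by (simp add: scal_def)

lemma scal_1 [simp]: "scal 1 = 1"
  by (simp add: scal_def single_one)

lemma word_plus: "Word xs + Word ys = Word (xs @ ys)"
  by (simp add: plus_word_def)

lemma zero_word: "0 = Word []"
  by (simp add: zero_word_def)

lemma var_power: "var g ^ n = Poly_Mapping.single (Word (replicate n g)) 1"
proof (induction n)
  case 0
  show ?case by (simp add: zero_word flip: single_one)
next
  case (Suc n)
  then show ?case by (simp add: var_def mult_single word_plus)
qed

lemma gen_degree_in_root_lattice: "gen_degree \<alpha> g \<in> root_lattice \<alpha>"
  unfolding root_lattice_def
  by (cases g) (auto intro: zmod.span_base zmod.span_neg zmod.span_zero)

lemma root_lattice_closed:
  "0 \<in> root_lattice \<alpha>"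
  "\<beta> \<in> root_lattice \<alpha> \<Longrightarrow> \<gamma> \<in> root_lattice \<alpha> \<Longrightarrow> \<beta> + \<gamma> \<in> root_lattice \<alpha>"
  "\<beta> \<in> root_lattice \<alpha> \<Longrightarrow> \<gamma> \<in> root_lattice \<alpha> \<Longrightarrow> \<beta> - \<gamma> \<in> root_lattice \<alpha>"
  "\<beta> \<in> root_lattice \<alpha> \<Longrightarrow> - \<beta> \<in> root_lattice \<alpha>"
  by (simp_all add: root_lattice_def zmod.span_zero zmod.span_add zmod.span_diff zmod.span_neg)

lemma sum_list_degree_in_root_lattice: "sum_list (map (gen_degree \<alpha>) gs) \<in> root_lattice \<alpha>"
  by (induction gs) (auto intro: root_lattice_closed gen_degree_in_root_lattice)

lemma word_degree_in_root_lattice: "word_degree \<alpha> w \<in> root_lattice \<alpha>"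
  unfolding word_degree_def by (rule sum_list_degree_in_root_lattice)

text \<open>
  If a generator \<open>g\<close> acting on weight \<open>\<mu>\<close> is rescaled by \<open>c g \<mu>\<close>, then a word acting on weight
  \<open>\<mu>\<close> is rescaled by \<open>word_scale \<alpha> c \<mu>\<close>; the last letter acts first.
\<close>

primrec list_scale ::
  "('i \<Rightarrow> 'p::ab_group_add) \<Rightarrow> ('i gen \<Rightarrow> 'p \<Rightarrow> 'k::comm_ring_1) \<Rightarrow> 'p \<Rightarrow> 'i gen list \<Rightarrow> 'k"
  where
    "list_scale \<alpha> c \<mu> [] = 1"
  | "list_scale \<alpha> c \<mu> (g # gs) = c g (\<mu> + sum_list (map (gen_degree \<alpha>) gs)) * list_scale \<alpha> c \<mu> gs"

definition word_scale where "word_scale \<alpha> c \<mu> w = list_scale \<alpha> c \<mu> (letters w)"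

definition rescale ::
  "('i \<Rightarrow> 'p::ab_group_add) \<Rightarrow> ('i gen \<Rightarrow> 'p \<Rightarrow> 'k::comm_ring_1) \<Rightarrow> 'p \<Rightarrow> ('i gen, 'k) falg \<Rightarrow> ('i gen, 'k) falg"
  where "rescale \<alpha> c \<mu> x = Poly_Mapping.mapp (\<lambda>w b. word_scale \<alpha> c \<mu> w * b) x"

lemma lookup_rescale: "Poly_Mapping.lookup (rescale \<alpha> c \<mu> x) w = word_scale \<alpha> c \<mu> w * Poly_Mapping.lookup x w"
  by (simp add: rescale_def lookup_mapp when_def in_keys_iff)

lemma list_scale_append:
  "list_scale \<alpha> c \<mu> (gs @ hs)
    = list_scale \<alpha> c (\<mu> + sum_list (map (gen_degree \<alpha>) hs)) gs * list_scale \<alpha> c \<mu> hs"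
  by (induction gs) (simp_all add: ac_simps)

lemma word_scale_add:
  "word_scale \<alpha> c \<mu> (v + w) = word_scale \<alpha> c (\<mu> + word_degree \<alpha> w) v * word_scale \<alpha> c \<mu> w"
  by (simp add: word_scale_def plus_word_def word_degree_def list_scale_append)

lemma rescale_add: "rescale \<alpha> c \<mu> (x + y) = rescale \<alpha> c \<mu> x + rescale \<alpha> c \<mu> y"
  by (rule poly_mapping_eqI) (simp add: lookup_rescale lookup_add algebra_simps)

lemma rescale_0 [simp]: "rescale \<alpha> c \<mu> 0 = 0"
  by (rule poly_mapping_eqI) (simp add: lookup_rescale)

lemma rescale_diff: "rescale \<alpha> c \<mu> (x - y) = rescale \<alpha> c \<mu> x - rescale \<alpha> c \<mu> y"
  by (rule poly_mapping_eqI) (simp add: lookup_rescale lookup_minus algebra_simps)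

lemma rescale_sum: "rescale \<alpha> c \<mu> (sum f A) = (\<Sum>k\<in>A. rescale \<alpha> c \<mu> (f k))"
  by (induction A rule: infinite_finite_induct) (simp_all add: rescale_add)

lemma rescale_single:
  "rescale \<alpha> c \<mu> (Poly_Mapping.single w b) = Poly_Mapping.single w (word_scale \<alpha> c \<mu> w * b)"
  by (rule poly_mapping_eqI) (simp add: lookup_rescale lookup_single when_def)

text \<open>Multiplicativity holds only up to a shift: the right factor acts first and moves \<mu>
  by its degree. It must therefore be homogeneous, here a monomial, while the left factor is
  arbitrary.\<close>

lemma rescale_mult_single:
  "rescale \<alpha> c \<mu> (x * Poly_Mapping.single w b)
    = rescale \<alpha> c (\<mu> + word_degree \<alpha> w) x * rescale \<alpha> c \<mu> (Poly_Mapping.single w b)"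
  by (induction x rule: falg_induct)
     (simp_all add: rescale_single mult_single word_scale_add ac_simps rescale_add distrib_left distrib_right)

lemma rescale_scal: "rescale \<alpha> c \<mu> (scal b) = scal b"
  by (simp add: scal_def rescale_single word_scale_def zero_word)

lemma rescale_scal_mult: "rescale \<alpha> c \<mu> (scal b * x) = scal b * rescale \<alpha> c \<mu> x"
  by (induction x rule: falg_induct)
     (simp_all add: scal_mult_single rescale_single rescale_add distrib_left ac_simps)

lemma rescale_1: "rescale \<alpha> c \<mu> 1 = 1"
  using rescale_scal[of \<alpha> c \<mu> 1] by simp

lemma rescale_var: "rescale \<alpha> c \<mu> (var g) = scal (c g \<mu>) * var g"
  by (simp add: var_def rescale_single scal_mult_single word_scale_def)

lemma rescale_mult_var:
  "rescale \<alpha> c \<mu> (x * var g) = scal (c g \<mu>) * (rescale \<alpha> c (\<mu> + gen_degree \<alpha> g) x * var g)"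
  unfolding var_def rescale_mult_single
  by (simp add: rescale_single word_degree_def scal_mult_single word_scale_def flip: scal_left_commute)

lemma keys_rescale: "Poly_Mapping.keys (rescale \<alpha> c \<mu> x) \<subseteq> Poly_Mapping.keys x"
  unfolding rescale_def by (rule keys_mapp_subset)

text \<open>The scalars are inverse to each other only at weights in \<open>G\<close>; stability of
  \<open>G\<close> keeps every weight that the letters pass through inside.\<close>

lemma list_scale_inverse:
  assumes "\<And>g \<nu>. \<nu> \<in> G \<Longrightarrow> c g \<nu> * c' g \<nu> = 1" and "\<mu> \<in> G"
    and "\<And>\<mu> \<beta>. \<mu> \<in> G \<Longrightarrow> \<beta> \<in> root_lattice \<alpha> \<Longrightarrow> \<mu> + \<beta> \<in> G"
  shows "list_scale \<alpha> c \<mu> gs * list_scale \<alpha> c' \<mu> gs = 1"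
proof (induction gs)
  case (Cons g gs)
  let ?\<nu> = "\<mu> + sum_list (map (gen_degree \<alpha>) gs)"
  have "c g ?\<nu> * c' g ?\<nu> = 1"
    using assms sum_list_degree_in_root_lattice by metis
  moreover have "list_scale \<alpha> c \<mu> (g # gs) * list_scale \<alpha> c' \<mu> (g # gs)
      = (c g ?\<nu> * c' g ?\<nu>) * (list_scale \<alpha> c \<mu> gs * list_scale \<alpha> c' \<mu> gs)"
    by (simp add: ac_simps)
  ultimately show ?case using Cons by simp
qed simp

lemma rescale_inverse:
  assumes "\<And>g \<nu>. \<nu> \<in> G \<Longrightarrow> c g \<nu> * c' g \<nu> = 1" and "\<mu> \<in> G"
    and "\<And>\<mu> \<beta>. \<mu> \<in> G \<Longrightarrow> \<beta> \<in> root_lattice \<alpha> \<Longrightarrow> \<mu> + \<beta> \<in> G"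
  shows "rescale \<alpha> c \<mu> (rescale \<alpha> c' \<mu> x) = x"
proof (rule poly_mapping_eqI)
  fix w
  have "word_scale \<alpha> c \<mu> w * (word_scale \<alpha> c' \<mu> w * b) = b" for b
    using list_scale_inverse[OF assms, where gs = "letters w"]
    by (simp add: word_scale_def mult.assoc[symmetric])
  then show "Poly_Mapping.lookup (rescale \<alpha> c \<mu> (rescale \<alpha> c' \<mu> x)) w = Poly_Mapping.lookup x w"
    by (simp add: lookup_rescale)
qed


section \<open>The quotient map onto a presented algebra\<close>

lemma free_alg_sel [simp]:
  "carrier free_alg = UNIV" "mult free_alg = (*)" "one free_alg = 1" "zero free_alg = 0" "add free_alg = (+)"
  by (simp_all add: free_alg_def)

lemma ideal_rels: "ideal (Idl\<^bsub>free_alg\<^esub> R) free_alg"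
  by (intro ring.genideal_ideal free_alg_ring) simp

lemma alg_class_hom: "alg_class R \<in> ring_hom free_alg (presented_alg R)"
  unfolding presented_alg_def using ideal.rcos_ring_hom[OF ideal_rels[of R]]
  by (simp add: alg_class_def[abs_def])

lemma alg_class_simps:
  "alg_class R x \<in> carrier (presented_alg R)"
  "alg_class R (x * y) = alg_class R x \<otimes>\<^bsub>presented_alg R\<^esub> alg_class R y"
  "alg_class R (x + y) = alg_class R x \<oplus>\<^bsub>presented_alg R\<^esub> alg_class R y"
  "alg_class R 1 = \<one>\<^bsub>presented_alg R\<^esub>"
  using ring_hom_closed[OF alg_class_hom[of R], of x] ring_hom_mult[OF alg_class_hom[of R], of x y]
    ring_hom_add[OF alg_class_hom[of R], of x y] ring_hom_one[OF alg_class_hom[of R]]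
  by simp_all

lemma carrier_presented_algE:
  assumes "X \<in> carrier (presented_alg R)"
  obtains x where "X = alg_class R x"
  using assms unfolding presented_alg_def FactRing_def A_RCOSETS_def' alg_class_def by auto

lemma minus_free_alg: "a_minus free_alg x y = x - y"
proof -
  interpret ring "free_alg :: ('g, 'k::comm_ring_1) falg ring" by (rule free_alg_ring)
  have "a_inv free_alg y = - y"
    by (rule minus_equality) simp_all
  then show ?thesis by (simp add: a_minus_def)
qed

lemma alg_class_eq_iff: "alg_class R x = alg_class R y \<longleftrightarrow> x - y \<in> Idl\<^bsub>free_alg\<^esub> R"
  using ring.quotient_eq_iff_same_a_r_cos[OF free_alg_ring ideal_rels[of R], of x y]
  by (auto simp: alg_class_def minus_free_alg)

lemma alg_class_0: "alg_class R 0 = \<zero>\<^bsub>presented_alg R\<^esub>"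
  using ring_hom_zero[OF alg_class_hom free_alg_ring presented_alg_ring] by simp

lemma alg_class_eq_0:
  assumes "x \<in> Idl\<^bsub>free_alg\<^esub> R"
  shows "alg_class R x = \<zero>\<^bsub>presented_alg R\<^esub>"
  using assms alg_class_eq_iff[of R x 0] by (simp add: alg_class_0)

lemma rels_in_ideal: "r \<in> R \<Longrightarrow> r \<in> Idl\<^bsub>free_alg\<^esub> R"
  using ring.genideal_self[OF free_alg_ring, of R] by auto

text \<open>A left ideal of the free algebra that kills the vectors of weight \<mu> in every
  weighted module. Right multiplication is excluded, because a factor on the right moves the vector
  to another weight, where \<open>K i\<close> may have another eigenvalue.\<close>

inductive_set weight_annihilator ::
  "('i gen, 'k::comm_ring_1) falg set \<Rightarrow> ('i \<Rightarrow> 'p \<Rightarrow> 'k) \<Rightarrow> 'p \<Rightarrow> ('i gen, 'k) falg set"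
  for R \<kappa> \<mu>
  where
    rel: "r \<in> R \<Longrightarrow> r \<in> weight_annihilator R \<kappa> \<mu>"
  | weight: "var (K i) - scal (\<kappa> i \<mu>) \<in> weight_annihilator R \<kappa> \<mu>"
  | mult: "x \<in> weight_annihilator R \<kappa> \<mu> \<Longrightarrow> y * x \<in> weight_annihilator R \<kappa> \<mu>"
  | add: "x \<in> weight_annihilator R \<kappa> \<mu> \<Longrightarrow> y \<in> weight_annihilator R \<kappa> \<mu>
      \<Longrightarrow> x + y \<in> weight_annihilator R \<kappa> \<mu>"

lemma weight_annihilator_minus: "x \<in> weight_annihilator R \<kappa> \<mu> \<Longrightarrow> - x \<in> weight_annihilator R \<kappa> \<mu>"
  using weight_annihilator.mult[of x R \<kappa> \<mu> "- 1"] by simp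

lemma weight_annihilator_diff:
  "x \<in> weight_annihilator R \<kappa> \<mu> \<Longrightarrow> y \<in> weight_annihilator R \<kappa> \<mu> \<Longrightarrow> x - y \<in> weight_annihilator R \<kappa> \<mu>"
  using weight_annihilator.add[OF _ weight_annihilator_minus] by fastforce

section \<open>Weighted modules\<close>

definition weight_comp :: "'p set \<Rightarrow> ('a, 'v, 'p) wmodule \<Rightarrow> 'v \<Rightarrow> 'p \<Rightarrow> 'v"
  where "weight_comp G M v = (THE u. u \<in> (\<Pi>\<^sub>E \<mu>\<in>G. wt M \<mu>) \<and> finite {\<mu>\<in>G. u \<mu> \<noteq> \<zero>\<^bsub>M\<^esub>} \<and>
      v = (\<Oplus>\<^bsub>M\<^esub> \<mu>\<in>{\<mu>\<in>G. u \<mu> \<noteq> \<zero>\<^bsub>M\<^esub>}. u \<mu>))"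

text \<open>Glues maps that are given separately on each weight space into one map of the whole
  module; a rescaling by weight-dependent scalars becomes an operator in this way.\<close>

definition weight_ext ::
  "'p set \<Rightarrow> ('a, 'v, 'p) wmodule \<Rightarrow> ('p \<Rightarrow> 'v \<Rightarrow> 'v) \<Rightarrow> 'v \<Rightarrow> 'v"
  where "weight_ext G M f v =
    (\<Oplus>\<^bsub>M\<^esub> \<mu>\<in>{\<mu>\<in>G. weight_comp G M v \<mu> \<noteq> \<zero>\<^bsub>M\<^esub>}. f \<mu> (weight_comp G M v \<mu>))"

locale weighted =
  fixes R :: "('i gen, 'k::comm_ring_1) falg set"
    and \<alpha> :: "'i \<Rightarrow> 'p::ab_group_add"
    and G :: "'p set"
    and \<kappa> :: "'i \<Rightarrow> 'p \<Rightarrow> 'k"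
    and M :: "(('i gen, 'k) falg set, 'v, 'p) wmodule" (structure)
  assumes weighted_module: "weighted_module R \<alpha> G \<kappa> M"
    and G_add: "\<mu> \<in> G \<Longrightarrow> \<beta> \<in> root_lattice \<alpha> \<Longrightarrow> \<mu> + \<beta> \<in> G"
begin

sublocale left_module "presented_alg R" M
  using weighted_module by (simp add: weighted_module_def)

text \<open>The rescaling is defined on representatives in the free algebra, so computations are
  made with these instead of with their classes.\<close>

definition act :: "('i gen, 'k) falg \<Rightarrow> 'v \<Rightarrow> 'v"
  where "act x v = alg_class R x \<odot> v"

lemma act_closed [simp, intro]: "v \<in> carrier M \<Longrightarrow> act x v \<in> carrier M"
  by (simp add: act_def smult_closed alg_class_simps)

lemma act_add: "v \<in> carrier M \<Longrightarrow> act (x + y) v = act x v \<oplus> act y v"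
  by (simp add: act_def smult_l_distr alg_class_simps)

lemma act_mult: "v \<in> carrier M \<Longrightarrow> act (x * y) v = act x (act y v)"
  by (simp add: act_def smult_assoc alg_class_simps)

lemma act_1: "v \<in> carrier M \<Longrightarrow> act 1 v = v"
  by (simp add: act_def smult_one alg_class_simps)

lemma act_add_right: "v \<in> carrier M \<Longrightarrow> w \<in> carrier M \<Longrightarrow> act x (v \<oplus> w) = act x v \<oplus> act x w"
  by (simp add: act_def smult_r_distr alg_class_simps)

lemma double_eq_zero: "x \<oplus> x = x \<Longrightarrow> x \<in> carrier M \<Longrightarrow> x = \<zero>"
  by (simp add: M.add.l_cancel_one)

lemma act_zero_right [simp]: "act x \<zero> = \<zero>"
  by (rule double_eq_zero) (simp_all flip: act_add_right)

lemma act_zero_left [simp]: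
  assumes v: "v \<in> carrier M"
  shows "act 0 v = \<zero>"
  by (rule double_eq_zero) (use v in \<open>simp_all flip: act_add\<close>)

lemma act_ideal: "r \<in> Idl\<^bsub>free_alg\<^esub> R \<Longrightarrow> v \<in> carrier M \<Longrightarrow> act r v = \<zero>"
  using act_zero_left[of v] by (simp add: act_def alg_class_eq_0 alg_class_0)

lemma act_uminus:
  assumes "v \<in> carrier M"
  shows "act (- x) v = \<ominus> act x v"
proof -
  have "act (- x) v \<oplus> act x v = \<zero>"
    using assms act_add[of v "- x" x] by simp
  then show ?thesis using assms by (simp add: M.minus_equality)
qed

lemma act_diff: "v \<in> carrier M \<Longrightarrow> act (x - y) v = act x v \<ominus> act y v"
  using act_add[of v x "- y"] by (simp add: act_uminus M.minus_eq)

lemma wt_subgroup: "\<mu> \<in> G \<Longrightarrow> additive_subgroup (wt M \<mu>) M"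
  using weighted_module by (simp add: weighted_module_def direct_sum_decomposition_def)

lemma wt_carrier [intro]: "v \<in> wt M \<mu> \<Longrightarrow> \<mu> \<in> G \<Longrightarrow> v \<in> carrier M"
  using additive_subgroup.a_subset[OF wt_subgroup] by auto

lemma wt_zero [simp]: "\<mu> \<in> G \<Longrightarrow> \<zero> \<in> wt M \<mu>"
  using additive_subgroup.zero_closed[OF wt_subgroup] .

lemma wt_add: "v \<in> wt M \<mu> \<Longrightarrow> w \<in> wt M \<mu> \<Longrightarrow> \<mu> \<in> G \<Longrightarrow> v \<oplus> w \<in> wt M \<mu>"
  using additive_subgroup.a_closed[OF wt_subgroup] .

lemma act_homogeneous:
  assumes "\<And>w. w \<in> Poly_Mapping.keys x \<Longrightarrow> word_degree \<alpha> w = \<beta>" and "\<beta> \<in> root_lattice \<alpha>"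
    and "\<mu> \<in> G" and "v \<in> wt M \<mu>"
  shows "act x v \<in> wt M (\<mu> + \<beta>)"
proof -
  have "alg_class R x \<in> graded_piece R \<alpha> \<beta>"
    using assms(1) by (auto simp: graded_piece_def)
  then show ?thesis
    using weighted_module assms by (simp add: weighted_module_def act_def)
qed

lemma act_single_wt:
  assumes "\<mu> \<in> G" and "v \<in> wt M \<mu>"
  shows "act (Poly_Mapping.single w b) v \<in> wt M (\<mu> + word_degree \<alpha> w)"
  by (rule act_homogeneous) (use assms in \<open>auto simp: word_degree_in_root_lattice split: if_splits\<close>)

lemma act_K:
  assumes "\<mu> \<in> G" and "v \<in> wt M \<mu>"
  shows "act (var (K i)) v = act (scal (\<kappa> i \<mu>)) v"
  using weighted_module assms by (simp add: weighted_module_def act_def)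

lemma act_annihilator:
  assumes "x \<in> weight_annihilator R \<kappa> \<mu>" and \<mu>: "\<mu> \<in> G" and v: "v \<in> wt M \<mu>"
  shows "act x v = \<zero>"
  using assms(1)
proof induction
  case (rel r)
  then show ?case using act_ideal[OF rels_in_ideal] \<mu> v by blast
next
  case (weight i)
  have c: "v \<in> carrier M" using v \<mu> by blast
  then show ?case
    by (simp add: act_diff act_K[OF \<mu> v] M.minus_eq M.r_neg)
next
  case (mult x y)
  then show ?case using act_mult[OF wt_carrier[OF v \<mu>]] by simp
next
  case (add x y)
  then show ?case using act_add[OF wt_carrier[OF v \<mu>]] by simp
qed

section \<open>Weight components, and additive maps glued from the weight spaces\<close>

abbreviation "wcomp \<equiv> weight_comp G M"
abbreviation "wext \<equiv> weight_ext G M"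

lemma comp_ex1:
  "v \<in> carrier M \<Longrightarrow> \<exists>!u. u \<in> (\<Pi>\<^sub>E \<mu>\<in>G. wt M \<mu>) \<and> finite {\<mu>\<in>G. u \<mu> \<noteq> \<zero>} \<and>
      v = (\<Oplus> \<mu>\<in>{\<mu>\<in>G. u \<mu> \<noteq> \<zero>}. u \<mu>)"
  using weighted_module by (simp add: weighted_module_def direct_sum_decomposition_def)

lemma comp_props:
  assumes "v \<in> carrier M"
  shows comp_PiE: "wcomp v \<in> (\<Pi>\<^sub>E \<mu>\<in>G. wt M \<mu>)"
    and comp_finite: "finite {\<mu>\<in>G. wcomp v \<mu> \<noteq> \<zero>}"
    and comp_sum: "v = (\<Oplus> \<mu>\<in>{\<mu>\<in>G. wcomp v \<mu> \<noteq> \<zero>}. wcomp v \<mu>)"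
  using theI'[OF comp_ex1[OF assms]] unfolding weight_comp_def by blast+

lemma comp_wt: "v \<in> carrier M \<Longrightarrow> \<mu> \<in> G \<Longrightarrow> wcomp v \<mu> \<in> wt M \<mu>"
  using comp_PiE by auto

lemma comp_carrier [simp]: "v \<in> carrier M \<Longrightarrow> \<mu> \<in> G \<Longrightarrow> wcomp v \<mu> \<in> carrier M"
  using comp_wt by blast

text \<open>The support of a vector changes under addition. Sums over different supports are
  compared after enlarging them to a common finite set, which adds only zero terms.\<close>

lemma finsum_extend:
  assumes "finite S" and "{\<mu>\<in>G. u \<mu> \<noteq> \<zero>} \<subseteq> S" and "S \<subseteq> G"
    and "\<And>\<mu>. \<mu> \<in> S \<Longrightarrow> f \<mu> (u \<mu>) \<in> carrier M" and "\<And>\<mu>. \<mu> \<in> S \<Longrightarrow> f \<mu> \<zero> = \<zero>"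
  shows "(\<Oplus> \<mu>\<in>{\<mu>\<in>G. u \<mu> \<noteq> \<zero>}. f \<mu> (u \<mu>)) = (\<Oplus> \<mu>\<in>S. f \<mu> (u \<mu>))"
proof (rule M.add.finprod_mono_neutral_cong_left)
  show "f \<mu> (u \<mu>) = \<zero>" if "\<mu> \<in> S - {\<mu>\<in>G. u \<mu> \<noteq> \<zero>}" for \<mu>
    using that assms(3,5) by auto
qed (use assms in auto)

lemma comp_eqI:
  assumes u: "u \<in> (\<Pi>\<^sub>E \<mu>\<in>G. wt M \<mu>)" and S: "finite S" "{\<mu>\<in>G. u \<mu> \<noteq> \<zero>} \<subseteq> S" "S \<subseteq> G"
    and v: "v = (\<Oplus> \<mu>\<in>S. u \<mu>)"
  shows "wcomp v = u"
proof -
  have c: "u \<mu> \<in> carrier M" if "\<mu> \<in> S" for \<mu>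
    using u S(3) that by (meson PiE_mem subsetD wt_carrier)
  have "v \<in> carrier M" unfolding v using c by auto
  moreover have "finite {\<mu>\<in>G. u \<mu> \<noteq> \<zero>}" using S(1,2) by (rule finite_subset[rotated])
  moreover have "v = (\<Oplus> \<mu>\<in>{\<mu>\<in>G. u \<mu> \<noteq> \<zero>}. u \<mu>)"
    unfolding v using finsum_extend[OF S, of "\<lambda>_ x. x"] c by simp
  ultimately show ?thesis
    unfolding weight_comp_def using u by (intro the1_equality[OF comp_ex1]) auto
qed

lemma comp_homogeneous:
  assumes \<mu>: "\<mu> \<in> G" and v: "v \<in> wt M \<mu>"
  shows "wcomp v = (\<lambda>\<nu>\<in>G. if \<nu> = \<mu> then v else \<zero>)"
proof (rule comp_eqI)
  show "v = (\<Oplus> \<nu>\<in>{\<mu>}. (\<lambda>\<nu>\<in>G. if \<nu> = \<mu> then v else \<zero>) \<nu>)"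
    using assms wt_carrier by auto
qed (use assms in \<open>auto split: if_splits\<close>)

lemma comp_add:
  assumes v: "v \<in> carrier M" and w: "w \<in> carrier M"
  shows "wcomp (v \<oplus> w) = (\<lambda>\<mu>\<in>G. wcomp v \<mu> \<oplus> wcomp w \<mu>)"
proof (rule comp_eqI)
  let ?A = "{\<mu>\<in>G. wcomp v \<mu> \<noteq> \<zero>}" and ?B = "{\<mu>\<in>G. wcomp w \<mu> \<noteq> \<zero>}"
  let ?S = "?A \<union> ?B"
  show fin: "finite ?S" using comp_finite assms by auto
  show "(\<lambda>\<mu>\<in>G. wcomp v \<mu> \<oplus> wcomp w \<mu>) \<in> (\<Pi>\<^sub>E \<mu>\<in>G. wt M \<mu>)"
    using wt_add comp_wt assms by auto
  have "v = (\<Oplus> \<mu>\<in>?S. wcomp v \<mu>)"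
    by (rule trans[OF comp_sum[OF v] finsum_extend[where f = "\<lambda>_ x. x"]]) (use fin v in auto)
  moreover have "w = (\<Oplus> \<mu>\<in>?S. wcomp w \<mu>)"
    by (rule trans[OF comp_sum[OF w] finsum_extend[where f = "\<lambda>_ x. x"]]) (use fin w in auto)
  moreover have "(\<Oplus> \<mu>\<in>?S. wcomp v \<mu> \<oplus> wcomp w \<mu>) = (\<Oplus> \<mu>\<in>?S. wcomp v \<mu>) \<oplus> (\<Oplus> \<mu>\<in>?S. wcomp w \<mu>)"
    using assms by (intro M.finsum_addf) auto
  ultimately have "v \<oplus> w = (\<Oplus> \<mu>\<in>?S. wcomp v \<mu> \<oplus> wcomp w \<mu>)" by simp
  also have "\<dots> = (\<Oplus> \<mu>\<in>?S. (\<lambda>\<mu>\<in>G. wcomp v \<mu> \<oplus> wcomp w \<mu>) \<mu>)"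
    using assms by (intro M.finsum_cong') auto
  finally show "v \<oplus> w = (\<Oplus> \<mu>\<in>?S. (\<lambda>\<mu>\<in>G. wcomp v \<mu> \<oplus> wcomp w \<mu>) \<mu>)" .
  show "?A \<union> ?B \<subseteq> G" by blast
  show "{\<mu> \<in> G. (\<lambda>\<mu>\<in>G. wcomp v \<mu> \<oplus> wcomp w \<mu>) \<mu> \<noteq> \<zero>} \<subseteq> ?A \<union> ?B"
    by auto
qed

text \<open>Every vector is the finite sum of its weight components. Identities between additive
  maps are thereby reduced to weight vectors, where a glued map is a single member of its
  family.\<close>

lemma carrier_induct [consumes 1, case_names zero wt add]:
  assumes "v \<in> carrier M"
    and zero: "P \<zero>"
    and wt: "\<And>\<mu> u. \<mu> \<in> G \<Longrightarrow> u \<in> wt M \<mu> \<Longrightarrow> P u"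
    and add: "\<And>u w. u \<in> carrier M \<Longrightarrow> w \<in> carrier M \<Longrightarrow> P u \<Longrightarrow> P w \<Longrightarrow> P (u \<oplus> w)"
  shows "P v"
proof -
  have "P (\<Oplus> \<mu>\<in>S. wcomp v \<mu>)" if "finite S" "S \<subseteq> G" for S
    using that
  proof induction
    case empty
    show ?case by (simp add: zero)
  next
    case (insert \<mu> S)
    then have c: "wcomp v \<in> S \<rightarrow> carrier M" "wcomp v \<mu> \<in> carrier M"
      using \<open>v \<in> carrier M\<close> by auto
    have "P (wcomp v \<mu>)"
      using insert.prems comp_wt[OF \<open>v \<in> carrier M\<close>] by (intro wt) auto
    moreover have "P (finsum M (wcomp v) S)" using insert by simp
    ultimately have "P (wcomp v \<mu> \<oplus> finsum M (wcomp v) S)"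
      by (rule add[OF c(2) M.finsum_closed[OF c(1)]])
    then show ?case using M.finsum_insert[OF insert.hyps c] by (simp only:)
  qed
  from this[of "{\<mu>\<in>G. wcomp v \<mu> \<noteq> \<zero>}"]
  have "P (\<Oplus> \<mu>\<in>{\<mu>\<in>G. wcomp v \<mu> \<noteq> \<zero>}. wcomp v \<mu>)"
    using comp_finite[OF assms(1)] by blast
  then show ?thesis by (subst comp_sum[OF assms(1)])
qed

definition "weight_additive f \<longleftrightarrow>
  (\<forall>\<mu>\<in>G. \<forall>v\<in>wt M \<mu>. f \<mu> v \<in> carrier M \<and> (\<forall>w\<in>wt M \<mu>. f \<mu> (v \<oplus> w) = f \<mu> v \<oplus> f \<mu> w))"

lemma weight_additive_closed: "weight_additive f \<Longrightarrow> \<mu> \<in> G \<Longrightarrow> v \<in> wt M \<mu> \<Longrightarrow> f \<mu> v \<in> carrier M"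
  by (simp add: weight_additive_def)

lemma weight_additive_add:
  "weight_additive f \<Longrightarrow> \<mu> \<in> G \<Longrightarrow> v \<in> wt M \<mu> \<Longrightarrow> w \<in> wt M \<mu> \<Longrightarrow> f \<mu> (v \<oplus> w) = f \<mu> v \<oplus> f \<mu> w"
  by (simp add: weight_additive_def)

lemma weight_additive_zero:
  assumes "weight_additive f" and "\<mu> \<in> G"
  shows "f \<mu> \<zero> = \<zero>"
proof -
  have c: "f \<mu> \<zero> \<in> carrier M" by (rule weight_additive_closed[OF assms wt_zero[OF assms(2)]])
  have "f \<mu> \<zero> \<oplus> f \<mu> \<zero> = f \<mu> (\<zero> \<oplus> \<zero>)"
    using weight_additive_add[OF assms wt_zero wt_zero] assms(2) by simp
  then show ?thesis using c double_eq_zero[of "f \<mu> \<zero>"] by simp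
qed

lemma ext_closed:
  assumes "weight_additive f" and "v \<in> carrier M"
  shows "wext f v \<in> carrier M"
  unfolding weight_ext_def
  using weight_additive_closed[OF assms(1) _ comp_wt[OF assms(2)]] by (intro M.finsum_closed) simp

lemma ext_homogeneous:
  assumes f: "weight_additive f" and \<mu>: "\<mu> \<in> G" and v: "v \<in> wt M \<mu>"
  shows "wext f v = f \<mu> v"
proof -
  note c = comp_homogeneous[OF \<mu> v]
  have fv: "f \<mu> (wcomp v \<mu>) \<in> carrier M" using weight_additive_closed[OF assms] \<mu> by (simp add: c)
  have "wext f v = (\<Oplus> \<nu>\<in>{\<mu>}. f \<nu> (wcomp v \<nu>))"
    unfolding weight_ext_def
  proof (rule finsum_extend)
    show "{\<nu>\<in>G. wcomp v \<nu> \<noteq> \<zero>} \<subseteq> {\<mu>}" by (auto simp: c)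
  qed (use \<mu> fv weight_additive_zero[OF f] in simp_all)
  also have "\<dots> = f \<mu> (wcomp v \<mu>)" using fv by simp
  finally show ?thesis using \<mu> by (simp add: c)
qed

lemma ext_add:
  assumes f: "weight_additive f" and v: "v \<in> carrier M" and w: "w \<in> carrier M"
  shows "wext f (v \<oplus> w) = wext f v \<oplus> wext f w"
proof -
  let ?S = "{\<mu>\<in>G. wcomp v \<mu> \<noteq> \<zero>} \<union> {\<mu>\<in>G. wcomp w \<mu> \<noteq> \<zero>}"
  have fin: "finite ?S" using comp_finite assms by auto
  have c: "f \<mu> (wcomp u \<mu>) \<in> carrier M" if "u \<in> carrier M" "\<mu> \<in> G" for u \<mu>
    using weight_additive_closed[OF f that(2) comp_wt[OF that]] .
  have *: "wext f u = (\<Oplus> \<mu>\<in>?S. f \<mu> (wcomp u \<mu>))"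
    if u: "u \<in> carrier M" and "{\<mu>\<in>G. wcomp u \<mu> \<noteq> \<zero>} \<subseteq> ?S" for u
    unfolding weight_ext_def
  proof (rule finsum_extend)
    show "f \<mu> (wcomp u \<mu>) \<in> carrier M" if "\<mu> \<in> ?S" for \<mu> using c[OF u] that by blast
    show "f \<mu> \<zero> = \<zero>" if "\<mu> \<in> ?S" for \<mu> using weight_additive_zero[OF f] that by blast
  qed (use that fin in blast)+
  have pi: "(\<lambda>\<mu>. f \<mu> (wcomp u \<mu>)) \<in> ?S \<rightarrow> carrier M" if "u \<in> carrier M" for u
    using c[OF that] by blast
  have add: "f \<mu> (wcomp (v \<oplus> w) \<mu>) = f \<mu> (wcomp v \<mu>) \<oplus> f \<mu> (wcomp w \<mu>)" if "\<mu> \<in> ?S" for \<mu>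
  proof -
    have "\<mu> \<in> G" using that by blast
    then show ?thesis
      using weight_additive_add[OF f \<open>\<mu> \<in> G\<close> comp_wt[OF v] comp_wt[OF w]] by (simp add: comp_add[OF v w])
  qed
  have "wext f (v \<oplus> w) = (\<Oplus> \<mu>\<in>?S. f \<mu> (wcomp (v \<oplus> w) \<mu>))"
  proof (rule *)
    show "v \<oplus> w \<in> carrier M" using v w by simp
    show "{\<mu>\<in>G. wcomp (v \<oplus> w) \<mu> \<noteq> \<zero>} \<subseteq> ?S" by (auto simp: comp_add[OF v w])
  qed
  also have "\<dots> = (\<Oplus> \<mu>\<in>?S. f \<mu> (wcomp v \<mu>) \<oplus> f \<mu> (wcomp w \<mu>))"
  proof (rule M.finsum_cong')
    show "(\<lambda>\<mu>. f \<mu> (wcomp v \<mu>) \<oplus> f \<mu> (wcomp w \<mu>)) \<in> ?S \<rightarrow> carrier M"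
      using pi[OF v] pi[OF w] by (simp add: Pi_iff)
  qed (use add in simp_all)
  also have "\<dots> = (\<Oplus> \<mu>\<in>?S. f \<mu> (wcomp v \<mu>)) \<oplus> (\<Oplus> \<mu>\<in>?S. f \<mu> (wcomp w \<mu>))"
    by (rule M.finsum_addf[OF pi[OF v] pi[OF w]])
  also have "\<dots> = wext f v \<oplus> wext f w" using *[OF v] *[OF w] by simp
  finally show ?thesis .
qed

lemma comp_zero: "wcomp \<zero> = (\<lambda>\<mu>\<in>G. \<zero>)"
  by (rule comp_eqI[where S = "{}"]) auto

lemma ext_zero: "wext f \<zero> = \<zero>"
proof -
  have "{\<mu>\<in>G. wcomp \<zero> \<mu> \<noteq> \<zero>} = {}" by (auto simp: comp_zero)
  then show ?thesis unfolding weight_ext_def by (simp only: M.finsum_empty)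
qed

lemma act_var_power:
  assumes "v \<in> carrier M"
  shows "(smult M (alg_class R (var g)) ^^ n) v = act (var g ^ n) v"
  using assms by (induction n) (simp_all add: act_1 act_mult, simp add: act_def)

text \<open>Translation by \<beta> is injective on weights, so the components of a vector cannot mix
  under a homogeneous element. For local nilpotency: a power of a generator that kills a vector
  kills each of its components.\<close>

lemma comp_act_homogeneous:
  assumes x: "\<And>w. w \<in> Poly_Mapping.keys x \<Longrightarrow> word_degree \<alpha> w = \<beta>" and \<beta>: "\<beta> \<in> root_lattice \<alpha>"
    and \<mu>: "\<mu> \<in> G" and v: "v \<in> carrier M"
  shows "wcomp (act x v) (\<mu> + \<beta>) = act x (wcomp v \<mu>)"
  using v
proof (induction v rule: carrier_induct)
  case zero
  show ?case using \<mu> G_add[OF \<mu> \<beta>] by (simp add: comp_zero)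
next
  case (wt \<nu> u)
  have "act x u \<in> wt M (\<nu> + \<beta>)" using act_homogeneous[OF x \<beta> wt] .
  from comp_homogeneous[OF G_add[OF wt(1) \<beta>] this] comp_homogeneous[OF wt]
  show ?case using \<mu> G_add[OF \<mu> \<beta>] by simp
next
  case (add u w)
  then show ?case using \<mu> G_add[OF \<mu> \<beta>] by (simp add: act_add_right comp_add)
qed

end

section \<open>Twisting a weighted module\<close>

text \<open>A scalar of the new algebra is a class, and \<open>SOME\<close> picks a representative
  to be rescaled; \<open>smult_twist_class_eq\<close> shows the choice to be harmless once the new
  relations are respected.\<close>

definition twist_module ::
  "('i gen, 'k::comm_ring_1) falg set \<Rightarrow> ('i gen, 'k) falg set \<Rightarrow> ('i \<Rightarrow> 'p::ab_group_add) \<Rightarrow> 'p set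
    \<Rightarrow> ('i gen \<Rightarrow> 'p \<Rightarrow> 'k) \<Rightarrow> (('i gen, 'k) falg set, 'v, 'p) wmodule
    \<Rightarrow> (('i gen, 'k) falg set, 'v, 'p) wmodule"
  where "twist_module R R' \<alpha> G c M = M\<lparr>smult := \<lambda>X. weight_ext G M
    (\<lambda>\<mu> u. alg_class R (rescale \<alpha> c \<mu> (SOME x. X = alg_class R' x)) \<odot>\<^bsub>M\<^esub> u)\<rparr>"

lemma twist_module_sel [simp]:
  "carrier (twist_module R R' \<alpha> G c M) = carrier M"
  "add (twist_module R R' \<alpha> G c M) = add M"
  "zero (twist_module R R' \<alpha> G c M) = zero M"
  "wt (twist_module R R' \<alpha> G c M) = wt M"
  by (simp_all add: twist_module_def)

lemma finsum_twist_module [simp]: "finsum (twist_module R R' \<alpha> G c M) = finsum M"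
  by (intro ext) (simp add: finsum_def)

lemma direct_sum_decomposition_twist_module:
  "direct_sum_decomposition G (twist_module R R' \<alpha> G c M) = direct_sum_decomposition G M"
  by (simp add: direct_sum_decomposition_def additive_subgroup_def)

locale twisting = weighted R \<alpha> G \<kappa> M
  for R :: "('i gen, 'k::comm_ring_1) falg set"
    and \<alpha> :: "'i \<Rightarrow> 'p::ab_group_add"
    and G :: "'p set"
    and \<kappa> :: "'i \<Rightarrow> 'p \<Rightarrow> 'k"
    and M :: "(('i gen, 'k) falg set, 'v, 'p) wmodule" (structure) +
  fixes R' :: "('i gen, 'k) falg set"
    and \<kappa>' :: "'i \<Rightarrow> 'p \<Rightarrow> 'k"
    and c :: "'i gen \<Rightarrow> 'p \<Rightarrow> 'k"
  assumes rescale_rel: "r \<in> R' \<Longrightarrow> \<mu> \<in> G \<Longrightarrow> rescale \<alpha> c \<mu> r \<in> weight_annihilator R \<kappa> \<mu>"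
    and scale_K: "\<mu> \<in> G \<Longrightarrow> c (K i) \<mu> * \<kappa> i \<mu> = \<kappa>' i \<mu>"
begin

abbreviation "M' \<equiv> twist_module R R' \<alpha> G c M"

abbreviation twist :: "'p \<Rightarrow> ('i gen, 'k) falg \<Rightarrow> ('i gen, 'k) falg"
  where "twist \<equiv> rescale \<alpha> c"

lemma weight_additive_act: "weight_additive (\<lambda>\<mu>. act (f \<mu>))"
  unfolding weight_additive_def using act_add_right wt_carrier by blast

text \<open>Only the right factor is decomposed: a monomial \<open>y\<close> sends \<open>v\<close>
  into a single weight space, where \<open>wext\<close> is the rescaled \<open>x\<close> at the
  shifted weight.\<close>

lemma act_twist_mult:
  assumes \<mu>: "\<mu> \<in> G" and v: "v \<in> wt M \<mu>"
  shows "act (twist \<mu> (x * y)) v = wext (\<lambda>\<nu>. act (twist \<nu> x)) (act (twist \<mu> y) v)"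
proof (induction y rule: falg_induct)
  case (single w b)
  have v': "v \<in> carrier M" using \<mu> v by blast
  have "\<mu> + word_degree \<alpha> w \<in> G" using \<mu> by (intro G_add word_degree_in_root_lattice)
  moreover have "act (twist \<mu> (Poly_Mapping.single w b)) v \<in> wt M (\<mu> + word_degree \<alpha> w)"
    unfolding rescale_single using act_single_wt[OF \<mu> v] .
  ultimately have "wext (\<lambda>\<nu>. act (twist \<nu> x)) (act (twist \<mu> (Poly_Mapping.single w b)) v)
      = act (twist (\<mu> + word_degree \<alpha> w) x) (act (twist \<mu> (Poly_Mapping.single w b)) v)"
    by (rule ext_homogeneous[OF weight_additive_act])
  then show ?case using v' by (simp add: rescale_mult_single act_mult)
next
  case (add y z)
  have v': "v \<in> carrier M" using \<mu> v by blast
  then show ?case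
    by (simp add: distrib_left rescale_add act_add add ext_add[OF weight_additive_act])
qed

text \<open>The elements whose rescalings vanish on the weight spaces form a two-sided ideal
  containing \<open>R'\<close>, hence contain the generated ideal.\<close>

lemma twist_ideal_zero:
  assumes "x \<in> Idl\<^bsub>free_alg\<^esub> R'" and \<mu>: "\<mu> \<in> G" and v: "v \<in> wt M \<mu>"
  shows "act (twist \<mu> x) v = \<zero>"
proof -
  \<comment> \<open>All weights are quantified at once: a factor on the right shifts the weight, so
    the elements that vanish at one fixed \<mu> would form only a left ideal.\<close>
  define J where "J = {x. \<forall>\<mu>\<in>G. \<forall>v\<in>wt M \<mu>. act (twist \<mu> x) v = \<zero>}"
  interpret F: ring "free_alg :: ('i gen, 'k) falg ring" by (rule free_alg_ring)
  have "ideal J free_alg"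
  proof (rule idealI)
    show "ring (free_alg :: ('i gen, 'k) falg ring)" by (rule free_alg_ring)
    have minus: "\<ominus>\<^bsub>free_alg\<^esub> x = - x" for x :: "('i gen, 'k) falg"
      by (rule F.minus_equality) simp_all
    have neg: "- x \<in> J" if "x \<in> J" for x
      using that rescale_diff[of \<alpha> c _ 0 x] wt_carrier
      by (auto simp: J_def act_uminus)
    show "subgroup J (add_monoid free_alg)"
    proof (rule group.subgroupI)
      show "group (add_monoid (free_alg :: ('i gen, 'k) falg ring))" by (rule F.add.is_group)
      show "J \<noteq> {}" using wt_carrier by (auto simp: J_def intro!: exI[of _ 0])
      show "inv\<^bsub>add_monoid free_alg\<^esub> x \<in> J" if "x \<in> J" for x
        using neg[OF that] minus[of x] by (simp add: a_inv_def)
      show "x \<otimes>\<^bsub>add_monoid free_alg\<^esub> y \<in> J" if "x \<in> J" "y \<in> J" for x y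
        using that wt_carrier by (auto simp: J_def rescale_add act_add)
    qed simp
    show "x \<otimes>\<^bsub>free_alg\<^esub> r \<in> J" if "r \<in> J" for r x
      using that by (simp add: J_def act_twist_mult ext_zero)
    show "r \<otimes>\<^bsub>free_alg\<^esub> x \<in> J" if "r \<in> J" for r x
    proof -
      have "act (twist \<mu> (r * x)) v = \<zero>" if \<mu>: "\<mu> \<in> G" and v: "v \<in> wt M \<mu>" for \<mu> v
      proof (induction x rule: falg_induct)
        case (single w b)
        have v': "v \<in> carrier M" using \<mu> v by blast
        have G: "\<mu> + word_degree \<alpha> w \<in> G" using \<mu> by (intro G_add word_degree_in_root_lattice)
        have "act (twist \<mu> (Poly_Mapping.single w b)) v \<in> wt M (\<mu> + word_degree \<alpha> w)"
          unfolding rescale_single using act_single_wt[OF \<mu> v] .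
        then have "act (twist (\<mu> + word_degree \<alpha> w) r) (act (twist \<mu> (Poly_Mapping.single w b)) v) = \<zero>"
          using \<open>r \<in> J\<close> G by (simp add: J_def)
        then show ?case using v' by (simp add: rescale_mult_single act_mult)
      next
        case (add y z)
        have v': "v \<in> carrier M" using \<mu> v by blast
        then show ?case by (simp add: distrib_left rescale_add act_add add)
      qed
      then show ?thesis by (simp add: J_def)
    qed
  qed
  moreover have "R' \<subseteq> J" unfolding J_def using act_annihilator rescale_rel by blast
  ultimately have "Idl\<^bsub>free_alg\<^esub> R' \<subseteq> J" by (rule F.genideal_minimal)
  then show ?thesis using assms by (auto simp: J_def)
qed

lemma smult_twist_class_eq:
  assumes "v \<in> carrier M" and "alg_class R' x = alg_class R' y"
  shows "wext (\<lambda>\<mu>. act (twist \<mu> x)) v = wext (\<lambda>\<mu>. act (twist \<mu> y)) v"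
  using assms(1)
proof (induction v rule: carrier_induct)
  case zero
  show ?case by (simp add: ext_zero)
next
  case (wt \<mu> u)
  have "x - y \<in> Idl\<^bsub>free_alg\<^esub> R'" using assms(2) by (simp add: alg_class_eq_iff)
  from twist_ideal_zero[OF this wt] have "act (twist \<mu> x - twist \<mu> y) u = \<zero>"
    by (simp add: rescale_diff)
  moreover have "act (twist \<mu> x) u = act ((twist \<mu> x - twist \<mu> y) + twist \<mu> y) u" by simp
  moreover have "u \<in> carrier M" using wt by blast
  ultimately have "act (twist \<mu> x) u = act (twist \<mu> y) u"
    by (simp only: act_add act_closed M.l_zero)
  then show ?case by (simp add: ext_homogeneous[OF weight_additive_act wt])
next
  case (add u w)
  then show ?case by (simp add: ext_add[OF weight_additive_act])
qed

lemma smult_twist: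
  assumes "v \<in> carrier M"
  shows "alg_class R' x \<odot>\<^bsub>M'\<^esub> v = wext (\<lambda>\<mu>. act (twist \<mu> x)) v"
proof -
  let ?y = "SOME y. alg_class R' x = alg_class R' y"
  have "alg_class R' x = alg_class R' ?y" by (rule someI[of _ x]) simp
  from smult_twist_class_eq[OF assms this] show ?thesis
    by (simp add: twist_module_def act_def[abs_def])
qed

lemma smult_twist_wt:
  "\<mu> \<in> G \<Longrightarrow> v \<in> wt M \<mu> \<Longrightarrow> alg_class R' x \<odot>\<^bsub>M'\<^esub> v = act (twist \<mu> x) v"
  using smult_twist[OF wt_carrier] ext_homogeneous[OF weight_additive_act] by simp

lemma smult_twist_closed: "v \<in> carrier M \<Longrightarrow> alg_class R' x \<odot>\<^bsub>M'\<^esub> v \<in> carrier M"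
  by (simp add: smult_twist ext_closed[OF weight_additive_act])

lemma smult_twist_add_right:
  "v \<in> carrier M \<Longrightarrow> w \<in> carrier M
    \<Longrightarrow> alg_class R' x \<odot>\<^bsub>M'\<^esub> (v \<oplus> w) = alg_class R' x \<odot>\<^bsub>M'\<^esub> v \<oplus> alg_class R' x \<odot>\<^bsub>M'\<^esub> w"
  by (simp add: smult_twist ext_add[OF weight_additive_act])

lemma smult_twist_zero: "alg_class R' x \<odot>\<^bsub>M'\<^esub> \<zero> = \<zero>"
  by (simp add: smult_twist ext_zero)

lemma left_module_twist: "left_module (presented_alg R') M'"
proof (intro left_module.intro left_module_axioms.intro)
  show "ring (presented_alg R')" by (rule presented_alg_ring)
  show "abelian_group M'"
    using M.abelian_group_axioms
    by (simp add: abelian_group_def abelian_monoid_def abelian_group_axioms_def)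
  show "r \<odot>\<^bsub>M'\<^esub> x \<in> carrier M'" if "r \<in> carrier (presented_alg R')" "x \<in> carrier M'" for r x
    using that by (auto elim!: carrier_presented_algE simp: smult_twist_closed)
  show "r \<odot>\<^bsub>M'\<^esub> (x \<oplus>\<^bsub>M'\<^esub> y) = r \<odot>\<^bsub>M'\<^esub> x \<oplus>\<^bsub>M'\<^esub> r \<odot>\<^bsub>M'\<^esub> y"
    if "r \<in> carrier (presented_alg R')" "x \<in> carrier M'" "y \<in> carrier M'" for r x y
    using that by (auto elim!: carrier_presented_algE simp: smult_twist_add_right)
  show "(r \<oplus>\<^bsub>presented_alg R'\<^esub> s) \<odot>\<^bsub>M'\<^esub> v = r \<odot>\<^bsub>M'\<^esub> v \<oplus>\<^bsub>M'\<^esub> s \<odot>\<^bsub>M'\<^esub> v"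
    if rs: "r \<in> carrier (presented_alg R')" "s \<in> carrier (presented_alg R')" and "v \<in> carrier M'" for r s v
  proof -
    obtain x y where xy: "r = alg_class R' x" "s = alg_class R' y"
      using rs by (auto elim!: carrier_presented_algE)
    have "v \<in> carrier M" using that by simp
    then have "alg_class R' (x + y) \<odot>\<^bsub>M'\<^esub> v = alg_class R' x \<odot>\<^bsub>M'\<^esub> v \<oplus> alg_class R' y \<odot>\<^bsub>M'\<^esub> v"
    proof (induction v rule: carrier_induct)
      case zero
      show ?case by (simp add: smult_twist_zero)
    next
      case (wt \<mu> u)
      then show ?case using wt_carrier[OF wt(2,1)] by (simp add: smult_twist_wt rescale_add act_add)
    next
      case (add u w)
      then show ?case
        by (simp add: smult_twist_add_right smult_twist_closed M.a_ac)
    qed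
    then show ?thesis by (simp add: xy alg_class_simps)
  qed
  show "(r \<otimes>\<^bsub>presented_alg R'\<^esub> s) \<odot>\<^bsub>M'\<^esub> v = r \<odot>\<^bsub>M'\<^esub> (s \<odot>\<^bsub>M'\<^esub> v)"
    if rs: "r \<in> carrier (presented_alg R')" "s \<in> carrier (presented_alg R')" and "v \<in> carrier M'" for r s v
  proof -
    obtain x y where xy: "r = alg_class R' x" "s = alg_class R' y"
      using rs by (auto elim!: carrier_presented_algE)
    have "v \<in> carrier M" using that by simp
    then have "alg_class R' (x * y) \<odot>\<^bsub>M'\<^esub> v = alg_class R' x \<odot>\<^bsub>M'\<^esub> (alg_class R' y \<odot>\<^bsub>M'\<^esub> v)"
    proof (induction v rule: carrier_induct)
      case zero
      show ?case by (simp add: smult_twist_zero)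
    next
      case (wt \<mu> u)
      have "act (twist \<mu> y) u \<in> carrier M" using wt wt_carrier by blast
      then show ?case
        using wt by (simp add: smult_twist_wt act_twist_mult smult_twist)
    next
      case (add u w)
      then show ?case by (simp add: smult_twist_add_right smult_twist_closed)
    qed
    then show ?thesis by (simp add: xy alg_class_simps)
  qed
  show "\<one>\<^bsub>presented_alg R'\<^esub> \<odot>\<^bsub>M'\<^esub> v = v" if "v \<in> carrier M'" for v
  proof -
    have "v \<in> carrier M" using that by simp
    then have "alg_class R' 1 \<odot>\<^bsub>M'\<^esub> v = v"
    proof (induction v rule: carrier_induct)
      case (wt \<mu> u)
      then show ?case using wt_carrier[OF wt(2,1)] by (simp add: smult_twist_wt rescale_1 act_1)
    qed (simp_all add: smult_twist_zero smult_twist_add_right)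
    then show ?thesis by (simp add: alg_class_simps)
  qed
qed

text \<open>Rescaling is diagonal on monomials, so degrees survive; the new \<open>K i\<close> acts
  at weight \<mu> through the scalar \<open>c (K i) \<mu> * \<kappa> i \<mu>\<close>, which is
  \<open>\<kappa>' i \<mu>\<close> by \<open>scale_K\<close>.\<close>

lemma weighted_twist: "weighted R' \<alpha> G \<kappa>' M'"
proof
  have "x \<odot>\<^bsub>M'\<^esub> v \<in> wt M (\<mu> + \<beta>)"
    if \<beta>: "\<beta> \<in> root_lattice \<alpha>" and \<mu>: "\<mu> \<in> G" and x: "x \<in> graded_piece R' \<alpha> \<beta>" and v: "v \<in> wt M \<mu>" for \<beta> \<mu> x v
  proof -
    obtain y where y: "x = alg_class R' y" "\<forall>w\<in>Poly_Mapping.keys y. word_degree \<alpha> w = \<beta>"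
      using x by (auto simp: graded_piece_def)
    then have "act (twist \<mu> y) v \<in> wt M (\<mu> + \<beta>)"
      using keys_rescale[of \<alpha> c \<mu> y] \<beta> \<mu> v by (intro act_homogeneous) auto
    then show ?thesis using \<mu> v by (simp add: y(1) smult_twist_wt)
  qed
  moreover have "alg_class R' (var (K i)) \<odot>\<^bsub>M'\<^esub> v = alg_class R' (scal (\<kappa>' i \<mu>)) \<odot>\<^bsub>M'\<^esub> v"
    if \<mu>: "\<mu> \<in> G" and v: "v \<in> wt M \<mu>" for i \<mu> v
  proof -
    have v': "v \<in> carrier M" using \<mu> v by blast
    have "act (scal (c (K i) \<mu>) * var (K i)) v = act (scal (c (K i) \<mu>) * scal (\<kappa> i \<mu>)) v"
      using v' by (simp add: act_mult act_K[OF \<mu> v])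
    then show ?thesis
      using \<mu> v by (simp add: smult_twist_wt rescale_var rescale_scal scale_K flip: scal_mult)
  qed
  ultimately show "weighted_module R' \<alpha> G \<kappa>' M'"
    using weighted_module left_module_twist
    by (simp add: weighted_module_def direct_sum_decomposition_twist_module)
qed (rule G_add)

end

lemma wmodule_hom_zero:
  assumes "weighted R \<alpha> G \<kappa> M" and "weighted R \<alpha> G \<kappa> N" and "\<phi> \<in> wmodule_hom (presented_alg R) G M N"
  shows "\<phi> \<zero>\<^bsub>M\<^esub> = \<zero>\<^bsub>N\<^esub>"
proof -
  interpret M: weighted R \<alpha> G \<kappa> M by fact
  interpret N: weighted R \<alpha> G \<kappa> N by fact
  have "\<phi> \<zero>\<^bsub>M\<^esub> \<in> carrier N" and "\<phi> (\<zero>\<^bsub>M\<^esub> \<oplus>\<^bsub>M\<^esub> \<zero>\<^bsub>M\<^esub>) = \<phi> \<zero>\<^bsub>M\<^esub> \<oplus>\<^bsub>N\<^esub> \<phi> \<zero>\<^bsub>M\<^esub>"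
    using assms(3) M.M.zero_closed unfolding wmodule_hom_def by blast+
  then show ?thesis by (intro N.double_eq_zero) simp_all
qed

text \<open>A morphism preserves weights, so source and target are rescaled by the same scalars. The
  twist functor can therefore leave morphisms untouched.\<close>

lemma wmodule_hom_twist:
  assumes M: "twisting R \<alpha> G \<kappa> M R' \<kappa>' c" and N: "twisting R \<alpha> G \<kappa> N R' \<kappa>' c"
    and \<phi>: "\<phi> \<in> wmodule_hom (presented_alg R) G M N"
  shows "\<phi> \<in> wmodule_hom (presented_alg R') G (twist_module R R' \<alpha> G c M) (twist_module R R' \<alpha> G c N)"
proof -
  interpret M: twisting R \<alpha> G \<kappa> M R' \<kappa>' c by fact
  interpret N: twisting R \<alpha> G \<kappa> N R' \<kappa>' c by fact
  have closed: "\<phi> v \<in> carrier N" if "v \<in> carrier M" for v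
    using \<phi> that unfolding wmodule_hom_def by blast
  have add: "\<phi> (v \<oplus>\<^bsub>M\<^esub> w) = \<phi> v \<oplus>\<^bsub>N\<^esub> \<phi> w" if "v \<in> carrier M" "w \<in> carrier M" for v w
    using \<phi> that unfolding wmodule_hom_def by blast
  have wt: "\<phi> v \<in> wt N \<mu>" if "\<mu> \<in> G" "v \<in> wt M \<mu>" for \<mu> v
    using \<phi> that unfolding wmodule_hom_def by blast
  have act: "\<phi> (M.act x v) = N.act x (\<phi> v)" if "v \<in> carrier M" for x v
    using \<phi> that alg_class_simps(1)[of R x] unfolding wmodule_hom_def M.act_def N.act_def by blast
  have "\<phi> (alg_class R' x \<odot>\<^bsub>M.M'\<^esub> v) = alg_class R' x \<odot>\<^bsub>N.M'\<^esub> \<phi> v" if "v \<in> carrier M" for x v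
    using that
  proof (induction v rule: M.carrier_induct)
    case zero
    show ?case
      using wmodule_hom_zero[OF M.weighted_axioms N.weighted_axioms \<phi>]
      by (simp add: M.smult_twist_zero N.smult_twist_zero)
  next
    case (wt \<mu> u)
    show ?case
      using act[OF M.wt_carrier[OF wt(2,1)]] \<open>\<And>\<mu> v. \<mu> \<in> G \<Longrightarrow> v \<in> wt M \<mu> \<Longrightarrow> \<phi> v \<in> wt N \<mu>\<close>[OF wt]
      by (simp add: M.smult_twist_wt[OF wt] N.smult_twist_wt[OF wt(1)])
  next
    case (add u w)
    then show ?case
      using \<open>\<And>v w. v \<in> carrier M \<Longrightarrow> w \<in> carrier M \<Longrightarrow> \<phi> (v \<oplus>\<^bsub>M\<^esub> w) = \<phi> v \<oplus>\<^bsub>N\<^esub> \<phi> w\<close>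
      by (simp add: M.smult_twist_add_right M.smult_twist_closed N.smult_twist_add_right closed)
  qed
  then show ?thesis
    using \<phi> unfolding wmodule_hom_def by (auto elim!: carrier_presented_algE)
qed

text \<open>The agreement is asserted for arguments in the carriers only; elsewhere the two scalar
  multiplications may differ. A module twisted forth and back is thus isomorphic to the original
  through the identity map, but need not be equal to it as a record.\<close>

lemma smult_twist_twist:
  assumes M: "twisting R \<alpha> G \<kappa> M R' \<kappa>' c"
    and M': "twisting R' \<alpha> G \<kappa>' (twist_module R R' \<alpha> G c M) R \<kappa> c'"
    and inv: "\<And>g \<mu>. \<mu> \<in> G \<Longrightarrow> c g \<mu> * c' g \<mu> = 1"
    and X: "X \<in> carrier (presented_alg R)" and v: "v \<in> carrier M"
  shows "X \<odot>\<^bsub>twist_module R' R \<alpha> G c' (twist_module R R' \<alpha> G c M)\<^esub> v = X \<odot>\<^bsub>M\<^esub> v"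
proof -
  interpret M: twisting R \<alpha> G \<kappa> M R' \<kappa>' c by fact
  interpret M': twisting R' \<alpha> G \<kappa>' M.M' R \<kappa> c' by fact
  obtain x where x: "X = alg_class R x" using X by (rule carrier_presented_algE)
  have "alg_class R x \<odot>\<^bsub>M'.M'\<^esub> v = M.act x v"
    using v
  proof (induction v rule: M.carrier_induct)
    case zero
    show ?case using M'.smult_twist_zero by simp
  next
    case (wt \<mu> u)
    have "alg_class R x \<odot>\<^bsub>M'.M'\<^esub> u = alg_class R' (rescale \<alpha> c' \<mu> x) \<odot>\<^bsub>M.M'\<^esub> u"
      using M'.smult_twist_wt[of \<mu> u x] wt by (simp add: M'.act_def)
    also have "\<dots> = M.act x u"
      using wt by (simp add: M.smult_twist_wt rescale_inverse[OF inv _ M.G_add])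
    finally show ?case .
  next
    case (add u w)
    then show ?case using M'.smult_twist_add_right[of u w x] by (simp add: M.act_add_right)
  qed
  then show ?thesis by (simp add: x M.act_def)
qed

text \<open>Weight spaces are unchanged and constants are not rescaled, which settles finiteness and
  the bound on weights. Local nilpotency passes over with the same exponent, since a power of a
  generator is only multiplied by a scalar on each component.\<close>

lemma integrable_O_twist:
  assumes "twisting R \<alpha> G \<kappa> M R' \<kappa>' c" and int: "integrable_O R \<alpha> G M"
  shows "integrable_O R' \<alpha> G (twist_module R R' \<alpha> G c M)"
proof -
  interpret twisting R \<alpha> G \<kappa> M R' \<kappa>' c by fact
  interpret M': weighted R' \<alpha> G \<kappa>' M' by (rule weighted_twist)
  have "fin_gen_weight_space R' M' \<mu>" if \<mu>: "\<mu> \<in> G" for \<mu>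
  proof -
    have "fin_gen_weight_space R M \<mu>" using int \<mu> unfolding integrable_O_def by blast
    then obtain S where *: "finite S \<and> S \<subseteq> wt M \<mu> \<and>
        (\<forall>v\<in>wt M \<mu>. \<exists>b. v = (\<Oplus>\<^bsub>M\<^esub> s\<in>S. act (scal (b s)) s))"
      unfolding fin_gen_weight_space_def act_def by (elim exE)
    then have S: "finite S" "S \<subseteq> wt M \<mu>" by simp_all
    have "\<exists>b. v = (\<Oplus>\<^bsub>M'\<^esub> s\<in>S. alg_class R' (scal (b s)) \<odot>\<^bsub>M'\<^esub> s)" if "v \<in> wt M \<mu>" for v
    proof -
      obtain b where b: "v = (\<Oplus>\<^bsub>M\<^esub> s\<in>S. act (scal (b s)) s)" using * \<open>v \<in> wt M \<mu>\<close> by blast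
      have "(\<Oplus>\<^bsub>M\<^esub> s\<in>S. alg_class R' (scal (b s)) \<odot>\<^bsub>M'\<^esub> s) = (\<Oplus>\<^bsub>M\<^esub> s\<in>S. act (scal (b s)) s)"
      proof (rule M.finsum_cong')
        show "(\<lambda>s. act (scal (b s)) s) \<in> S \<rightarrow> carrier M"
        proof
          fix s assume "s \<in> S"
          then have "s \<in> carrier M" using S(2) wt_carrier[OF _ \<mu>] by auto
          then show "act (scal (b s)) s \<in> carrier M" by (rule act_closed)
        qed
        show "alg_class R' (scal (b s)) \<odot>\<^bsub>M'\<^esub> s = act (scal (b s)) s" if "s \<in> S" for s
          using that S(2) \<mu> by (simp add: smult_twist_wt[OF \<mu>] rescale_scal subset_iff)
      qed simp
      then show ?thesis using b by (intro exI[of _ b]) simp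
    qed
    then show ?thesis using S by (auto simp: fin_gen_weight_space_def)
  qed
  moreover have "\<exists>n. (smult M' (alg_class R' (var g)) ^^ n) v = \<zero>\<^bsub>M\<^esub>"
    if v: "v \<in> carrier M" and nil: "\<exists>n. (smult M (alg_class R (var g)) ^^ n) v = \<zero>\<^bsub>M\<^esub>" for g v
  proof -
    obtain n where n: "act (var g ^ n) v = \<zero>\<^bsub>M\<^esub>"
      using nil unfolding act_var_power[OF v] ..
    define w where "w = Word (replicate n g)"
    \<comment> \<open>The components of \<open>v\<close> are multiplied by different scalars, so
      vanishing is needed for each of them and not only for their sum.\<close>
    have comp: "act (var g ^ n) (wcomp v \<mu>) = \<zero>\<^bsub>M\<^esub>" if \<mu>: "\<mu> \<in> G" for \<mu>
    proof -
      have "wcomp (act (var g ^ n) v) (\<mu> + word_degree \<alpha> w) = act (var g ^ n) (wcomp v \<mu>)"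
        using \<mu> v by (intro comp_act_homogeneous) (auto simp: var_power w_def word_degree_in_root_lattice)
      then show ?thesis using G_add[OF \<mu> word_degree_in_root_lattice] by (simp add: n comp_zero)
    qed
    have "act (twist \<mu> (var g ^ n)) (wcomp v \<mu>) = \<zero>\<^bsub>M\<^esub>" if \<mu>: "\<mu> \<in> G" for \<mu>
    proof -
      have "twist \<mu> (var g ^ n) = scal (word_scale \<alpha> c \<mu> w) * var g ^ n"
        by (simp add: var_power w_def rescale_single scal_mult_single)
      then show ?thesis using comp[OF \<mu>] \<mu> v by (simp add: act_mult)
    qed
    then have "wext (\<lambda>\<mu>. act (twist \<mu> (var g ^ n))) v = \<zero>\<^bsub>M\<^esub>"
      unfolding weight_ext_def by (intro M.add.finprod_one_eqI) blast
    then have "M'.act (var g ^ n) v = \<zero>\<^bsub>M\<^esub>"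
      using v by (simp add: M'.act_def smult_twist)
    then have "(smult M' (alg_class R' (var g)) ^^ n) v = \<zero>\<^bsub>M\<^esub>"
      using v M'.act_var_power[of v n g] by simp
    then show ?thesis ..
  qed
  ultimately show ?thesis
    using int unfolding integrable_O_def twist_module_sel by blast
qed


section \<open>The equivalence of categories given by a twist\<close>

lemma wmodule_hom_id:
  assumes "left_module A M" and "\<And>\<mu>. \<mu> \<in> G \<Longrightarrow> wt M \<mu> \<subseteq> carrier M"
    and "carrier N = carrier M" and "add N = add M" and "\<And>\<mu>. \<mu> \<in> G \<Longrightarrow> wt N \<mu> = wt M \<mu>"
    and "\<And>X v. X \<in> carrier A \<Longrightarrow> v \<in> carrier M \<Longrightarrow> X \<odot>\<^bsub>N\<^esub> v = X \<odot>\<^bsub>M\<^esub> v"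
  shows "restrict (\<lambda>x. x) (carrier M) \<in> wmodule_hom A G M N"
proof -
  interpret left_module A M by fact
  show ?thesis using assms(2-6) by (auto simp: wmodule_hom_def smult_closed)
qed

lemma weighted_module_wt_subset:
  "weighted_module R \<alpha> G \<kappa> M \<Longrightarrow> \<mu> \<in> G \<Longrightarrow> wt M \<mu> \<subseteq> carrier M"
  unfolding weighted_module_def direct_sum_decomposition_def
  using additive_subgroup.a_subset by blast

lemma weighted_subcat_sel [simp]:
  "Ob (full_subcategory (weighted_cat T R \<alpha> G \<kappa>) P) = {M. weighted_module R \<alpha> G \<kappa> M \<and> P M}"
  "Hom (full_subcategory (weighted_cat T R \<alpha> G \<kappa>) P) = wmodule_hom (presented_alg R) G"
  "Id (full_subcategory (weighted_cat T R \<alpha> G \<kappa>) P) = (\<lambda>M. restrict (\<lambda>x. x) (carrier M))"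
  "Comp (full_subcategory (weighted_cat T R \<alpha> G \<kappa>) P) = (\<lambda>L M N \<psi> \<phi>. compose (carrier L) \<psi> \<phi>)"
  by (auto simp: full_subcategory_def weighted_cat_def)

lemma is_category_weighted_subcat: "is_category (full_subcategory (weighted_cat T R \<alpha> G \<kappa>) P)"
proof (unfold_locales, unfold weighted_subcat_sel mem_Collect_eq)
  fix X assume X: "weighted_module R \<alpha> G \<kappa> X \<and> P X"
  then show "restrict (\<lambda>x. x) (carrier X) \<in> wmodule_hom (presented_alg R) G X X"
    by (intro wmodule_hom_id weighted_module_wt_subset) (auto simp: weighted_module_def)
next
  fix X Y Z f g
  assume X: "weighted_module R \<alpha> G \<kappa> X \<and> P X" and f: "f \<in> wmodule_hom (presented_alg R) G X Y"
    and g: "g \<in> wmodule_hom (presented_alg R) G Y Z"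
  interpret X: left_module "presented_alg R" X using X by (simp add: weighted_module_def)
  have "compose (carrier X) g f ` wt X \<mu> \<subseteq> wt Z \<mu>" if "\<mu> \<in> G" for \<mu>
  proof -
    have "wt X \<mu> \<subseteq> carrier X" using X that weighted_module_wt_subset by blast
    moreover have "f ` wt X \<mu> \<subseteq> wt Y \<mu>" "g ` wt Y \<mu> \<subseteq> wt Z \<mu>"
      using f g that by (auto simp: wmodule_hom_def)
    ultimately show ?thesis by (auto simp: compose_def)
  qed
  moreover have "f v \<in> carrier Y" if "v \<in> carrier X" for v using f that by (auto simp: wmodule_hom_def)
  ultimately show "compose (carrier X) g f \<in> wmodule_hom (presented_alg R) G X Z"
    using f g by (auto simp: wmodule_hom_def compose_def X.smult_closed)
qed (auto simp: wmodule_hom_def compose_def restrict_def fun_eq_iff PiE_def extensional_def Pi_iff)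

definition rescales ::
  "('i gen, 'k::comm_ring_1) falg set \<Rightarrow> ('i gen, 'k) falg set \<Rightarrow> ('i \<Rightarrow> 'p::ab_group_add) \<Rightarrow> 'p set
    \<Rightarrow> ('i \<Rightarrow> 'p \<Rightarrow> 'k) \<Rightarrow> ('i \<Rightarrow> 'p \<Rightarrow> 'k) \<Rightarrow> ('i gen \<Rightarrow> 'p \<Rightarrow> 'k) \<Rightarrow> bool"
  where "rescales R R' \<alpha> G \<kappa> \<kappa>' c \<longleftrightarrow>
    (\<forall>r\<in>R'. \<forall>\<mu>\<in>G. rescale \<alpha> c \<mu> r \<in> weight_annihilator R \<kappa> \<mu>) \<and>
    (\<forall>i. \<forall>\<mu>\<in>G. c (K i) \<mu> * \<kappa> i \<mu> = \<kappa>' i \<mu>)"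

lemma twistingI:
  assumes "\<And>\<mu> \<beta>. \<mu> \<in> G \<Longrightarrow> \<beta> \<in> root_lattice \<alpha> \<Longrightarrow> \<mu> + \<beta> \<in> G"
    and "rescales R R' \<alpha> G \<kappa> \<kappa>' c" and "weighted_module R \<alpha> G \<kappa> M"
  shows "twisting R \<alpha> G \<kappa> M R' \<kappa>' c"
  using assms by unfold_locales (auto simp: rescales_def)

text \<open>The predicates \<open>P\<close> and \<open>P'\<close> cut out full subcategories. Taking
  them constantly true gives the equivalence of all weighted modules, taking integrability gives the
  one of the categories O, with one proof for both.\<close>

locale mutual_rescaling =
  fixes R R' :: "('i gen, 'k::comm_ring_1) falg set"
    and \<alpha> :: "'i \<Rightarrow> 'p::ab_group_add"
    and G :: "'p set"
    and \<kappa> \<kappa>' :: "'i \<Rightarrow> 'p \<Rightarrow> 'k"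
    and c c' :: "'i gen \<Rightarrow> 'p \<Rightarrow> 'k"
    and T :: "'v itself"
    and P P' :: "(('i gen, 'k) falg set, 'v, 'p) wmodule \<Rightarrow> bool"
  assumes G_add: "\<And>\<mu> \<beta>. \<mu> \<in> G \<Longrightarrow> \<beta> \<in> root_lattice \<alpha> \<Longrightarrow> \<mu> + \<beta> \<in> G"
    and c: "rescales R R' \<alpha> G \<kappa> \<kappa>' c" and c': "rescales R' R \<alpha> G \<kappa>' \<kappa> c'"
    and inverse: "\<And>g \<mu>. \<mu> \<in> G \<Longrightarrow> c g \<mu> * c' g \<mu> = 1"
    and P: "\<And>M. weighted_module R \<alpha> G \<kappa> M \<Longrightarrow> P M \<Longrightarrow> P' (twist_module R R' \<alpha> G c M)"
    and P': "\<And>M. weighted_module R' \<alpha> G \<kappa>' M \<Longrightarrow> P' M \<Longrightarrow> P (twist_module R' R \<alpha> G c' M)"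
begin

lemma swap: "mutual_rescaling R' R \<alpha> G \<kappa>' \<kappa> c' c P' P"
  by unfold_locales (use G_add c c' inverse P P' in \<open>auto simp: mult.commute\<close>)

abbreviation "C \<equiv> full_subcategory (weighted_cat T R \<alpha> G \<kappa>) P"
abbreviation "C' \<equiv> full_subcategory (weighted_cat T R' \<alpha> G \<kappa>') P'"
abbreviation "Tw \<equiv> twist_module R R' \<alpha> G c"
abbreviation "Tw' \<equiv> twist_module R' R \<alpha> G c'"

lemma twisting: "weighted_module R \<alpha> G \<kappa> M \<Longrightarrow> twisting R \<alpha> G \<kappa> M R' \<kappa>' c"
  by (rule twistingI[OF _ c]) (rule G_add)

lemma twisting': "weighted_module R' \<alpha> G \<kappa>' M \<Longrightarrow> twisting R' \<alpha> G \<kappa>' M R \<kappa> c'"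
  by (rule twistingI[OF _ c']) (rule G_add)

lemma Tw_weighted: "weighted_module R \<alpha> G \<kappa> M \<Longrightarrow> weighted_module R' \<alpha> G \<kappa>' (Tw M)"
  using twisting.weighted_twist[OF twisting] weighted.weighted_module by blast

lemma is_functor_Tw: "is_functor C C' Tw (\<lambda>_ _ \<phi>. \<phi>)"
proof (intro is_functor.intro is_functor_axioms.intro is_category_weighted_subcat, unfold weighted_subcat_sel mem_Collect_eq)
  fix X Y \<phi>
  assume "weighted_module R \<alpha> G \<kappa> X \<and> P X" "weighted_module R \<alpha> G \<kappa> Y \<and> P Y"
    "\<phi> \<in> wmodule_hom (presented_alg R) G X Y"
  then show "\<phi> \<in> wmodule_hom (presented_alg R') G (Tw X) (Tw Y)"
    using wmodule_hom_twist[OF twisting twisting] by blast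
qed (use Tw_weighted P in auto)

lemma id_hom:
  assumes "weighted_module R \<alpha> G \<kappa> M"
  shows "restrict (\<lambda>x. x) (carrier M) \<in> wmodule_hom (presented_alg R) G M (Tw' (Tw M))"
    and "restrict (\<lambda>x. x) (carrier M) \<in> wmodule_hom (presented_alg R) G (Tw' (Tw M)) M"
proof -
  note eq = smult_twist_twist[OF twisting[OF assms] twisting'[OF Tw_weighted[OF assms]] inverse]
  have M: "left_module (presented_alg R) M" using assms by (simp add: weighted_module_def)
  interpret S: mutual_rescaling R' R \<alpha> G \<kappa>' \<kappa> c' c T P' P by (rule swap)
  have M'': "left_module (presented_alg R) (Tw' (Tw M))"
    using S.Tw_weighted[OF Tw_weighted[OF assms]] by (simp add: weighted_module_def)
  show "restrict (\<lambda>x. x) (carrier M) \<in> wmodule_hom (presented_alg R) G M (Tw' (Tw M))"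
    using weighted_module_wt_subset[OF assms] eq by (intro wmodule_hom_id[OF M]) simp_all
  have "restrict (\<lambda>x. x) (carrier (Tw' (Tw M))) \<in> wmodule_hom (presented_alg R) G (Tw' (Tw M)) M"
    using weighted_module_wt_subset[OF assms] eq by (intro wmodule_hom_id[OF M'']) simp_all
  then show "restrict (\<lambda>x. x) (carrier M) \<in> wmodule_hom (presented_alg R) G (Tw' (Tw M)) M" by simp
qed

text \<open>Both directions are recorded: the first is the unit of the equivalence, and the second
  becomes the counit after the two presentations are exchanged by \<open>swap\<close>.\<close>

lemma natural_iso_Tw:
  "natural_iso C C (\<lambda>X. X) (\<lambda>X Y f. f) (\<lambda>X. Tw' (Tw X)) (\<lambda>X Y f. f) (\<lambda>M. restrict (\<lambda>x. x) (carrier M))"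
  "natural_iso C C (\<lambda>X. Tw' (Tw X)) (\<lambda>X Y f. f) (\<lambda>X. X) (\<lambda>X Y f. f) (\<lambda>M. restrict (\<lambda>x. x) (carrier M))"
proof -
  have idem: "compose (carrier M) (restrict (\<lambda>x. x) (carrier M)) (restrict (\<lambda>x. x) (carrier M))
      = restrict (\<lambda>x. x) (carrier M)" for M :: "(('i gen, 'k) falg set, 'v, 'p) wmodule"
    by (auto simp: compose_def)
  have nat: "compose (carrier X) (restrict (\<lambda>x. x) (carrier Y)) f = compose (carrier X) f (restrict (\<lambda>x. x) (carrier X))"
    if "f \<in> wmodule_hom (presented_alg R) G X Y" for f and X Y :: "(('i gen, 'k) falg set, 'v, 'p) wmodule"
    using that by (auto simp: compose_def wmodule_hom_def fun_eq_iff)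
  show "natural_iso C C (\<lambda>X. X) (\<lambda>X Y f. f) (\<lambda>X. Tw' (Tw X)) (\<lambda>X Y f. f) (\<lambda>M. restrict (\<lambda>x. x) (carrier M))"
    unfolding natural_iso_def is_iso_def weighted_subcat_sel twist_module_sel mem_Collect_eq
  proof (intro conjI ballI)
    fix X :: "(('i gen, 'k) falg set, 'v, 'p) wmodule"
    assume "X \<in> {M. weighted_module R \<alpha> G \<kappa> M \<and> P M}"
    then have X: "weighted_module R \<alpha> G \<kappa> X" by simp
    note hom = id_hom[OF X]
    show "restrict (\<lambda>x. x) (carrier X) \<in> wmodule_hom (presented_alg R) G X (Tw' (Tw X))" by (rule hom)
    show "\<exists>g\<in>wmodule_hom (presented_alg R) G (Tw' (Tw X)) X.
        compose (carrier X) g (restrict (\<lambda>x. x) (carrier X)) = restrict (\<lambda>x. x) (carrier X) \<and>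
        compose (carrier X) (restrict (\<lambda>x. x) (carrier X)) g = restrict (\<lambda>x. x) (carrier X)"
      by (rule bexI[OF _ hom(2)]) (simp add: idem)
    fix Y f
    assume f: "f \<in> wmodule_hom (presented_alg R) G X Y"
    show "compose (carrier X) (restrict (\<lambda>x. x) (carrier Y)) f = compose (carrier X) f (restrict (\<lambda>x. x) (carrier X))"
      by (rule nat[OF f])
  qed
  show "natural_iso C C (\<lambda>X. Tw' (Tw X)) (\<lambda>X Y f. f) (\<lambda>X. X) (\<lambda>X Y f. f) (\<lambda>M. restrict (\<lambda>x. x) (carrier M))"
    unfolding natural_iso_def is_iso_def weighted_subcat_sel twist_module_sel mem_Collect_eq
  proof (intro conjI ballI)
    fix X :: "(('i gen, 'k) falg set, 'v, 'p) wmodule"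
    assume "X \<in> {M. weighted_module R \<alpha> G \<kappa> M \<and> P M}"
    then have X: "weighted_module R \<alpha> G \<kappa> X" by simp
    note hom = id_hom[OF X]
    show "restrict (\<lambda>x. x) (carrier X) \<in> wmodule_hom (presented_alg R) G (Tw' (Tw X)) X" by (rule hom)
    show "\<exists>g\<in>wmodule_hom (presented_alg R) G X (Tw' (Tw X)).
        compose (carrier X) g (restrict (\<lambda>x. x) (carrier X)) = restrict (\<lambda>x. x) (carrier X) \<and>
        compose (carrier X) (restrict (\<lambda>x. x) (carrier X)) g = restrict (\<lambda>x. x) (carrier X)"
      by (rule bexI[OF _ hom(1)]) (simp add: idem)
    fix Y f
    assume f: "f \<in> wmodule_hom (presented_alg R) G X Y"
    show "compose (carrier X) (restrict (\<lambda>x. x) (carrier Y)) f = compose (carrier X) f (restrict (\<lambda>x. x) (carrier X))"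
      by (rule nat[OF f])
  qed
qed

theorem equivalent_weighted_subcats: "equivalent_categories C C'"
proof -
  interpret S: mutual_rescaling R' R \<alpha> G \<kappa>' \<kappa> c' c T P' P by (rule swap)
  show ?thesis
    unfolding equivalent_categories_def
    using is_functor_Tw S.is_functor_Tw natural_iso_Tw(1) S.natural_iso_Tw(2) by blast
qed

end

lemma full_subcategory_True: "full_subcategory C (\<lambda>_. True) = C"
  by (simp add: full_subcategory_def)

theorem equivalent_weighted_cats:
  fixes T :: "'v itself"
  assumes "\<And>\<mu> \<beta>. \<mu> \<in> G \<Longrightarrow> \<beta> \<in> root_lattice \<alpha> \<Longrightarrow> \<mu> + \<beta> \<in> G"
    and "rescales R R' \<alpha> G \<kappa> \<kappa>' c" and "rescales R' R \<alpha> G \<kappa>' \<kappa> c'"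
    and "\<And>g \<mu>. \<mu> \<in> G \<Longrightarrow> c g \<mu> * c' g \<mu> = 1"
  shows "equivalent_categories (weighted_cat T R \<alpha> G \<kappa>) (weighted_cat T R' \<alpha> G \<kappa>')"
    and "equivalent_categories
      (full_subcategory (weighted_cat T R \<alpha> G \<kappa>) (integrable_O R \<alpha> G))
      (full_subcategory (weighted_cat T R' \<alpha> G \<kappa>') (integrable_O R' \<alpha> G))"
proof -
  interpret mutual_rescaling R R' \<alpha> G \<kappa> \<kappa>' c c' T "\<lambda>_. True" "\<lambda>_. True"
    by unfold_locales (use assms in auto)
  show "equivalent_categories (weighted_cat T R \<alpha> G \<kappa>) (weighted_cat T R' \<alpha> G \<kappa>')"
    using equivalent_weighted_subcats by (simp add: full_subcategory_True)
next
  interpret mutual_rescaling R R' \<alpha> G \<kappa> \<kappa>' c c' T "integrable_O R \<alpha> G" "integrable_O R' \<alpha> G"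
    by unfold_locales
       (use assms integrable_O_twist[OF twistingI[OF _ assms(2)]] integrable_O_twist[OF twistingI[OF _ assms(3)]] in blast)+
  show "equivalent_categories
      (full_subcategory (weighted_cat T R \<alpha> G \<kappa>) (integrable_O R \<alpha> G))
      (full_subcategory (weighted_cat T R' \<alpha> G \<kappa>') (integrable_O R' \<alpha> G))"
    by (rule equivalent_weighted_subcats)
qed

section \<open>Units\<close>

lemma uinv_mult_self: "x dvd 1 \<Longrightarrow> uinv x * x = (1 :: 'k::comm_ring_1)"
  by (simp add: mult_uinv mult.commute)

lemma uinv_dvd_1: "x dvd 1 \<Longrightarrow> uinv x dvd (1 :: 'k::comm_ring_1)"
  by (metis dvd_triv_left uinv_mult_self)

lemma uinv_uinv: "x dvd 1 \<Longrightarrow> uinv (uinv x) = (x :: 'k::comm_ring_1)"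
  by (rule uinv_eqI) (rule uinv_mult_self)

lemma uinv_mult: "x dvd 1 \<Longrightarrow> y dvd 1 \<Longrightarrow> uinv (x * y) = uinv x * uinv (y :: 'k::comm_ring_1)"
proof (rule uinv_eqI)
  assume "x dvd 1" "y dvd 1"
  then have "(x * uinv x) * (y * uinv y) = 1" by (simp add: mult_uinv)
  then show "x * y * (uinv x * uinv y) = 1" by (simp only: ac_simps)
qed

lemma uinv_power: "x dvd 1 \<Longrightarrow> uinv (x ^ n) = uinv (x :: 'k::comm_ring_1) ^ n"
  by (rule uinv_eqI) (simp add: mult_uinv flip: power_mult_distrib)

lemma uinv_minus: "x dvd 1 \<Longrightarrow> uinv (- x) = - uinv (x :: 'k::comm_ring_1)"
  by (rule uinv_eqI) (simp add: mult_uinv)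

lemma power_dvd_1: "x dvd 1 \<Longrightarrow> x ^ n dvd (1 :: 'k::comm_ring_1)"
  by (metis dvd_power_same power_one)

lemma mult_dvd_1: "x dvd 1 \<Longrightarrow> y dvd 1 \<Longrightarrow> x * y dvd (1 :: 'k::comm_ring_1)"
  using mult_dvd_mono[of x 1 y 1] by simp

lemma unit_mult_left_cancel: "x dvd 1 \<Longrightarrow> x * y = x * z \<longleftrightarrow> y = (z :: 'k::comm_ring_1)"
  using uinv_mult_self[of x] by (metis mult.assoc mult_1)

lemma unit_swap_sides:
  fixes u v x y :: "'k::comm_ring_1"
  assumes "u * x = y * v" and "u * u' = 1" and "v * v' = 1"
  shows "u' * y = x * v'"
proof -
  have "u' * y = u' * (y * v) * v'" using assms(3) by (simp add: mult.assoc)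
  also have "\<dots> = (u * u') * x * v'" unfolding assms(1)[symmetric] by (simp add: ac_simps)
  finally show ?thesis using assms(2) by simp
qed


section \<open>Relations of quantum group type\<close>

text \<open>Signs, parameters and quantum factorials are all absorbed into \<open>s\<close>. A
  rescaling is diagonal on the words and changes nothing but this coefficient function.\<close>

definition serre :: "'g \<Rightarrow> 'g \<Rightarrow> nat \<Rightarrow> (nat \<Rightarrow> 'k) \<Rightarrow> ('g, 'k::comm_ring_1) falg"
  where "serre g g' n s =
    (\<Sum>k=0..n. Poly_Mapping.single (Word (replicate (n - k) g @ g' # replicate k g)) (s k))"

text \<open>
  The common shape of \<open>U_rels\<close> and \<open>Ut_rels\<close>; the inhomogeneous term of the relation between
  \<open>E i\<close> and \<open>F i\<close> is \<open>d0 i + d1 i K i + d2 i Kinv i\<close>.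
\<close>

definition quantum_rels ::
  "('i \<Rightarrow> 'i \<Rightarrow> nat) \<Rightarrow> ('i \<Rightarrow> 'i \<Rightarrow> 'k::comm_ring_1) \<Rightarrow> ('i \<Rightarrow> 'i \<Rightarrow> 'k) \<Rightarrow> ('i \<Rightarrow> 'k) \<Rightarrow> ('i \<Rightarrow> 'k) \<Rightarrow> ('i \<Rightarrow> 'k)
    \<Rightarrow> ('i \<Rightarrow> 'i \<Rightarrow> nat \<Rightarrow> 'k) \<Rightarrow> ('i \<Rightarrow> 'i \<Rightarrow> nat \<Rightarrow> 'k) \<Rightarrow> ('i gen, 'k) falg set"
  where "quantum_rels n q \<theta> d0 d1 d2 sF sE =
    {var (K i) * var (Kinv i) - 1 | i. True} \<union>
    {var (Kinv i) * var (K i) - 1 | i. True} \<union>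
    {var (K i) * var (K j) - var (K j) * var (K i) | i j. True} \<union>
    {var (K i) * var (E j) * var (Kinv i) - scal (q i j) * var (E j) | i j. True} \<union>
    {var (K i) * var (F j) * var (Kinv i) - scal (uinv (q i j)) * var (F j) | i j. True} \<union>
    {var (E i) * var (F j) - scal (\<theta> j i) * var (F j) * var (E i)
      - (if i = j then scal (d0 i) + scal (d1 i) * var (K i) + scal (d2 i) * var (Kinv i) else 0)
      | i j. True} \<union>
    {serre (F i) (F j) (n i j) (sF i j) | i j. i \<noteq> j} \<union>
    {serre (E i) (E j) (n i j) (sE i j) | i j. i \<noteq> j}"

lemma scal_mult_serre: "scal b * serre g g' n s = serre g g' n (\<lambda>k. b * s k)"
  by (simp add: serre_def sum_distrib_left scal_mult_single)

lemma rescale_var2: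
  "rescale \<alpha> c \<mu> (var a * var b) = scal (c a (\<mu> + gen_degree \<alpha> b) * c b \<mu>) * (var a * var b)"
  by (simp add: rescale_mult_var rescale_var scal_mult_assoc mult.assoc mult.commute)

lemma rescale_var3:
  "rescale \<alpha> c \<mu> (var a * var b * var d)
    = scal (c a (\<mu> + gen_degree \<alpha> d + gen_degree \<alpha> b) * c b (\<mu> + gen_degree \<alpha> d) * c d \<mu>)
      * (var a * var b * var d)"
proof -
  have "rescale \<alpha> c \<mu> (var a * var b * var d)
      = scal (c d \<mu>) * (scal (c a (\<mu> + gen_degree \<alpha> d + gen_degree \<alpha> b) * c b (\<mu> + gen_degree \<alpha> d))
        * (var a * var b) * var d)"
    by (simp only: rescale_mult_var[of _ _ _ "var a * var b"] rescale_var2)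
  then show ?thesis by (simp add: mult.assoc scal_mult_assoc ac_simps(5-8))
qed

fun gen_scale ::
  "('i \<Rightarrow> 'p \<Rightarrow> 'k) \<Rightarrow> ('i \<Rightarrow> 'p \<Rightarrow> 'k) \<Rightarrow> ('i \<Rightarrow> 'p \<Rightarrow> 'k) \<Rightarrow> ('i \<Rightarrow> 'p \<Rightarrow> 'k::comm_ring_1) \<Rightarrow> 'i gen \<Rightarrow> 'p \<Rightarrow> 'k"
  where
    "gen_scale x y \<kappa> \<kappa>' (E i) \<mu> = x i \<mu>"
  | "gen_scale x y \<kappa> \<kappa>' (F i) \<mu> = y i \<mu>"
  | "gen_scale x y \<kappa> \<kappa>' (K i) \<mu> = \<kappa>' i \<mu> * uinv (\<kappa> i \<mu>)"
  | "gen_scale x y \<kappa> \<kappa>' (Kinv i) \<mu> = \<kappa> i \<mu> * uinv (\<kappa>' i \<mu>)"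

text \<open>
  Rescaling \<open>E i\<close> by \<open>x i\<close> and \<open>F i\<close> by \<open>y i\<close> turns the relations with unprimed parameters into
  those with primed ones; all conditions are symmetric under exchanging the two sides.
\<close>

locale quantum_twist =
  fixes \<alpha> :: "'i \<Rightarrow> 'p::ab_group_add"
    and G :: "'p set"
    and n :: "'i \<Rightarrow> 'i \<Rightarrow> nat"
    and \<kappa> :: "'i \<Rightarrow> 'p \<Rightarrow> 'k::comm_ring_1"
    and q \<theta> :: "'i \<Rightarrow> 'i \<Rightarrow> 'k"
    and d0 d1 d2 :: "'i \<Rightarrow> 'k"
    and sF sE :: "'i \<Rightarrow> 'i \<Rightarrow> nat \<Rightarrow> 'k"
    and \<kappa>' :: "'i \<Rightarrow> 'p \<Rightarrow> 'k"
    and q' \<theta>' :: "'i \<Rightarrow> 'i \<Rightarrow> 'k"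
    and d0' d1' d2' :: "'i \<Rightarrow> 'k"
    and sF' sE' :: "'i \<Rightarrow> 'i \<Rightarrow> nat \<Rightarrow> 'k"
    and x y :: "'i \<Rightarrow> 'p \<Rightarrow> 'k"
    and s t :: "'i \<Rightarrow> 'i \<Rightarrow> 'k"
  assumes G_add: "\<mu> \<in> G \<Longrightarrow> \<beta> \<in> root_lattice \<alpha> \<Longrightarrow> \<mu> + \<beta> \<in> G"
    and \<kappa>_unit: "\<mu> \<in> G \<Longrightarrow> \<kappa> i \<mu> dvd 1" and \<kappa>'_unit: "\<mu> \<in> G \<Longrightarrow> \<kappa>' i \<mu> dvd 1"
    and x_unit: "\<mu> \<in> G \<Longrightarrow> x i \<mu> dvd 1" and y_unit: "\<mu> \<in> G \<Longrightarrow> y i \<mu> dvd 1"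
    and q_unit: "q i j dvd 1" and q'_unit: "q' i j dvd 1"
    and s_unit: "s i j dvd 1" and t_unit: "t i j dvd 1"
    and \<kappa>_add: "\<mu> \<in> G \<Longrightarrow> \<kappa> i (\<mu> + \<alpha> j) = q i j * \<kappa> i \<mu>"
    and \<kappa>'_add: "\<mu> \<in> G \<Longrightarrow> \<kappa>' i (\<mu> + \<alpha> j) = q' i j * \<kappa>' i \<mu>"
    and x_add: "\<mu> \<in> G \<Longrightarrow> x i (\<mu> + \<alpha> j) = s i j * x i \<mu>"
    and y_diff: "\<mu> \<in> G \<Longrightarrow> y i (\<mu> - \<alpha> j) = t i j * y i \<mu>"
    and EF: "\<mu> \<in> G \<Longrightarrow> (x i (\<mu> - \<alpha> j) * y j \<mu>) * \<theta> j i = \<theta>' j i * (x i \<mu> * y j (\<mu> + \<alpha> i))"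
    and EF_diag: "\<mu> \<in> G \<Longrightarrow> x i (\<mu> - \<alpha> i) * y i \<mu> * (d0 i + d1 i * \<kappa> i \<mu> + d2 i * uinv (\<kappa> i \<mu>))
      = d0' i + d1' i * \<kappa>' i \<mu> + d2' i * uinv (\<kappa>' i \<mu>)"
    and serre_F: "i \<noteq> j \<Longrightarrow> \<exists>C. C dvd 1 \<and> (\<forall>k\<le>n i j. (t i j ^ (n i j - k) * t j i ^ k) * sF' i j k = sF i j k * C)"
    and serre_E: "i \<noteq> j \<Longrightarrow> \<exists>C. C dvd 1 \<and> (\<forall>k\<le>n i j. (s i j ^ (n i j - k) * s j i ^ k) * sE' i j k = sE i j k * C)"
begin

abbreviation "rels \<equiv> quantum_rels n q \<theta> d0 d1 d2 sF sE"
abbreviation "rels' \<equiv> quantum_rels n q' \<theta>' d0' d1' d2' sF' sE'"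
abbreviation "c \<equiv> gen_scale x y \<kappa> \<kappa>'"

lemma G_add_gen: "\<mu> \<in> G \<Longrightarrow> \<mu> + gen_degree \<alpha> g \<in> G"
  by (intro G_add gen_degree_in_root_lattice)

lemma G_root: "\<mu> \<in> G \<Longrightarrow> \<mu> + \<alpha> i \<in> G" "\<mu> \<in> G \<Longrightarrow> \<mu> - \<alpha> i \<in> G"
  using G_add_gen[of \<mu> "E i"] G_add_gen[of \<mu> "F i"] by simp_all

text \<open>All scalars are units and every condition can be solved for the other side, so the
  inverse scalars form a twist in the opposite direction. The quasi-inverse functor then needs no
  computation of its own.\<close>

lemma swap:
  "quantum_twist \<alpha> G n \<kappa>' q' \<theta>' d0' d1' d2' sF' sE' \<kappa> q \<theta> d0 d1 d2 sF sE
    (\<lambda>i \<mu>. uinv (x i \<mu>)) (\<lambda>i \<mu>. uinv (y i \<mu>)) (\<lambda>i j. uinv (s i j)) (\<lambda>i j. uinv (t i j))"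
proof
  fix i j \<mu> assume \<mu>: "\<mu> \<in> G"
  note G = G_root[OF \<mu>]
  show "uinv (x i (\<mu> + \<alpha> j)) = uinv (s i j) * uinv (x i \<mu>)"
    by (simp add: x_add[OF \<mu>] uinv_mult s_unit x_unit[OF \<mu>])
  show "uinv (y i (\<mu> - \<alpha> j)) = uinv (t i j) * uinv (y i \<mu>)"
    by (simp add: y_diff[OF \<mu>] uinv_mult t_unit y_unit[OF \<mu>])
  show "uinv (x i (\<mu> - \<alpha> j)) * uinv (y j \<mu>) * \<theta>' j i = \<theta> j i * (uinv (x i \<mu>) * uinv (y j (\<mu> + \<alpha> i)))"
    using unit_swap_sides[OF EF[OF \<mu>, of i j] mult_uinv mult_uinv]
    by (simp add: mult_dvd_1 uinv_mult x_unit y_unit \<mu> G)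
  show "uinv (x i (\<mu> - \<alpha> i)) * uinv (y i \<mu>) * (d0' i + d1' i * \<kappa>' i \<mu> + d2' i * uinv (\<kappa>' i \<mu>))
      = d0 i + d1 i * \<kappa> i \<mu> + d2 i * uinv (\<kappa> i \<mu>)"
    using uinv_mult_self[of "x i (\<mu> - \<alpha> i) * y i \<mu>"]
    by (simp add: mult_dvd_1 x_unit y_unit \<mu> G flip: EF_diag[OF \<mu>] uinv_mult mult.assoc[of "uinv _"])
next
  fix i j :: 'i assume "i \<noteq> j"
  from serre_F[OF this] obtain C where C: "C dvd 1"
    "\<forall>k\<le>n i j. (t i j ^ (n i j - k) * t j i ^ k) * sF' i j k = sF i j k * C" by blast
  have "\<forall>k\<le>n i j. (uinv (t i j) ^ (n i j - k) * uinv (t j i) ^ k) * sF i j k = sF' i j k * uinv C"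
  proof (intro allI impI)
    fix k assume k: "k \<le> n i j"
    have "t i j ^ (n i j - k) * t j i ^ k dvd 1" by (intro mult_dvd_1 power_dvd_1 t_unit)
    from unit_swap_sides[OF C(2)[rule_format, OF k] mult_uinv[OF this] mult_uinv[OF C(1)]]
    show "uinv (t i j) ^ (n i j - k) * uinv (t j i) ^ k * sF i j k = sF' i j k * uinv C"
      by (simp add: uinv_mult uinv_power power_dvd_1 t_unit)
  qed
  then show "\<exists>C. C dvd 1 \<and> (\<forall>k\<le>n i j. uinv (t i j) ^ (n i j - k) * uinv (t j i) ^ k * sF i j k = sF' i j k * C)"
    using uinv_dvd_1[OF C(1)] by blast
next
  fix i j :: 'i assume "i \<noteq> j"
  from serre_E[OF this] obtain C where C: "C dvd 1"
    "\<forall>k\<le>n i j. (s i j ^ (n i j - k) * s j i ^ k) * sE' i j k = sE i j k * C" by blast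
  have "\<forall>k\<le>n i j. (uinv (s i j) ^ (n i j - k) * uinv (s j i) ^ k) * sE i j k = sE' i j k * uinv C"
  proof (intro allI impI)
    fix k assume k: "k \<le> n i j"
    have "s i j ^ (n i j - k) * s j i ^ k dvd 1" by (intro mult_dvd_1 power_dvd_1 s_unit)
    from unit_swap_sides[OF C(2)[rule_format, OF k] mult_uinv[OF this] mult_uinv[OF C(1)]]
    show "uinv (s i j) ^ (n i j - k) * uinv (s j i) ^ k * sE i j k = sE' i j k * uinv C"
      by (simp add: uinv_mult uinv_power power_dvd_1 s_unit)
  qed
  then show "\<exists>C. C dvd 1 \<and> (\<forall>k\<le>n i j. uinv (s i j) ^ (n i j - k) * uinv (s j i) ^ k * sE i j k = sE' i j k * C)"
    using uinv_dvd_1[OF C(1)] by blast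
qed (use G_add \<kappa>_unit \<kappa>'_unit x_unit y_unit q_unit q'_unit s_unit t_unit \<kappa>_add \<kappa>'_add in \<open>auto intro: uinv_dvd_1\<close>)

text \<open>The scalar of \<open>K i\<close> is the quotient of the eigenvalues
  \<open>\<kappa>'\<close> and \<open>\<kappa>\<close>, which are multiplied by \<open>q'\<close>
  and \<open>q\<close> under a shift by a simple root.\<close>

lemma K_shift:
  assumes "\<mu> \<in> G"
  shows "c (K i) (\<mu> + \<alpha> j) * q i j = q' i j * c (K i) \<mu>"
proof -
  have "uinv (\<kappa> i (\<mu> + \<alpha> j)) * q i j = uinv (\<kappa> i \<mu>)"
    by (simp add: \<kappa>_add[OF assms] uinv_mult q_unit \<kappa>_unit[OF assms])
       (simp add: mult.commute mult_uinv q_unit flip: mult.assoc)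
  then show ?thesis by (simp add: \<kappa>'_add[OF assms] mult.assoc)
qed

lemma K_Kinv: "\<mu> \<in> G \<Longrightarrow> c (K i) \<mu> * c (Kinv i) \<mu> = 1"
proof -
  assume \<mu>: "\<mu> \<in> G"
  have "c (K i) \<mu> * c (Kinv i) \<mu> = (\<kappa> i \<mu> * uinv (\<kappa> i \<mu>)) * (\<kappa>' i \<mu> * uinv (\<kappa>' i \<mu>))"
    by (simp add: ac_simps)
  then show ?thesis using \<mu> by (simp add: mult_uinv \<kappa>_unit \<kappa>'_unit)
qed

section \<open>The rescaled relations lie in the weight annihilator\<close>

abbreviation "A \<equiv> weight_annihilator rels \<kappa>"

text \<open>No eigenvalue of \<open>Kinv i\<close> is imposed. It follows inside the left ideal:
  subtracting \<open>Kinv i * (K i - \<kappa> i \<mu>)\<close> from \<open>Kinv i * K i - 1\<close>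
  leaves \<open>\<kappa> i \<mu> * Kinv i - 1\<close>, and the eigenvalue is a unit.\<close>

lemma Kinv_annihilator:
  assumes "\<mu> \<in> G"
  shows "var (Kinv i) - scal (uinv (\<kappa> i \<mu>)) \<in> A \<mu>"
proof -
  let ?u = "uinv (\<kappa> i \<mu>)"
  have "var (Kinv i) * var (K i) - 1 \<in> A \<mu>"
    by (rule weight_annihilator.rel) (auto simp: quantum_rels_def)
  moreover have "var (Kinv i) * (var (K i) - scal (\<kappa> i \<mu>)) \<in> A \<mu>"
    by (intro weight_annihilator.mult weight_annihilator.weight)
  ultimately have "scal ?u * ((var (Kinv i) * var (K i) - 1) - var (Kinv i) * (var (K i) - scal (\<kappa> i \<mu>))) \<in> A \<mu>"
    by (rule weight_annihilator.mult[OF weight_annihilator_diff])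
  also have "scal ?u * ((var (Kinv i) * var (K i) - 1) - var (Kinv i) * (var (K i) - scal (\<kappa> i \<mu>)))
      = var (Kinv i) - scal ?u"
    using uinv_mult_self[OF \<kappa>_unit[OF assms]]
    by (simp add: right_diff_distrib scal_commute scal_mult_assoc)
  finally show ?thesis .
qed

lemma scal_rel_annihilator: "r \<in> rels \<Longrightarrow> scal b * r \<in> A \<mu>"
  by (intro weight_annihilator.mult weight_annihilator.rel)

lemma EF_rel:
  "var (E i) * var (F j) - scal (\<theta> j i) * var (F j) * var (E i)
    - (if i = j then scal (d0 i) + scal (d1 i) * var (K i) + scal (d2 i) * var (Kinv i) else 0) \<in> rels"
  unfolding quantum_rels_def by blast

text \<open>The only relation whose terms scale differently, so that a multiple of the old relation
  does not suffice and the eigenvalues of \<open>K i\<close> and \<open>Kinv i\<close> are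
  needed.\<close>

lemma rescale_EF_diag:
  assumes \<mu>: "\<mu> \<in> G"
  shows "rescale \<alpha> c \<mu> (var (E i) * var (F i) - scal (\<theta>' i i) * var (F i) * var (E i)
    - (scal (d0' i) + scal (d1' i) * var (K i) + scal (d2' i) * var (Kinv i))) \<in> A \<mu>"
proof -
  define X where "X = x i (\<mu> - \<alpha> i) * y i \<mu>"
  \<comment> \<open>\<open>A1\<close> and \<open>A2\<close> are the multiples of
    \<open>K i - \<kappa> i \<mu>\<close> and \<open>Kinv i - uinv (\<kappa> i \<mu>)\<close> that
    correct the coefficients of \<open>K i\<close> and \<open>Kinv i\<close>. The constant term is
    then right by \<open>EF_diag\<close>.\<close>
  define A1 where "A1 = X * d1 i - d1' i * c (K i) \<mu>"
  define A2 where "A2 = X * d2 i - d2' i * c (Kinv i) \<mu>"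
  let ?r = "var (E i) * var (F i) - scal (\<theta> i i) * var (F i) * var (E i)
    - (scal (d0 i) + scal (d1 i) * var (K i) + scal (d2 i) * var (Kinv i))"
  have "?r \<in> rels" using EF_rel[of i i] by simp
  then have "scal X * ?r + scal A1 * (var (K i) - scal (\<kappa> i \<mu>))
      + scal A2 * (var (Kinv i) - scal (uinv (\<kappa> i \<mu>))) \<in> A \<mu>"
    by (intro weight_annihilator.add scal_rel_annihilator weight_annihilator.mult
        weight_annihilator.weight Kinv_annihilator \<mu>)
  also have "scal X * ?r + scal A1 * (var (K i) - scal (\<kappa> i \<mu>))
      + scal A2 * (var (Kinv i) - scal (uinv (\<kappa> i \<mu>)))
    = scal X * (var (E i) * var (F i)) - scal (X * \<theta> i i) * (var (F i) * var (E i))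
      - scal (X * d0 i + A1 * \<kappa> i \<mu> + A2 * uinv (\<kappa> i \<mu>))
      - scal (d1' i * c (K i) \<mu>) * var (K i) - scal (d2' i * c (Kinv i) \<mu>) * var (Kinv i)"
    by (simp add: A1_def A2_def scal_add scal_diff ring_distribs scal_mult_assoc mult.assoc flip: scal_mult)
  also have "X * d0 i + A1 * \<kappa> i \<mu> + A2 * uinv (\<kappa> i \<mu>) = d0' i"
  proof -
    have "c (K i) \<mu> * \<kappa> i \<mu> = \<kappa>' i \<mu>"
      by (simp add: mult.assoc uinv_mult_self \<kappa>_unit \<mu>)
    moreover have "c (Kinv i) \<mu> * uinv (\<kappa> i \<mu>) = \<kappa> i \<mu> * uinv (\<kappa> i \<mu>) * uinv (\<kappa>' i \<mu>)"
      by (simp only: gen_scale.simps ac_simps)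
    then have "c (Kinv i) \<mu> * uinv (\<kappa> i \<mu>) = uinv (\<kappa>' i \<mu>)"
      by (simp add: mult_uinv \<kappa>_unit \<mu>)
    ultimately have "A1 * \<kappa> i \<mu> = X * d1 i * \<kappa> i \<mu> - d1' i * \<kappa>' i \<mu>"
      "A2 * uinv (\<kappa> i \<mu>) = X * d2 i * uinv (\<kappa> i \<mu>) - d2' i * uinv (\<kappa>' i \<mu>)"
      by (simp_all only: A1_def A2_def left_diff_distrib mult.assoc)
    moreover have "d0' i = X * (d0 i + d1 i * \<kappa> i \<mu> + d2 i * uinv (\<kappa> i \<mu>))
        - d1' i * \<kappa>' i \<mu> - d2' i * uinv (\<kappa>' i \<mu>)"
      unfolding X_def EF_diag[OF \<mu>] by simp
    ultimately show ?thesis by (simp only: ring_distribs mult.assoc) simp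
  qed
  also have "X * \<theta> i i = \<theta>' i i * (y i (\<mu> + \<alpha> i) * x i \<mu>)"
    using EF[OF \<mu>, of i i] by (simp add: X_def mult.commute)
  finally show ?thesis
    by (simp add: rescale_diff rescale_add rescale_scal_mult rescale_scal rescale_var rescale_var2
        scal_mult_assoc mult.assoc X_def algebra_simps del: gen_scale.simps(3,4))
qed

lemma rescale_EF_off_diag:
  assumes \<mu>: "\<mu> \<in> G" and "i \<noteq> j"
  shows "rescale \<alpha> c \<mu> (var (E i) * var (F j) - scal (\<theta>' j i) * var (F j) * var (E i)) \<in> A \<mu>"
proof -
  let ?X = "x i (\<mu> - \<alpha> j) * y j \<mu>"
  have "var (E i) * var (F j) - scal (\<theta> j i) * var (F j) * var (E i) - 0 \<in> rels"
    using EF_rel[of i j] \<open>i \<noteq> j\<close> by simp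
  then have "scal ?X * (var (E i) * var (F j) - scal (\<theta> j i) * var (F j) * var (E i) - 0) \<in> A \<mu>"
    by (rule scal_rel_annihilator)
  also have "scal ?X * (var (E i) * var (F j) - scal (\<theta> j i) * var (F j) * var (E i) - 0)
      = scal ?X * (var (E i) * var (F j)) - scal (?X * \<theta> j i) * (var (F j) * var (E i))"
    by (simp add: right_diff_distrib scal_mult_assoc mult.assoc)
  also have "?X * \<theta> j i = \<theta>' j i * (y j (\<mu> + \<alpha> i) * x i \<mu>)"
    using EF[OF \<mu>, of i j] by (simp add: mult.commute)
  finally show ?thesis
    by (simp add: rescale_diff rescale_scal_mult rescale_var2 scal_mult_assoc mult.assoc)
qed

text \<open>Treats \<open>E j\<close> and \<open>F j\<close> alike. At weight \<mu> the scalars of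
  \<open>K i\<close> and \<open>Kinv i\<close> cancel, and \<open>shift\<close> accounts for
  \<open>K i\<close> acting only after \<open>g\<close> has changed the weight.\<close>

lemma rescale_K_commute:
  assumes "\<mu> \<in> G"
    and shift: "c (K i) (\<mu> + gen_degree \<alpha> g) * b = b' * c (K i) \<mu>"
    and rel: "var (K i) * var g * var (Kinv i) - scal b * var g \<in> rels"
  shows "rescale \<alpha> c \<mu> (var (K i) * var g * var (Kinv i) - scal b' * var g) \<in> A \<mu>"
proof -
  let ?X = "c (K i) (\<mu> + gen_degree \<alpha> g) * c g \<mu> * c (Kinv i) \<mu>"
  have "scal ?X * (var (K i) * var g * var (Kinv i) - scal b * var g) \<in> A \<mu>"
    using rel by (rule scal_rel_annihilator)
  also have "scal ?X * (var (K i) * var g * var (Kinv i) - scal b * var g)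
      = scal ?X * (var (K i) * var g * var (Kinv i)) - scal (?X * b) * var g"
    by (simp add: right_diff_distrib scal_mult_assoc)
  also have "?X * b = c g \<mu> * c (Kinv i) \<mu> * (c (K i) (\<mu> + gen_degree \<alpha> g) * b)"
    by (simp only: ac_simps)
  also have "\<dots> = b' * c g \<mu> * (c (K i) \<mu> * c (Kinv i) \<mu>)"
    unfolding shift by (simp only: ac_simps)
  finally show ?thesis
    using K_Kinv[OF assms(1), of i]
    by (simp add: rescale_diff rescale_scal_mult rescale_var3 rescale_var scal_mult_assoc del: gen_scale.simps)
qed

text \<open>Compared with the word in which nothing interferes, each of the \<open>m - k\<close>
  letters to the left of \<open>g'\<close> meets a weight shifted by the degree of \<open>g'\<close>
  and contributes \<open>u\<close>, while \<open>g'\<close> itself acts after \<open>k\<close>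
  letters \<open>g\<close>, each contributing \<open>v\<close>.\<close>

lemma list_scale_serre:
  assumes "\<mu> \<in> G"
    and gg': "\<And>\<nu>. \<nu> \<in> G \<Longrightarrow> c g (\<nu> + gen_degree \<alpha> g') = u * c g \<nu>"
    and g'g: "\<And>\<nu>. \<nu> \<in> G \<Longrightarrow> c g' (\<nu> + gen_degree \<alpha> g) = v * c g' \<nu>"
    and "k \<le> m"
  shows "list_scale \<alpha> c \<mu> (replicate (m - k) g @ g' # replicate k g)
    = u ^ (m - k) * v ^ k * (c g' \<mu> * list_scale \<alpha> c \<mu> (replicate m g))"
proof -
  define d where "d l = sum_list (replicate l (gen_degree \<alpha> g))" for l
  have G: "\<nu> + d l \<in> G" if "\<nu> \<in> G" for \<nu> l
    using G_add[OF that sum_list_degree_in_root_lattice[of \<alpha> "replicate l g"]] by (simp add: d_def)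
  have d_Suc: "d (Suc l) = gen_degree \<alpha> g + d l" for l by (simp add: d_def)
  have 1: "c g' (\<mu> + d l) = v ^ l * c g' \<mu>" for l
  proof (induction l)
    case (Suc l)
    have "c g' (\<mu> + d (Suc l)) = v * c g' (\<mu> + d l)"
      using g'g[OF G[OF assms(1)], of l] by (simp add: d_Suc ac_simps)
    then show ?case using Suc by (simp add: ac_simps)
  qed (simp add: d_def)
  have 2: "list_scale \<alpha> c (\<nu> + gen_degree \<alpha> g') (replicate l g) = u ^ l * list_scale \<alpha> c \<nu> (replicate l g)"
    if \<nu>: "\<nu> \<in> G" for \<nu> l
  proof (induction l)
    case (Suc l)
    have "c g (\<nu> + gen_degree \<alpha> g' + d l) = u * c g (\<nu> + d l)"
      using gg'[OF G[OF \<nu>], of l] by (simp add: ac_simps)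
    then show ?case using Suc by (simp add: d_def[symmetric] mult.assoc mult.left_commute)
  qed simp
  have "replicate m g = replicate (m - k) g @ replicate k g"
    using \<open>k \<le> m\<close> by (simp flip: replicate_add)
  then have 3: "list_scale \<alpha> c \<mu> (replicate m g)
      = list_scale \<alpha> c (\<mu> + d k) (replicate (m - k) g) * list_scale \<alpha> c \<mu> (replicate k g)"
    by (simp add: list_scale_append d_def)
  have "list_scale \<alpha> c \<mu> (replicate (m - k) g @ g' # replicate k g)
      = list_scale \<alpha> c (\<mu> + d k + gen_degree \<alpha> g') (replicate (m - k) g)
        * (c g' (\<mu> + d k) * list_scale \<alpha> c \<mu> (replicate k g))"
    by (simp add: list_scale_append d_def ac_simps)
  then show ?thesis
    unfolding 1 2[OF G[OF assms(1)]] 3 by (simp add: ac_simps)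
qed

text \<open>By \<open>list_scale_serre\<close> the scalars depend on \<open>k\<close> only through
  \<open>u ^ (m - k) * v ^ k\<close>. Hypothesis \<open>C\<close> absorbs this into the change of
  coefficients, so the rescaled relation is a scalar multiple of the old one.\<close>

lemma rescale_serre:
  assumes "\<mu> \<in> G"
    and gg': "\<And>\<nu>. \<nu> \<in> G \<Longrightarrow> c g (\<nu> + gen_degree \<alpha> g') = u * c g \<nu>"
    and g'g: "\<And>\<nu>. \<nu> \<in> G \<Longrightarrow> c g' (\<nu> + gen_degree \<alpha> g) = v * c g' \<nu>"
    and C: "\<forall>k\<le>m. (u ^ (m - k) * v ^ k) * z' k = z k * C"
    and rel: "serre g g' m z \<in> rels"
  shows "rescale \<alpha> c \<mu> (serre g g' m z') \<in> A \<mu>"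
proof -
  let ?X = "C * (c g' \<mu> * list_scale \<alpha> c \<mu> (replicate m g))"
  have "rescale \<alpha> c \<mu> (serre g g' m z') = serre g g' m (\<lambda>k. ?X * z k)"
    unfolding serre_def rescale_sum
  proof (rule sum.cong)
    fix k assume "k \<in> {0..m}"
    then have "k \<le> m" by simp
    have "word_scale \<alpha> c \<mu> (Word (replicate (m - k) g @ g' # replicate k g)) * z' k
        = (u ^ (m - k) * v ^ k * z' k) * (c g' \<mu> * list_scale \<alpha> c \<mu> (replicate m g))"
      using list_scale_serre[OF assms(1) gg' g'g \<open>k \<le> m\<close>] by (simp add: word_scale_def ac_simps)
    also have "\<dots> = ?X * z k"
      using C \<open>k \<le> m\<close> by (simp add: ac_simps)
    finally show "rescale \<alpha> c \<mu> (Poly_Mapping.single (Word (replicate (m - k) g @ g' # replicate k g)) (z' k))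
        = Poly_Mapping.single (Word (replicate (m - k) g @ g' # replicate k g)) (?X * z k)"
      by (simp add: rescale_single)
  qed simp
  then show ?thesis using scal_rel_annihilator[OF rel, of ?X] by (simp add: scal_mult_serre)
qed

lemma rescales: "rescales rels rels' \<alpha> G \<kappa> \<kappa>' c"
  unfolding rescales_def
proof (intro conjI allI ballI)
  fix i \<mu> assume "\<mu> \<in> G"
  then show "c (K i) \<mu> * \<kappa> i \<mu> = \<kappa>' i \<mu>"
    using uinv_mult_self[OF \<kappa>_unit, of \<mu> i] by (simp add: mult.assoc)
next
  fix r \<mu> assume r: "r \<in> rels'" and \<mu>: "\<mu> \<in> G"
  note G = G_root[OF \<mu>]
  consider (KKinv) i where "r = var (K i) * var (Kinv i) - 1"
    | (KinvK) i where "r = var (Kinv i) * var (K i) - 1"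
    | (KK) i j where "r = var (K i) * var (K j) - var (K j) * var (K i)"
    | (KE) i j where "r = var (K i) * var (E j) * var (Kinv i) - scal (q' i j) * var (E j)"
    | (KF) i j where "r = var (K i) * var (F j) * var (Kinv i) - scal (uinv (q' i j)) * var (F j)"
    | (EF) i j where "r = var (E i) * var (F j) - scal (\<theta>' j i) * var (F j) * var (E i)
      - (if i = j then scal (d0' i) + scal (d1' i) * var (K i) + scal (d2' i) * var (Kinv i) else 0)"
    | (FF) i j where "i \<noteq> j" "r = serre (F i) (F j) (n i j) (sF' i j)"
    | (EE) i j where "i \<noteq> j" "r = serre (E i) (E j) (n i j) (sE' i j)"
    using r unfolding quantum_rels_def by blast
  then show "rescale \<alpha> c \<mu> r \<in> A \<mu>"
  proof cases
    case KKinv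
    have "rescale \<alpha> c \<mu> r = scal 1 * (var (K i) * var (Kinv i) - 1)"
      using K_Kinv[OF \<mu>, of i] by (simp add: KKinv rescale_diff rescale_var2 rescale_1 del: gen_scale.simps)
    moreover have "scal 1 * (var (K i) * var (Kinv i) - 1) \<in> A \<mu>"
      by (rule scal_rel_annihilator) (auto simp: quantum_rels_def)
    ultimately show ?thesis by simp
  next
    case KinvK
    have "rescale \<alpha> c \<mu> r = scal 1 * (var (Kinv i) * var (K i) - 1)"
      using K_Kinv[OF \<mu>, of i]
      by (simp add: KinvK rescale_diff rescale_var2 rescale_1 mult.commute del: gen_scale.simps)
    moreover have "scal 1 * (var (Kinv i) * var (K i) - 1) \<in> A \<mu>"
      by (rule scal_rel_annihilator) (auto simp: quantum_rels_def)
    ultimately show ?thesis by simp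
  next
    case KK
    have "rescale \<alpha> c \<mu> r = scal (c (K i) \<mu> * c (K j) \<mu>) * (var (K i) * var (K j) - var (K j) * var (K i))"
      by (simp add: KK rescale_diff rescale_var2 right_diff_distrib mult.commute del: gen_scale.simps)
    moreover have "\<dots> \<in> A \<mu>"
      by (rule scal_rel_annihilator) (auto simp: quantum_rels_def)
    ultimately show ?thesis by simp
  next
    case KE
    show ?thesis unfolding KE
      by (rule rescale_K_commute[OF \<mu>, where b = "q i j"])
         (use K_shift[OF \<mu>, of i j] in \<open>auto simp: quantum_rels_def\<close>)
  next
    case KF
    have "c (K i) (\<mu> - \<alpha> j) * uinv (q i j) = uinv (q' i j) * c (K i) \<mu>"
    proof -
      \<comment> \<open>Since \<open>F j\<close> lowers the weight, \<open>K_shift\<close> is read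
        at \<open>\<mu> - \<alpha> j\<close> and solved for the scalar there.\<close>
      have "c (K i) \<mu> * q i j = q' i j * c (K i) (\<mu> - \<alpha> j)"
        using K_shift[OF G(2)[of j], of i j] by simp
      then show ?thesis
        using unit_swap_sides[OF _ mult_uinv[OF q'_unit] mult_uinv[OF q_unit]] by metis
    qed
    then show ?thesis unfolding KF
      by (intro rescale_K_commute[OF \<mu>, where b = "uinv (q i j)"]) (auto simp: quantum_rels_def)
  next
    case EF
    show ?thesis
    proof (cases "i = j")
      case True
      then show ?thesis using rescale_EF_diag[OF \<mu>, of i] by (simp add: EF)
    next
      case False
      then show ?thesis using rescale_EF_off_diag[OF \<mu> False] by (simp add: EF)
    qed
  next
    case FF
    obtain C where "\<forall>k\<le>n i j. (t i j ^ (n i j - k) * t j i ^ k) * sF' i j k = sF i j k * C"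
      using serre_F[OF FF(1)] by blast
    then show ?thesis
      unfolding FF(2) using \<open>i \<noteq> j\<close>
      by (intro rescale_serre[OF \<mu>, where z = "sF i j"]) (auto simp: y_diff quantum_rels_def)
  next
    case EE
    obtain C where "\<forall>k\<le>n i j. (s i j ^ (n i j - k) * s j i ^ k) * sE' i j k = sE i j k * C"
      using serre_E[OF EE(1)] by blast
    then show ?thesis
      unfolding EE(2) using \<open>i \<noteq> j\<close>
      by (intro rescale_serre[OF \<mu>, where z = "sE i j"]) (auto simp: x_add quantum_rels_def)
  qed
qed

lemma gen_scale_inverse:
  assumes \<mu>: "\<mu> \<in> G"
  shows "c g \<mu> * gen_scale (\<lambda>i \<mu>. uinv (x i \<mu>)) (\<lambda>i \<mu>. uinv (y i \<mu>)) \<kappa>' \<kappa> g \<mu> = 1"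
proof (cases g)
  case (K i)
  then show ?thesis using K_Kinv[OF \<mu>, of i] by simp
next
  case (Kinv i)
  then show ?thesis using K_Kinv[OF \<mu>, of i] by (simp add: mult.commute)
qed (simp_all add: mult_uinv x_unit y_unit \<mu>)

lemmas equivalent_cats = equivalent_weighted_cats
  [OF G_add rescales quantum_twist.rescales[OF swap] gen_scale_inverse, simplified]

end


section \<open>Integer powers of units\<close>

lemma upow_int [simp]: "upow x (int n) = x ^ n"
  by (simp add: upow_def)

lemma upow_minus_int: "upow x (- int n) = uinv x ^ n"
  by (cases n) (simp_all add: upow_def nat_add_distrib)

lemma upow_minus:
  assumes "x dvd 1"
  shows "upow x (- n) = uinv (upow x n)"
proof (cases n rule: int_cases2)
  case (nonneg m)
  then show ?thesis using assms by (simp add: upow_minus_int uinv_power)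
next
  case (nonpos m)
  then show ?thesis using assms by (simp add: upow_minus_int uinv_power uinv_dvd_1 uinv_uinv)
qed

lemma upow_dvd_1: "x dvd 1 \<Longrightarrow> upow x n dvd 1"
  by (simp add: upow_def power_dvd_1 uinv_dvd_1)

lemma upow_0 [simp]: "upow x 0 = 1"
  by (simp add: upow_def)

lemma upow_add_1:
  assumes "x dvd 1"
  shows "upow x (n + 1) = x * upow x n"
proof (cases "0 \<le> n")
  case True
  then show ?thesis by (simp add: upow_def nat_add_distrib)
next
  case False
  define m where "m = nat (- n - 1)"
  then have m: "n = - int (Suc m)" "n + 1 = - int m" using False by simp_all
  have "uinv x ^ m = x * uinv x ^ Suc m"
    using mult_uinv[OF assms] by (simp flip: mult.assoc)
  then show ?thesis unfolding m(2) unfolding m(1) upow_minus_int .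
qed

lemma upow_add:
  assumes "x dvd 1"
  shows "upow x (n + m) = upow x n * upow x m"
proof (induction m rule: int_induct[where k = 0])
  case (step1 m)
  have "upow x (n + (m + 1)) = x * upow x (n + m)"
    using upow_add_1[OF assms, of "n + m"] by (simp add: add.assoc)
  then show ?case using step1 by (simp add: upow_add_1[OF assms] mult.left_commute)
next
  case (step2 m)
  have "x * upow x (n + (m - 1)) = upow x (n + m)"
    using upow_add_1[OF assms, of "n + (m - 1)"] by simp
  also have "\<dots> = x * (upow x n * upow x (m - 1))"
    using step2 upow_add_1[OF assms, of "m - 1"] by (simp add: mult.left_commute)
  finally show ?case using unit_mult_left_cancel[OF assms] by blast
qed simp

lemma upow_square:
  assumes "x dvd 1"
  shows "upow (x ^ 2) n = upow x (2 * n)"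
proof (cases n rule: int_cases2)
  case (nonneg m)
  have "2 * n = int (2 * m)" using nonneg by simp
  then show ?thesis unfolding nonneg by (simp only: upow_int power_mult)
next
  case (nonpos m)
  have "2 * n = - int (2 * m)" using nonpos by simp
  then show ?thesis unfolding nonpos by (simp only: upow_minus_int power_mult uinv_power[OF assms])
qed


section \<open>Coefficients of the Serre relations\<close>

lemma divpow_serre_term:
  "scal b * divpow d (var g) m * var g' * divpow d (var g) k
    = Poly_Mapping.single (Word (replicate m g @ g' # replicate k g)) (b * uinv (d m) * uinv (d k))"
  by (simp add: divpow_def var_power var_def[of g'] scal_mult_single mult_single word_plus mult.assoc
      scal_def[of b])

abbreviation Ut_coeff_F where
  "Ut_coeff_F a \<theta> p \<equiv> \<lambda>i j k. upow (- \<theta> j i) (- int k) * p i ^ (k * (k - 1) div 2)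
    * uinv (Ut_fact (p i) (nat (1 - a i j) - k)) * uinv (Ut_fact (p i) k)"

text \<open>In \<open>Ut_rels\<close> the Serre relation for \<open>E\<close> has the
  \<open>k\<close>-th divided power on the left, whereas \<open>serre\<close> counts the letters on
  the right; hence the reflection of \<open>k\<close> in the exponents.\<close>

abbreviation Ut_coeff_E where
  "Ut_coeff_E a \<theta> p \<equiv> \<lambda>i j k. upow (- \<theta> i j) (- int (nat (1 - a i j) - k))
    * p i ^ ((nat (1 - a i j) - k) * (nat (1 - a i j) - k - 1) div 2)
    * uinv (Ut_fact (p i) (nat (1 - a i j) - k)) * uinv (Ut_fact (p i) k)"

abbreviation U_coeff_F where
  "U_coeff_F a \<theta> pp p \<equiv> \<lambda>i j k. (- (pp i j * upow (p i) (- a i j) * uinv (\<theta> j i))) ^ k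
    * uinv (U_fact (p i) (nat (1 - a i j) - k)) * uinv (U_fact (p i) k)"

abbreviation U_coeff_E where
  "U_coeff_E a \<theta> pp p \<equiv> \<lambda>i j k. (- (pp i j * upow (p i) (- a i j) * \<theta> i j)) ^ k
    * uinv (U_fact (p i) (nat (1 - a i j) - k)) * uinv (U_fact (p i) k)"

lemma U_rels_eq:
  "U_rels a \<theta> pp p = quantum_rels (\<lambda>i j. nat (1 - a i j)) pp \<theta>
    (\<lambda>_. 0) (\<lambda>i. uinv (p i - uinv (p i))) (\<lambda>i. - uinv (p i - uinv (p i)))
    (U_coeff_F a \<theta> pp p) (U_coeff_E a \<theta> pp p)"
  unfolding U_rels_def quantum_rels_def serre_def divpow_serre_term
  by (simp add: right_diff_distrib scal_minus)

lemma Ut_rels_eq: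
  assumes "\<And>i. p i dvd 1"
  shows "Ut_rels a \<theta> p = quantum_rels (\<lambda>i j. nat (1 - a i j)) (\<lambda>i j. upow (p i) (a i j)) \<theta>
    (\<lambda>i. uinv (1 - p i)) (\<lambda>i. - uinv (1 - p i)) (\<lambda>_. 0)
    (Ut_coeff_F a \<theta> p) (Ut_coeff_E a \<theta> p)"
proof -
  have E: "(\<Sum>k=0..n. scal (f k) * divpow d (var (E i)) k * var (E j) * divpow d (var (E i)) (n - k))
    = serre (E i) (E j) n (\<lambda>k. f (n - k) * uinv (d (n - k)) * uinv (d k))"
    for n f d and i j :: 'a
    unfolding serre_def divpow_serre_term
    by (rule sum.reindex_bij_witness[where i = "\<lambda>k. n - k" and j = "\<lambda>k. n - k"]) auto
  have D: "scal u * (1 - var (K i)) = scal u + scal (- u) * var (K i) + scal 0 * var (Kinv i)"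
    for u and i :: 'a
    by (simp add: right_diff_distrib scal_minus)
  show ?thesis
    unfolding Ut_rels_def quantum_rels_def E unfolding D upow_minus[OF assms] divpow_serre_term serre_def ..
qed

section \<open>Triangular exponents and the two kinds of quantum factorial\<close>

lemma triangle_Suc: "Suc n * (Suc n - 1) div 2 = n * (n - 1) div 2 + n"
  by (cases n) auto

lemma double_triangle: "2 * (n * (n - 1) div 2) = n * (n - 1 :: nat)"
  by (induction n) (simp_all add: triangle_Suc)

lemma triangle_add:
  "(m + k) * (m + k - 1) div 2 = m * (m - 1) div 2 + k * (k - 1) div 2 + m * (k :: nat)"
proof -
  have "2 * ((m + k) * (m + k - 1) div 2) = 2 * (m * (m - 1) div 2 + k * (k - 1) div 2 + m * k)"
    unfolding double_triangle distrib_left by (cases m; cases k) (simp_all add: algebra_simps)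
  then show ?thesis by simp
qed

lemma sub_uinv_factor:
  fixes p :: "'k::comm_ring_1"
  assumes "p dvd 1"
  shows "p ^ n - uinv p ^ n = - (uinv p ^ n) * (1 - (p ^ 2) ^ n)"
proof -
  have "uinv p ^ n * (p ^ n * p ^ n) = p ^ n"
    using uinv_mult_self[OF power_dvd_1[OF assms], of n] by (simp add: uinv_power assms flip: mult.assoc)
  then show ?thesis by (simp add: right_diff_distrib power2_eq_square power_mult_distrib)
qed

lemma uinv_sub_uinv:
  fixes p :: "'k::comm_ring_1"
  assumes "p dvd 1" and "1 - p ^ 2 dvd 1"
  shows "uinv (p - uinv p) = - p * uinv (1 - p ^ 2)"
proof (rule uinv_eqI)
  have "(p - uinv p) * (- p * uinv (1 - p ^ 2)) = (uinv p * p) * ((1 - p ^ 2) * uinv (1 - p ^ 2))"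
    using sub_uinv_factor[OF assms(1), of 1] by (simp add: ac_simps)
  then show "(p - uinv p) * (- p * uinv (1 - p ^ 2)) = 1"
    using assms by (simp add: uinv_mult_self mult_uinv)
qed

lemma Ut_fact_Suc: "Ut_fact p (Suc n) = Ut_fact p n * ((1 - p ^ Suc n) * uinv (1 - p))"
  by (simp add: Ut_fact_def prod.nat_ivl_Suc' ac_simps)

lemma U_fact_Suc:
  "U_fact p (Suc n) = U_fact p n * ((upow p (int (Suc n)) - upow p (- int (Suc n))) * uinv (p - uinv p))"
  unfolding U_fact_def by (subst prod.nat_ivl_Suc') (simp_all only: mult.commute le_add1 Suc_eq_plus1_left)

lemma Ut_fact_dvd_1:
  assumes "\<And>n. 0 < n \<Longrightarrow> 1 - p ^ n dvd (1 :: 'k::comm_ring_1)"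
  shows "Ut_fact p n dvd 1"
proof (induction n)
  case 0
  show ?case by (simp add: Ut_fact_def)
next
  case (Suc n)
  have "1 - p dvd 1" using assms[of 1] by simp
  then show ?case
    unfolding Ut_fact_Suc using Suc assms[of "Suc n"] by (intro mult_dvd_1 uinv_dvd_1) simp_all
qed

text \<open>Factor by factor, (1 - p^(2k)) / (1 - p^2) equals p^(k-1) times (p^k - p^-k) / (p -
  p^-1), and the exponents k - 1 add up to n(n-1)/2.\<close>

lemma Ut_fact_square:
  assumes "p dvd 1" and "1 - p ^ 2 dvd (1 :: 'k::comm_ring_1)"
  shows "Ut_fact (p ^ 2) n = p ^ (n * (n - 1) div 2) * U_fact p n"
proof (induction n)
  case 0
  show ?case by (simp add: Ut_fact_def U_fact_def)
next
  case (Suc n)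
  have "p ^ n * ((p ^ Suc n - uinv p ^ Suc n) * uinv (p - uinv p))
      = (p ^ Suc n * uinv p ^ Suc n) * ((1 - (p ^ 2) ^ Suc n) * uinv (1 - p ^ 2))"
    unfolding sub_uinv_factor[OF assms(1)] uinv_sub_uinv[OF assms] by (simp add: ac_simps)
  also have "p ^ Suc n * uinv p ^ Suc n = 1"
    using mult_uinv[OF assms(1)] by (simp only: power_one flip: power_mult_distrib)
  finally have step: "p ^ n * ((upow p (int (Suc n)) - upow p (- int (Suc n))) * uinv (p - uinv p))
      = (1 - (p ^ 2) ^ Suc n) * uinv (1 - p ^ 2)"
    by (simp only: upow_int upow_minus_int mult_1)
  show ?case
    unfolding Ut_fact_Suc U_fact_Suc Suc triangle_Suc power_add step[symmetric] by (simp only: ac_simps)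
qed

lemma uinv_Ut_fact_square:
  assumes "p dvd 1" and "\<And>n. 0 < n \<Longrightarrow> 1 - (p ^ 2) ^ n dvd (1 :: 'k::comm_ring_1)"
  shows "uinv (U_fact p n) = p ^ (n * (n - 1) div 2) * uinv (Ut_fact (p ^ 2) n)"
proof -
  have sq: "1 - p ^ 2 dvd 1" using assms(2)[of 1] by simp
  have "U_fact p n dvd 1"
    using Ut_fact_dvd_1[OF assms(2), of n] unfolding Ut_fact_square[OF assms(1) sq]
    by (metis dvd_mult_right)
  then show ?thesis
    unfolding Ut_fact_square[OF assms(1) sq]
    using mult_uinv[OF power_dvd_1[OF assms(1)], of "n * (n - 1) div 2"]
    by (simp add: uinv_mult power_dvd_1 assms(1) flip: mult.assoc)
qed

text \<open>The left side collects the powers of \<open>p\<close> from the \<open>k\<close>-th power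
  of c_ij and from the two factorials; the right side is the power in the tilde relation times a
  factor that does not depend on \<open>k\<close>. The exponents agree because k(k-1) + mk = bk when
  m + k = b + 1.\<close>

lemma triangle_power_identity:
  fixes p :: "'k::comm_ring_1"
  assumes "m + k = Suc b"
  shows "p ^ (b * k) * p ^ (m * (m - 1) div 2) * p ^ (k * (k - 1) div 2)
    = (p ^ 2) ^ (k * (k - 1) div 2) * p ^ (Suc b * (Suc b - 1) div 2)"
proof -
  let ?t = "\<lambda>n::nat. n * (n - 1) div 2"
  have "2 * ?t k + m * k = b * k"
  proof (cases k)
    case (Suc l)
    then have "b = m + l" using assms by simp
    then show ?thesis unfolding double_triangle Suc by (simp add: algebra_simps)
  qed simp
  then have "b * k + ?t m + ?t k = 2 * ?t k + ?t (Suc b)"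
    using triangle_add[of m k] assms by simp
  then show ?thesis by (simp only: flip: power_add power_mult)
qed

text \<open>To be read with \<open>x\<close> as \<open>pp i j\<close>, \<open>\<theta>\<close> as
  \<open>\<theta> j i\<close> and \<open>b\<close> as \<open>- a i j\<close>. \<open>F\<close> is
  not rescaled, so the two coefficients must already be proportional, and the triangular power left
  over is independent of \<open>k\<close>.\<close>

lemma serre_coeff_F:
  fixes p x \<theta> :: "'k::comm_ring_1"
  assumes p: "p dvd 1" and fact: "\<And>n. 0 < n \<Longrightarrow> 1 - (p ^ 2) ^ n dvd 1"
    and x: "x dvd 1" and \<theta>: "\<theta> dvd 1" and k: "k \<le> Suc b"
  shows "(- (x * p ^ b * uinv \<theta>)) ^ k * uinv (U_fact p (Suc b - k)) * uinv (U_fact p k)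
    = upow (- (\<theta> * uinv x)) (- int k) * (p ^ 2) ^ (k * (k - 1) div 2)
      * uinv (Ut_fact (p ^ 2) (Suc b - k)) * uinv (Ut_fact (p ^ 2) k) * p ^ (Suc b * (Suc b - 1) div 2)"
proof -
  define m where "m = Suc b - k"
  have mk: "m + k = Suc b" using k by (simp add: m_def)
  have V: "uinv (U_fact p n) = p ^ (n * (n - 1) div 2) * uinv (Ut_fact (p ^ 2) n)" for n
    by (rule uinv_Ut_fact_square[OF p fact])
  note id = triangle_power_identity[OF mk, of p]
  let ?t = "\<lambda>n::nat. p ^ (n * (n - 1) div 2)" and ?V = "\<lambda>n. uinv (Ut_fact (p ^ 2) n)"
  have "(- (x * p ^ b * uinv \<theta>)) ^ k = ((- (uinv \<theta> * x)) * p ^ b) ^ k" by (simp add: ac_simps)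
  also have "\<dots> = (- (uinv \<theta> * x)) ^ k * p ^ (b * k)" by (simp only: power_mult_distrib power_mult)
  finally have "(- (x * p ^ b * uinv \<theta>)) ^ k * uinv (U_fact p m) * uinv (U_fact p k)
      = (- (uinv \<theta> * x)) ^ k * (p ^ (b * k) * ?t m * ?t k) * ?V m * ?V k"
    unfolding V by (simp only: ac_simps)
  moreover have "upow (- (\<theta> * uinv x)) (- int k) = (- (uinv \<theta> * x)) ^ k"
    by (simp add: upow_minus_int uinv_minus uinv_mult uinv_uinv mult_dvd_1 uinv_dvd_1 x \<theta>)
  ultimately show ?thesis unfolding id m_def[symmetric] by (simp only: ac_simps)
qed

text \<open>To be read with \<open>x\<close> as \<open>pp i j\<close>, \<open>y\<close> as
  \<open>pp j i\<close>, \<open>\<theta>\<close> as \<open>\<theta> i j\<close> and \<open>b\<close>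
  as \<open>- a i j\<close>; the inverse powers in front come from rescaling \<open>E\<close>. The
  tilde side is reflected, so the exponent identity is needed with \<open>k\<close> and
  \<open>m\<close> exchanged, and \<open>sq\<close> serves to even out the powers of
  \<open>x\<close> and \<open>p\<close>.\<close>

lemma serre_coeff_E:
  fixes p x y \<theta> :: "'k::comm_ring_1"
  assumes p: "p dvd 1" and fact: "\<And>n. 0 < n \<Longrightarrow> 1 - (p ^ 2) ^ n dvd 1"
    and x: "x dvd 1" and y: "y dvd 1" and \<theta>: "\<theta> dvd 1" and k: "k \<le> Suc b"
    and sq: "x ^ 2 = uinv p ^ (2 * b)"
  shows "uinv x ^ (Suc b - k) * uinv y ^ k
      * ((- (x * p ^ b * \<theta>)) ^ k * uinv (U_fact p (Suc b - k)) * uinv (U_fact p k))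
    = upow (- (\<theta> * uinv y)) (- int (Suc b - k)) * (p ^ 2) ^ ((Suc b - k) * (Suc b - k - 1) div 2)
      * uinv (Ut_fact (p ^ 2) (Suc b - k)) * uinv (Ut_fact (p ^ 2) k)
      * (uinv x ^ Suc b * (- (\<theta> * uinv y)) ^ Suc b * uinv p ^ (b * Suc b) * p ^ (Suc b * (Suc b - 1) div 2))"
proof -
  define m where "m = Suc b - k"
  have n: "Suc b = m + k" using k by (simp add: m_def)
  have km: "k + m = Suc b" using n by simp
  let ?t = "\<lambda>n::nat. p ^ (n * (n - 1) div 2)" and ?V = "\<lambda>n. uinv (Ut_fact (p ^ 2) n)"
  let ?X = "uinv x" and ?Y = "uinv y" and ?P = "uinv p"
  let ?z = "- (\<theta> * ?Y)"
  have V: "uinv (U_fact p n) = p ^ (n * (n - 1) div 2) * uinv (Ut_fact (p ^ 2) n)" for n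
    by (rule uinv_Ut_fact_square[OF p fact])
  have cancel: "?P ^ j * p ^ j = 1" for j
    by (simp add: uinv_mult_self p flip: power_mult_distrib)
  \<comment> \<open>The reflected exponent identity calls for \<open>p ^ (b * m)\<close>, while the
    coefficient offers \<open>p ^ (b * k)\<close>; the missing power is inserted together with its
    inverse.\<close>
  have "?t m * ?t k = (?P ^ (b * m) * p ^ (b * m)) * (?t m * ?t k)" by (simp add: cancel)
  also have "\<dots> = ?P ^ (b * m) * (p ^ (b * m) * ?t k * ?t m)" by (simp only: ac_simps)
  also have "\<dots> = ?P ^ (b * m) * ((p ^ 2) ^ (m * (m - 1) div 2) * ?t (Suc b))"
    unfolding triangle_power_identity[OF km] ..
  finally have 1: "?t m * ?t k = ?P ^ (b * m) * ((p ^ 2) ^ (m * (m - 1) div 2) * ?t (Suc b))" .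
  \<comment> \<open>By \<open>sq\<close> the element \<open>x * p ^ b\<close> squares to 1, so it
    equals its own inverse. The powers of \<open>?X\<close> then add up to \<open>Suc b\<close>, and
    the powers of \<open>?P\<close> to \<open>b * Suc b\<close>, both independent of
    \<open>k\<close>.\<close>
  have "x * p ^ b = (x * ?X) * (x * p ^ b)" by (simp add: mult_uinv x)
  also have "\<dots> = x ^ 2 * ?X * p ^ b" by (simp only: power2_eq_square ac_simps)
  also have "\<dots> = ?X * ?P ^ b * (?P ^ b * p ^ b)"
    unfolding sq mult_2 power_add by (simp only: ac_simps)
  finally have "x * p ^ b = ?X * ?P ^ b" by (simp add: cancel)
  then have "?X ^ m * ?Y ^ k * (- (x * p ^ b * \<theta>)) ^ k = ?X ^ m * (?X * ?P ^ b * ?z) ^ k"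
    by (simp add: ac_simps flip: power_mult_distrib)
  also have "\<dots> = ?X ^ Suc b * ?P ^ (b * k) * ?z ^ k"
    unfolding n power_add power_mult_distrib power_mult by (simp only: ac_simps)
  finally have 2: "?X ^ m * ?Y ^ k * (- (x * p ^ b * \<theta>)) ^ k = ?X ^ Suc b * ?P ^ (b * k) * ?z ^ k" .
  have "upow ?z (- int m) * ?z ^ Suc b = (uinv ?z * ?z) ^ m * ?z ^ k"
    unfolding n power_add power_mult_distrib upow_minus_int by (simp only: ac_simps)
  also have "uinv ?z * ?z = 1"
    by (rule uinv_mult_self) (simp add: mult_dvd_1 uinv_dvd_1 y \<theta>)
  finally have 3: "upow ?z (- int m) * ?z ^ Suc b = ?z ^ k" by simp
  have 4: "?P ^ (b * Suc b) = ?P ^ (b * k) * ?P ^ (b * m)"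
    unfolding n distrib_left power_add by (rule mult.commute)
  have "?X ^ m * ?Y ^ k * ((- (x * p ^ b * \<theta>)) ^ k * uinv (U_fact p m) * uinv (U_fact p k))
      = (?X ^ m * ?Y ^ k * (- (x * p ^ b * \<theta>)) ^ k) * (?t m * ?t k) * ?V m * ?V k"
    unfolding V by (simp only: ac_simps)
  also have "\<dots> = ?X ^ Suc b * ?P ^ (b * k) * (upow ?z (- int m) * ?z ^ Suc b)
      * (?P ^ (b * m) * ((p ^ 2) ^ (m * (m - 1) div 2) * ?t (Suc b))) * ?V m * ?V k"
    unfolding 1 2 3 ..
  finally show ?thesis unfolding 4 m_def[symmetric] by (simp only: ac_simps)
qed


section \<open>Scalings with prescribed ratios\<close>

text \<open>Linear independence gives integral coordinates r_j of \<beta>, and the map is \<beta>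
  |-> product of s_j^(r_j). It is finite for every \<beta> although there may be infinitely many
  simple roots; negative coordinates are allowed because the s_j are units.\<close>

lemma root_lattice_character:
  fixes \<alpha> :: "'i \<Rightarrow> 'p::ab_group_add" and s :: "'i \<Rightarrow> 'k::comm_ring_1"
  assumes inj: "inj \<alpha>" and indep: "zmod.independent (range \<alpha>)" and s: "\<And>j. s j dvd 1"
  obtains f where "\<And>\<beta>. f \<beta> dvd 1"
    and "\<And>\<beta> j. \<beta> \<in> root_lattice \<alpha> \<Longrightarrow> f (\<beta> + \<alpha> j) = s j * f \<beta>"
proof
  define r where "r \<beta> j = zmod.representation (range \<alpha>) \<beta> (\<alpha> j)" for \<beta> j
  define f where "f \<beta> = (\<Prod>j\<in>{j. r \<beta> j \<noteq> 0}. upow (s j) (r \<beta> j))" for \<beta>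
  have fin: "finite {j. r \<beta> j \<noteq> 0}" for \<beta>
  proof -
    have "\<alpha> ` {j. r \<beta> j \<noteq> 0} \<subseteq> {b. zmod.representation (range \<alpha>) \<beta> b \<noteq> 0}"
      by (auto simp: r_def)
    then have "finite (\<alpha> ` {j. r \<beta> j \<noteq> 0})"
      using zmod.finite_representation finite_subset by blast
    then show ?thesis using inj by (meson finite_imageD inj_on_subset subset_UNIV)
  qed
  have f_eq: "f \<beta> = (\<Prod>j\<in>S. upow (s j) (r \<beta> j))" if "finite S" "{j. r \<beta> j \<noteq> 0} \<subseteq> S" for \<beta> S
    unfolding f_def using that by (intro prod.mono_neutral_left) auto
  have unit_prod: "(\<Prod>j\<in>S. upow (s j) (g j)) dvd 1" for S :: "'i set" and g
    by (induction S rule: infinite_finite_induct) (auto intro!: mult_dvd_1 upow_dvd_1 s)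
  then show "f \<beta> dvd 1" for \<beta> unfolding f_def .
  fix \<beta> j assume \<beta>: "\<beta> \<in> root_lattice \<alpha>"
  have r_add: "r (\<beta> + \<alpha> j) l = r \<beta> l + (if l = j then 1 else 0)" for l
  proof -
    have "zmod.representation (range \<alpha>) (\<beta> + \<alpha> j)
        = (\<lambda>b. zmod.representation (range \<alpha>) \<beta> b + zmod.representation (range \<alpha>) (\<alpha> j) b)"
      using \<beta> by (intro zmod.representation_add[OF indep]) (auto simp: root_lattice_def intro: zmod.span_base)
    then show ?thesis
      using inj by (simp add: r_def zmod.representation_basis[OF indep] inj_eq)
  qed
  \<comment> \<open>The support may gain or lose \<open>j\<close>, so both products are taken over
    one set that contains it.\<close>
  let ?S = "insert j ({l. r \<beta> l \<noteq> 0} \<union> {l. r (\<beta> + \<alpha> j) l \<noteq> 0})"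
  have S: "finite ?S" using fin by simp
  have "f (\<beta> + \<alpha> j) = (\<Prod>l\<in>?S. upow (s l) (r \<beta> l + (if l = j then 1 else 0)))"
    using f_eq[OF S, of "\<beta> + \<alpha> j"] by (simp add: r_add subset_iff)
  also have "\<dots> = (\<Prod>l\<in>?S. upow (s l) (r \<beta> l) * (if l = j then s j else 1))"
    by (rule prod.cong) (auto simp: upow_add_1 s mult.commute)
  also have "\<dots> = (\<Prod>l\<in>?S. upow (s l) (r \<beta> l)) * (\<Prod>l\<in>?S. if l = j then s j else 1)"
    by (rule prod.distrib)
  also have "(\<Prod>l\<in>?S. if l = j then s j else 1) = s j" using S by (simp add: prod.delta)
  also have "(\<Prod>l\<in>?S. upow (s l) (r \<beta> l)) = f \<beta>" by (rule f_eq[OF S, symmetric]) auto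
  finally show "f (\<beta> + \<alpha> j) = s j * f \<beta>" by (simp add: mult.commute)
qed

text \<open>Translates the character of the root lattice to each coset through a chosen base point.\<close>

lemma scaling_with_ratios:
  fixes \<alpha> :: "'i \<Rightarrow> 'p::ab_group_add" and s :: "'i \<Rightarrow> 'k::comm_ring_1"
  assumes "inj \<alpha>" and "zmod.independent (range \<alpha>)" and "\<And>j. s j dvd 1"
  obtains x where "\<And>\<mu>. x \<mu> dvd 1" and "\<And>\<mu> j. x (\<mu> + \<alpha> j) = s j * x \<mu>"
proof -
  obtain f where f: "\<And>\<beta>. f \<beta> dvd 1"
    "\<And>\<beta> j. \<beta> \<in> root_lattice \<alpha> \<Longrightarrow> f (\<beta> + \<alpha> j) = s j * f \<beta>"
    using root_lattice_character[OF assms(1,2), of s] assms(3) by metis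
  define base where "base \<mu> = (SOME \<nu>. \<mu> - \<nu> \<in> root_lattice \<alpha>)" for \<mu>
  have base: "\<mu> - base \<mu> \<in> root_lattice \<alpha>" for \<mu>
    unfolding base_def by (rule someI[of _ \<mu>]) (simp add: root_lattice_closed)
  \<comment> \<open>Weights of the same coset define the same predicate, so the choice operator
    returns the same base point for them.\<close>
  have base_add: "base (\<mu> + \<alpha> j) = base \<mu>" for \<mu> j
  proof -
    have \<alpha>: "\<alpha> j \<in> root_lattice \<alpha>" using gen_degree_in_root_lattice[of \<alpha> "E j"] by simp
    have "\<mu> + \<alpha> j - \<nu> \<in> root_lattice \<alpha> \<longleftrightarrow> \<mu> - \<nu> \<in> root_lattice \<alpha>" for \<nu>
      using root_lattice_closed(2)[OF _ \<alpha>, of "\<mu> - \<nu>"] root_lattice_closed(3)[OF _ \<alpha>, of "\<mu> + \<alpha> j - \<nu>"]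
      by (auto simp: algebra_simps)
    then show ?thesis by (simp add: base_def)
  qed
  show thesis
  proof
    show "f (\<mu> - base \<mu>) dvd 1" for \<mu> by (rule f)
    have "\<mu> + \<alpha> j - base \<mu> = \<mu> - base \<mu> + \<alpha> j" for \<mu> j by simp
    then show "f (\<mu> + \<alpha> j - base (\<mu> + \<alpha> j)) = s j * f (\<mu> - base \<mu>)" for \<mu> j
      using f(2)[OF base] by (simp only: base_add)
  qed
qed

section \<open>The two twists\<close>

lemma cartan_weight_scalar_add:
  assumes "cartan_datum a \<alpha> h" and "p dvd 1"
  shows "upow p (h i (\<mu> + \<alpha> j)) = upow p (a i j) * upow p (h i \<mu>)"
proof -
  interpret cartan_datum a \<alpha> h by fact
  show ?thesis using assms(2) by (simp add: h_add h_\<alpha> upow_add mult.commute)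
qed

lemma quantum_twist_Ut_U:
  fixes a :: "'i \<Rightarrow> 'i \<Rightarrow> int" and \<alpha> :: "'i \<Rightarrow> 'p::ab_group_add" and p :: "'i \<Rightarrow> 'k::comm_ring_1"
  assumes cd: "cartan_datum a \<alpha> h"
    and \<theta>: "\<And>i j. \<theta> i j dvd 1" and pp: "\<And>i j. pp i j dvd 1" and p: "\<And>i. p i dvd 1"
    and fact: "\<And>i n. 0 < n \<Longrightarrow> 1 - (p i ^ 2) ^ n dvd 1"
    and pp_sq: "\<And>i j. pp i j ^ 2 = upow (p i) (2 * a i j)"
    and G: "\<And>\<mu> \<beta>. \<mu> \<in> G \<Longrightarrow> \<beta> \<in> root_lattice \<alpha> \<Longrightarrow> \<mu> + \<beta> \<in> G"
    and \<chi>: "weight_characters \<alpha> h G pp p \<chi>"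
    and t\<theta>_def: "\<And>i j. t\<theta> i j = \<theta> i j * uinv (pp j i)" and tp_def: "\<And>i. tp i = p i ^ 2"
  shows "quantum_twist \<alpha> G (\<lambda>i j. nat (1 - a i j))
    (\<lambda>i \<mu>. upow (tp i) (h i \<mu>)) (\<lambda>i j. upow (tp i) (a i j)) t\<theta>
    (\<lambda>i. uinv (1 - tp i)) (\<lambda>i. - uinv (1 - tp i)) (\<lambda>_. 0) (Ut_coeff_F a t\<theta> tp) (Ut_coeff_E a t\<theta> tp)
    \<chi> pp \<theta> (\<lambda>_. 0) (\<lambda>i. uinv (p i - uinv (p i))) (\<lambda>i. - uinv (p i - uinv (p i)))
    (U_coeff_F a \<theta> pp p) (U_coeff_E a \<theta> pp p)
    (\<lambda>i \<mu>. p i * uinv (pp i i) * uinv (\<chi> i \<mu>)) (\<lambda>_ _. 1) (\<lambda>i j. uinv (pp i j)) (\<lambda>_ _. 1)"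
proof -
  interpret cartan_datum a \<alpha> h by fact
  have tp: "tp i dvd 1" for i by (simp add: tp_def power_dvd_1 p)
  have \<chi>_unit: "\<chi> i \<mu> dvd 1" and \<chi>_sq: "\<chi> i \<mu> ^ 2 = upow (p i) (2 * h i \<mu>)"
    and \<chi>_add: "\<chi> i (\<mu> + \<alpha> j) = pp i j * \<chi> i \<mu>" if "\<mu> \<in> G" for i j \<mu>
    using \<chi> that by (simp_all add: weight_characters_def)
  let ?x = "\<lambda>i \<mu>. p i * uinv (pp i i) * uinv (\<chi> i \<mu>)"
  have x_add: "?x i (\<mu> + \<alpha> j) = uinv (pp i j) * ?x i \<mu>" if "\<mu> \<in> G" for i j \<mu>
    by (simp add: \<chi>_add that uinv_mult pp \<chi>_unit ac_simps)
  have G_diff: "\<mu> - \<alpha> j \<in> G" if "\<mu> \<in> G" for \<mu> j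
    using G[OF that gen_degree_in_root_lattice, of "F j"] by simp
  have x_diff: "?x i (\<mu> - \<alpha> j) = pp i j * ?x i \<mu>" if "\<mu> \<in> G" for i j \<mu>
  proof -
    have "?x i \<mu> = uinv (pp i j) * ?x i (\<mu> - \<alpha> j)"
      using x_add[OF G_diff[OF that], of i j j] by (simp only: diff_add_cancel)
    then have "pp i j * ?x i \<mu> = (pp i j * uinv (pp i j)) * ?x i (\<mu> - \<alpha> j)"
      by (simp only: mult.assoc)
    then show ?thesis by (simp add: mult_uinv pp)
  qed
  \<comment> \<open>Off the diagonal \<open>a i j\<close> is not positive, so everything is
    expressed by the natural number \<open>- a i j\<close>, as \<open>serre_coeff_F\<close> and
    \<open>serre_coeff_E\<close> expect.\<close>
  have exponents: "nat (1 - a i j) = Suc (nat (- a i j))" "upow (p i) (- a i j) = p i ^ nat (- a i j)"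
    "pp i j ^ 2 = uinv (p i) ^ (2 * nat (- a i j))" if "i \<noteq> j" for i j
  proof -
    have "a i j = - int (nat (- a i j))" using a_offdiag[OF that] by simp
    then obtain b where b: "a i j = - int b" by blast
    have "2 * a i j = - int (2 * b)" by (simp add: b)
    then have "pp i j ^ 2 = uinv (p i) ^ (2 * b)" unfolding pp_sq by (simp only: upow_minus_int)
    then show "nat (1 - a i j) = Suc (nat (- a i j))" "upow (p i) (- a i j) = p i ^ nat (- a i j)"
      "pp i j ^ 2 = uinv (p i) ^ (2 * nat (- a i j))"
      by (simp_all add: b nat_add_distrib)
  qed
  show ?thesis
  proof
    fix i j :: 'i and \<mu> assume \<mu>: "\<mu> \<in> G"
    \<comment> \<open>The factor \<open>pp i j\<close> that \<open>?x i\<close> acquires under the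
      shift by \<open>- \<alpha> j\<close> is exactly the quotient of \<open>\<theta> j i\<close> by
      \<open>t\<theta> j i\<close>.\<close>
    show "?x i (\<mu> - \<alpha> j) * 1 * t\<theta> j i = \<theta> j i * (?x i \<mu> * 1)"
    proof -
      have "pp i j * ?x i \<mu> * 1 * t\<theta> j i = (pp i j * uinv (pp i j)) * (\<theta> j i * (?x i \<mu> * 1))"
        unfolding t\<theta>_def mult_1_right by (simp only: ac_simps)
      then show ?thesis unfolding x_diff[OF \<mu>] mult_uinv[OF pp] mult_1 .
    qed
    show "?x i (\<mu> - \<alpha> i) * 1 * (uinv (1 - tp i) + - uinv (1 - tp i) * upow (tp i) (h i \<mu>) + 0 * uinv (upow (tp i) (h i \<mu>)))
      = 0 + uinv (p i - uinv (p i)) * \<chi> i \<mu> + - uinv (p i - uinv (p i)) * uinv (\<chi> i \<mu>)"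
    proof -
      have sq: "1 - p i ^ 2 dvd 1" using fact[of 1 i] by simp
      have x: "?x i (\<mu> - \<alpha> i) = p i * uinv (\<chi> i \<mu>)"
      proof -
        have "pp i i * ?x i \<mu> = (pp i i * uinv (pp i i)) * (p i * uinv (\<chi> i \<mu>))"
          by (simp only: ac_simps)
        then show ?thesis unfolding x_diff[OF \<mu>] mult_uinv[OF pp] mult_1 .
      qed
      \<comment> \<open>The eigenvalue of the tilde \<open>K i\<close> is the square of
        \<open>\<chi> i \<mu>\<close>, so multiplying 1 minus this eigenvalue by the inverse of
        \<open>\<chi> i \<mu>\<close> gives the antisymmetric difference.\<close>
      have "uinv (\<chi> i \<mu>) * upow (tp i) (h i \<mu>) = (uinv (\<chi> i \<mu>) * \<chi> i \<mu>) * \<chi> i \<mu>"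
        unfolding tp_def upow_square[OF p] \<chi>_sq[OF \<mu>, symmetric] unfolding power2_eq_square
        by (simp only: mult.assoc)
      then have "uinv (\<chi> i \<mu>) * upow (tp i) (h i \<mu>) = \<chi> i \<mu>"
        by (simp add: uinv_mult_self \<chi>_unit[OF \<mu>])
      then have "?x i (\<mu> - \<alpha> i) * (1 - upow (tp i) (h i \<mu>)) = p i * (uinv (\<chi> i \<mu>) - \<chi> i \<mu>)"
        unfolding x by (simp add: algebra_simps)
      then have "?x i (\<mu> - \<alpha> i) * (1 - upow (tp i) (h i \<mu>)) * uinv (1 - tp i)
          = p i * (uinv (\<chi> i \<mu>) - \<chi> i \<mu>) * uinv (1 - tp i)" by simp
      then show ?thesis
        unfolding uinv_sub_uinv[OF p sq] tp_def by (simp add: algebra_simps)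
    qed
  next
    fix i j :: 'i assume ij: "i \<noteq> j"
    let ?b = "nat (- a i j)"
    note e = exponents[OF ij]
    show "\<exists>C. C dvd 1 \<and> (\<forall>k\<le>nat (1 - a i j). 1 ^ (nat (1 - a i j) - k) * 1 ^ k * U_coeff_F a \<theta> pp p i j k
      = Ut_coeff_F a t\<theta> tp i j k * C)"
    proof (intro exI conjI allI impI)
      show "p i ^ (Suc ?b * (Suc ?b - 1) div 2) dvd 1" by (intro power_dvd_1 p)
      fix k assume "k \<le> nat (1 - a i j)"
      then have "k \<le> Suc ?b" by (simp only: e)
      from serre_coeff_F[OF p fact pp \<theta> this]
      show "1 ^ (nat (1 - a i j) - k) * 1 ^ k * U_coeff_F a \<theta> pp p i j k
        = Ut_coeff_F a t\<theta> tp i j k * p i ^ (Suc ?b * (Suc ?b - 1) div 2)"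
        unfolding e(1,2) tp_def t\<theta>_def power_one mult_1 .
    qed
    show "\<exists>C. C dvd 1 \<and> (\<forall>k\<le>nat (1 - a i j). uinv (pp i j) ^ (nat (1 - a i j) - k) * uinv (pp j i) ^ k
      * U_coeff_E a \<theta> pp p i j k = Ut_coeff_E a t\<theta> tp i j k * C)"
    proof (intro exI conjI allI impI)
      let ?C = "uinv (pp i j) ^ Suc ?b * (- (\<theta> i j * uinv (pp j i))) ^ Suc ?b * uinv (p i) ^ (?b * Suc ?b)
        * p i ^ (Suc ?b * (Suc ?b - 1) div 2)"
      have "- (\<theta> i j * uinv (pp j i)) dvd 1" by (simp add: mult_dvd_1 uinv_dvd_1 \<theta> pp)
      then show "?C dvd 1" by (intro mult_dvd_1 power_dvd_1 uinv_dvd_1 p pp)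
      fix k assume "k \<le> nat (1 - a i j)"
      then have "k \<le> Suc ?b" by (simp only: e)
      from serre_coeff_E[OF p fact pp pp \<theta> this e(3)]
      show "uinv (pp i j) ^ (nat (1 - a i j) - k) * uinv (pp j i) ^ k * U_coeff_E a \<theta> pp p i j k
        = Ut_coeff_E a t\<theta> tp i j k * ?C"
        unfolding e(1,2) tp_def t\<theta>_def .
    qed
  qed (use G \<chi>_unit \<chi>_add x_add in \<open>auto simp: tp p pp upow_dvd_1 cartan_weight_scalar_add[OF cd]
        intro!: mult_dvd_1 uinv_dvd_1\<close>)
qed

lemma exchange_factor:
  fixes a b c :: "'k::comm_ring_1"
  assumes "u * b = c * u'"
  shows "a * b * (u * t * v * w) = u' * t * v * w * (a * c)"
proof -
  have "a * b * (u * t * v * w) = a * (u * b) * (t * v * w)" by (simp only: ac_simps)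
  then show ?thesis unfolding assms by (simp only: ac_simps)
qed

lemma equivalent_Mod_Ut:
  fixes a :: "'i \<Rightarrow> 'i \<Rightarrow> int" and \<alpha> :: "'i \<Rightarrow> 'p::ab_group_add" and p :: "'i \<Rightarrow> 'k::comm_ring_1"
  assumes cd: "cartan_datum a \<alpha> h"
    and \<theta>: "\<And>i j. \<theta> i j dvd 1" and \<theta>': "\<And>i j. \<theta>' i j dvd 1" and p: "\<And>i. p i dvd 1"
    and prod: "\<And>i j. \<theta>' i j * \<theta>' j i = \<theta> i j * \<theta> j i" and diag: "\<And>i. \<theta>' i i = \<theta> i i"
    and G: "\<And>\<mu> \<beta>. \<mu> \<in> G \<Longrightarrow> \<beta> \<in> root_lattice \<alpha> \<Longrightarrow> \<mu> + \<beta> \<in> G"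
  shows "equivalent_categories (Mod_Ut T a \<alpha> h G \<theta> p) (Mod_Ut T a \<alpha> h G \<theta>' p)"
proof -
  interpret cartan_datum a \<alpha> h by fact
  \<comment> \<open>The index type carries no order, so one is obtained from the well-ordering
    theorem in order to select one of (i, j) and (j, i).\<close>
  obtain r :: "'i rel" where "well_order_on UNIV r" using well_order_on by blast
  then have r: "antisym r" "total r" by (auto simp: order_on_defs)
  define s where "s i j = (if i \<noteq> j \<and> (i, j) \<in> r then \<theta>' i j * uinv (\<theta> i j) else 1)" for i j
  have s_unit: "s i j dvd 1" for i j by (simp add: s_def mult_dvd_1 uinv_dvd_1 \<theta> \<theta>')
  \<comment> \<open>For a selected pair the equation \<open>bwd\<close> holds by the choice of
    \<open>s\<close>, and \<open>fwd\<close> follows from it because \<open>prod\<close> prescribes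
    the same product for both families.\<close>
  have s: "s i j * \<theta>' j i = s j i * \<theta> j i" for i j
  proof -
    have fwd: "s i j * \<theta>' j i = s j i * \<theta> j i" and bwd: "s j i * \<theta>' i j = s i j * \<theta> i j"
      if "i \<noteq> j" "(i, j) \<in> r" for i j
    proof -
      have "(j, i) \<notin> r" using that r(1) by (auto dest: antisymD)
      then have s1: "s i j = \<theta>' i j * uinv (\<theta> i j)" "s j i = 1" using that by (simp_all add: s_def)
      have "\<theta>' i j * uinv (\<theta> i j) * \<theta>' j i = (\<theta> i j * \<theta> j i) * uinv (\<theta> i j)"
        unfolding prod[symmetric] by (simp only: ac_simps)
      also have "\<dots> = \<theta> j i * (\<theta> i j * uinv (\<theta> i j))" by (simp only: ac_simps)
      finally show "s i j * \<theta>' j i = s j i * \<theta> j i" by (simp add: s1 mult_uinv \<theta>)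
      show "s j i * \<theta>' i j = s i j * \<theta> i j" by (simp add: s1 mult.assoc uinv_mult_self \<theta>)
    qed
    consider "i = j" | "i \<noteq> j" "(i, j) \<in> r" | "j \<noteq> i" "(j, i) \<in> r" using r(2) by (auto simp: total_on_def)
    then show ?thesis using fwd bwd diag by cases auto
  qed
  have "\<exists>x. (\<forall>\<mu>. x \<mu> dvd 1) \<and> (\<forall>\<mu> j. x (\<mu> + \<alpha> j) = s i j * x \<mu>)" for i
    using scaling_with_ratios[OF \<alpha>_inj \<alpha>_independent, of "s i"] s_unit by metis
  then obtain x where x_unit: "\<And>i \<mu>. x i \<mu> dvd 1" and x_add: "\<And>i \<mu> j. x i (\<mu> + \<alpha> j) = s i j * x i \<mu>"
    by metis
  \<comment> \<open>With this choice the product of \<open>E i\<close> and \<open>F i\<close> is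
    rescaled by 1, as the unchanged inhomogeneous term requires.\<close>
  define y where "y i \<mu> = uinv (x i (\<mu> - \<alpha> i))" for i \<mu>
  have y_unit: "y i \<mu> dvd 1" for i \<mu> by (simp add: y_def uinv_dvd_1 x_unit)
  have x_diff: "x i \<mu> = s i j * x i (\<mu> - \<alpha> j)" for i j \<mu> using x_add[of i "\<mu> - \<alpha> j" j] by simp
  \<comment> \<open>Inversion and the reversed direction of the shift compensate each other, so
    \<open>x\<close> and \<open>y\<close> have the same ratios and both Serre relations are governed
    by \<open>s\<close>.\<close>
  have y_diff: "y i (\<mu> - \<alpha> j) = s i j * y i \<mu>" for i j \<mu>
  proof -
    have *: "\<mu> - \<alpha> j - \<alpha> i = \<mu> - \<alpha> i - \<alpha> j" by simp
    have "y i \<mu> = uinv (s i j) * y i (\<mu> - \<alpha> j)"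
      using x_diff[of i "\<mu> - \<alpha> i" j] by (simp add: y_def * uinv_mult s_unit x_unit)
    then show ?thesis using mult_uinv[OF s_unit, of i j] by (simp flip: mult.assoc)
  qed
  have "quantum_twist \<alpha> G (\<lambda>i j. nat (1 - a i j))
    (\<lambda>i \<mu>. upow (p i) (h i \<mu>)) (\<lambda>i j. upow (p i) (a i j)) \<theta>
    (\<lambda>i. uinv (1 - p i)) (\<lambda>i. - uinv (1 - p i)) (\<lambda>_. 0) (Ut_coeff_F a \<theta> p) (Ut_coeff_E a \<theta> p)
    (\<lambda>i \<mu>. upow (p i) (h i \<mu>)) (\<lambda>i j. upow (p i) (a i j)) \<theta>'
    (\<lambda>i. uinv (1 - p i)) (\<lambda>i. - uinv (1 - p i)) (\<lambda>_. 0) (Ut_coeff_F a \<theta>' p) (Ut_coeff_E a \<theta>' p)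
    x y s s"
  proof
    fix i j :: 'i and \<mu> assume "\<mu> \<in> G"
    have "y j \<mu> = s j i * y j (\<mu> + \<alpha> i)" using y_diff[of j "\<mu> + \<alpha> i" i] by simp
    then have "x i (\<mu> - \<alpha> j) * y j \<mu> * \<theta> j i = x i (\<mu> - \<alpha> j) * y j (\<mu> + \<alpha> i) * (s j i * \<theta> j i)"
      by (simp only: ac_simps)
    also have "\<dots> = \<theta>' j i * ((s i j * x i (\<mu> - \<alpha> j)) * y j (\<mu> + \<alpha> i))"
      unfolding s[symmetric] by (simp only: ac_simps)
    finally show "x i (\<mu> - \<alpha> j) * y j \<mu> * \<theta> j i = \<theta>' j i * (x i \<mu> * y j (\<mu> + \<alpha> i))"
      unfolding x_diff[symmetric] .
    show "x i (\<mu> - \<alpha> i) * y i \<mu> * (uinv (1 - p i) + - uinv (1 - p i) * upow (p i) (h i \<mu>) + 0 * uinv (upow (p i) (h i \<mu>)))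
      = uinv (1 - p i) + - uinv (1 - p i) * upow (p i) (h i \<mu>) + 0 * uinv (upow (p i) (h i \<mu>))"
      by (simp add: y_def mult_uinv x_unit)
  next
    fix i j :: 'i assume "i \<noteq> j"
    have swap: "uinv (- \<theta>' j i) * s j i = s i j * uinv (- \<theta> j i)" for i j
    proof (rule unit_swap_sides)
      show "- \<theta>' j i * s i j = s j i * - \<theta> j i" using s[of i j] by (simp add: mult.commute)
    qed (rule mult_uinv, simp add: \<theta> \<theta>')+
    show "\<exists>C. C dvd 1 \<and> (\<forall>k\<le>nat (1 - a i j). s i j ^ (nat (1 - a i j) - k) * s j i ^ k * Ut_coeff_F a \<theta>' p i j k
      = Ut_coeff_F a \<theta> p i j k * C)"
    proof (intro exI conjI allI impI)
      \<comment> \<open>Passing from \<open>\<theta>' j i\<close> to \<open>\<theta> j i\<close>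
        with exponent \<open>k\<close> turns \<open>s j i ^ k\<close> into \<open>s i j ^ k\<close>,
        which completes the power of \<open>s i j\<close> to the full degree.\<close>
      show "s i j ^ nat (1 - a i j) dvd 1" by (intro power_dvd_1 s_unit)
      fix k assume "k \<le> nat (1 - a i j)"
      then have split: "s i j ^ nat (1 - a i j) = s i j ^ (nat (1 - a i j) - k) * s i j ^ k"
        by (simp flip: power_add)
      have *: "upow (- \<theta>' j i) (- int k) * s j i ^ k = s i j ^ k * upow (- \<theta> j i) (- int k)"
        unfolding upow_minus_int by (simp only: swap flip: power_mult_distrib)
      show "s i j ^ (nat (1 - a i j) - k) * s j i ^ k * Ut_coeff_F a \<theta>' p i j k
          = Ut_coeff_F a \<theta> p i j k * s i j ^ nat (1 - a i j)"
        unfolding split by (rule exchange_factor[OF *])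
    qed
    show "\<exists>C. C dvd 1 \<and> (\<forall>k\<le>nat (1 - a i j). s i j ^ (nat (1 - a i j) - k) * s j i ^ k * Ut_coeff_E a \<theta>' p i j k
      = Ut_coeff_E a \<theta> p i j k * C)"
    proof (intro exI conjI allI impI)
      \<comment> \<open>The reflected coefficient carries the complementary exponent, so here the
        power of \<open>s i j\<close> is exchanged and \<open>s j i\<close> survives.\<close>
      show "s j i ^ nat (1 - a i j) dvd 1" by (intro power_dvd_1 s_unit)
      fix k assume "k \<le> nat (1 - a i j)"
      let ?m = "nat (1 - a i j) - k"
      have split: "s j i ^ nat (1 - a i j) = s j i ^ ?m * s j i ^ k"
        using \<open>k \<le> nat (1 - a i j)\<close> by (simp flip: power_add)
      have *: "upow (- \<theta>' i j) (- int ?m) * s i j ^ ?m = s j i ^ ?m * upow (- \<theta> i j) (- int ?m)"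
        unfolding upow_minus_int by (simp only: swap flip: power_mult_distrib)
      show "s i j ^ ?m * s j i ^ k * Ut_coeff_E a \<theta>' p i j k
          = Ut_coeff_E a \<theta> p i j k * s j i ^ nat (1 - a i j)"
        unfolding split mult.commute[of "s i j ^ ?m"] mult.commute[of "s j i ^ ?m"]
        by (rule exchange_factor[OF *])
    qed
  qed (use G in \<open>simp_all add: p s_unit x_unit y_unit upow_dvd_1 x_add y_diff cartan_weight_scalar_add[OF cd]\<close>)
  then show ?thesis
    unfolding Mod_Ut_def Ut_rels_eq[OF p] by (rule quantum_twist.equivalent_cats(1))
qed

theorem proposition3p4:
  fixes a :: "'i \<Rightarrow> 'i \<Rightarrow> int"
    and \<alpha> :: "'i \<Rightarrow> 'p::ab_group_add"
    and h :: "'i \<Rightarrow> 'p \<Rightarrow> int"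
    and t\<theta> \<theta> pp :: "'i \<Rightarrow> 'i \<Rightarrow> 'k::comm_ring_1"
    and tp p :: "'i \<Rightarrow> 'k"
    and G :: "'p set"
  assumes "cartan_datum a \<alpha> h"
    and "\<And>i j. t\<theta> i j dvd 1" and "\<And>i. tp i dvd 1"
    and "\<And>i j. \<theta> i j dvd 1" and "\<And>i j. pp i j dvd 1" and "\<And>i. p i dvd 1"
    and "\<And>i n. 0 < n \<Longrightarrow> 1 - tp i ^ n dvd 1"
    and "\<And>i j. t\<theta> i j = \<theta> i j * uinv (pp j i)"
    and "\<And>i j. upow (tp i) (a i j) = pp i j ^ 2"
    and "\<And>i. tp i = p i ^ 2"
    and "\<And>i j. t\<theta> i j * t\<theta> j i = upow (tp i) (- a i j)"
    and "\<And>i. t\<theta> i i = uinv (tp i)"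
    and "\<And>\<mu> \<beta>. \<mu> \<in> G \<Longrightarrow> \<beta> \<in> root_lattice \<alpha> \<Longrightarrow> \<mu> + \<beta> \<in> G"
  shows
    \<comment> \<open>(i)\<close>
    "((\<forall>i j. pp i j ^ 2 = upow (p i) (2 * a i j)) \<and>
      (\<forall>i j. (pp i j * pp j i) * uinv (\<theta> i j * \<theta> j i) = upow (p i) (2 * a i j)) \<and>
      (\<forall>i. pp i i * uinv (\<theta> i i) = p i ^ 2) \<and>
      (\<forall>i n. 0 < n \<longrightarrow> 1 - p i ^ n dvd 1)) \<and>
    \<comment> \<open>(ii)\<close>
     (\<forall>\<chi>. weight_characters \<alpha> h G pp p \<chi> \<longrightarrow>
        equivalent_categories (Mod_Ut TYPE('v) a \<alpha> h G t\<theta> tp) (Mod_U TYPE('v) a \<alpha> G \<theta> pp p \<chi>) \<and>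
        equivalent_categories (O_int_Ut TYPE('v) a \<alpha> h G t\<theta> tp) (O_int_U TYPE('v) a \<alpha> G \<theta> pp p \<chi>)) \<and>
    \<comment> \<open>(iii)\<close>
     (\<forall>i j. upow (tp i) (a i j) = upow (tp j) (a j i)) \<and>
     (\<forall>t\<theta>'. (\<forall>i j. t\<theta>' i j dvd 1) \<and>
        (\<forall>i j. t\<theta>' i j * t\<theta>' j i = upow (tp i) (- a i j)) \<and>
        (\<forall>i. t\<theta>' i i = uinv (tp i)) \<longrightarrow>
        equivalent_categories (Mod_Ut TYPE('v) a \<alpha> h G t\<theta>' tp) (Mod_Ut TYPE('v) a \<alpha> h G t\<theta> tp))"
proof -
  note cd = assms(1) and units = assms(2-6) and t\<theta>_eq = assms(8) and tp_pp = assms(9) and tp_eq = assms(10)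
    and t\<theta>_prod = assms(11) and t\<theta>_diag = assms(12) and G = assms(13)
  note [simp] = units
  have pp_sq: "pp i j ^ 2 = upow (p i) (2 * a i j)" for i j
    using tp_pp[of i j] by (simp add: tp_eq upow_square)
  have ratio: "(pp i j * pp j i) * uinv (\<theta> i j * \<theta> j i) = upow (p i) (2 * a i j)" for i j
  proof -
    \<comment> \<open>Both factors \<open>pp\<close> cancel, which expresses
      \<open>\<theta> i j * \<theta> j i\<close> through the product of the tilde parameters, known
      from \<open>t\<theta>_prod\<close>.\<close>
    have "(t\<theta> i j * t\<theta> j i) * (pp i j * pp j i) = (uinv (pp i j) * pp i j) * (uinv (pp j i) * pp j i) * (\<theta> i j * \<theta> j i)"
      unfolding t\<theta>_eq by (simp only: ac_simps)
    then have "\<theta> i j * \<theta> j i = (t\<theta> i j * t\<theta> j i) * (pp i j * pp j i)"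
      by (simp add: uinv_mult_self)
    then have "uinv (\<theta> i j * \<theta> j i) = upow (tp i) (a i j) * uinv (pp i j * pp j i)"
      by (simp add: t\<theta>_prod upow_minus uinv_mult mult_dvd_1 uinv_dvd_1 upow_dvd_1 uinv_uinv)
    then have "(pp i j * pp j i) * uinv (\<theta> i j * \<theta> j i)
        = (pp i j * pp j i) * uinv (pp i j * pp j i) * upow (tp i) (a i j)"
      by (simp only: ac_simps)
    then show ?thesis by (simp add: mult_uinv mult_dvd_1 tp_eq upow_square)
  qed
  have diag: "pp i i * uinv (\<theta> i i) = p i ^ 2" for i
  proof (rule unit_mult_left_cancel[THEN iffD1])
    \<comment> \<open>After multiplication by the unit \<open>t\<theta> i i\<close> both sides are
      1.\<close>
    show "t\<theta> i i dvd 1" by simp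
    have "t\<theta> i i * (pp i i * uinv (\<theta> i i)) = (uinv (pp i i) * pp i i) * (\<theta> i i * uinv (\<theta> i i))"
      unfolding t\<theta>_eq by (simp only: ac_simps)
    then show "t\<theta> i i * (pp i i * uinv (\<theta> i i)) = t\<theta> i i * p i ^ 2"
      by (simp add: uinv_mult_self mult_uinv t\<theta>_diag flip: tp_eq)
  qed
  have not_root_of_unity: "1 - p i ^ n dvd 1" if "0 < n" for i n
  proof -
    have "1 - tp i ^ n = (1 - p i ^ n) * (1 + p i ^ n)"
      by (simp add: tp_eq algebra_simps power2_eq_square flip: power_mult_distrib)
    then show ?thesis using assms(7)[OF that, of i] by (metis dvd_mult_left)
  qed
  have symm: "upow (tp i) (a i j) = upow (tp j) (a j i)" for i j
  proof -
    \<comment> \<open>Both sides equal \<open>t\<theta> i j * t\<theta> j i\<close>, which is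
      symmetric in \<open>i\<close> and \<open>j\<close>.\<close>
    have "uinv (upow (tp i) (a i j)) = uinv (upow (tp j) (a j i))"
      using t\<theta>_prod[of i j] t\<theta>_prod[of j i] by (simp add: upow_minus mult.commute)
    then have "uinv (uinv (upow (tp i) (a i j))) = uinv (uinv (upow (tp j) (a j i)))" by simp
    then show ?thesis by (simp add: uinv_uinv upow_dvd_1)
  qed
  have fact: "1 - (p i ^ 2) ^ n dvd 1" if "0 < n" for i n
    using assms(7)[OF that, of i] by (simp add: tp_eq)
  have equiv_U: "equivalent_categories (Mod_Ut TYPE('v) a \<alpha> h G t\<theta> tp) (Mod_U TYPE('v) a \<alpha> G \<theta> pp p \<chi>) \<and>
      equivalent_categories (O_int_Ut TYPE('v) a \<alpha> h G t\<theta> tp) (O_int_U TYPE('v) a \<alpha> G \<theta> pp p \<chi>)"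
    if \<chi>: "weight_characters \<alpha> h G pp p \<chi>" for \<chi>
    unfolding O_int_Ut_def O_int_U_def Mod_Ut_def Mod_U_def Ut_rels_eq[OF units(2)] U_rels_eq
    by (intro conjI; rule quantum_twist.equivalent_cats,
        rule quantum_twist_Ut_U[OF cd units(3-5) _ pp_sq _ \<chi> t\<theta>_eq tp_eq])
       (use fact G in blast)+
  have equiv_Ut: "equivalent_categories (Mod_Ut TYPE('v) a \<alpha> h G t\<theta>' tp) (Mod_Ut TYPE('v) a \<alpha> h G t\<theta> tp)"
    if "\<forall>i j. t\<theta>' i j dvd 1" "\<forall>i j. t\<theta>' i j * t\<theta>' j i = upow (tp i) (- a i j)" "\<forall>i. t\<theta>' i i = uinv (tp i)" for t\<theta>'
  proof -
    show ?thesis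
      by (rule equivalent_Mod_Ut[OF cd]) (use that t\<theta>_prod t\<theta>_diag G in simp_all)
  qed
  show ?thesis
    using pp_sq ratio diag not_root_of_unity symm equiv_U equiv_Ut by simp
qed

end
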